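(* Let $A$ and $B$ be JB-algebras. (a) If $f\colon A_+^\circ\to B_+^\circ$ is a bijective Thompson's metric isometry with $f(e)=e$, then the map $S\colon A\to B$ given by $Sa:=\log f(\exp(a))$ is a bijective linear $\|\cdot\|$-isometry. (b) If $f\colon\overline{A}_+^\circ\to\overline{B}_+^\circ$ is a bijective Hilbert's metric isometry with $f(\overline{e})=\overline{e}$, then the map $S\colon[A]\to[B]$ given by $S[a]:=\log f(\exp([a]))$ is a bijective linear $\|\cdot\|_v$-isometry.
   Context: A JB-algebra is a real Banach space $A$ with a commutative bilinear product $\circ$ satisfying $a\circ(b\circ a^2)=(a\circ b)\circ a^2$, $\|a\circ b\|\le\|a\|\|b\|$, $\|a^2\|=\|a\|^2$ and $\|a^2\|\le\|a^2+b^2\|$ for all $a,b$; all JB-algebras are assumed to have a unit $e$. $\sigma(a)$ denotes the spectrum of $a$. $A_+=\{a^2: a\in A\}$ is the cone, $\le$ the induced partial order, and $A_+^\circ$ its interior, i.e. the set of elements with strictly positive spectrum. $\log$ and $\exp$ are defined by the continuous functional calculus. For $a\in A_+^\circ$, $\overline{a}=\{\lambda a:\lambda>0\}$, and $\overline{A}_+^\circ$ is the set of these rays. For $a,b\in A_+^\circ$ let $M(a/b)=\inf\{\beta>0: a\le\beta b\}$. Thompson's metric on $A_+^\circ$ is $d_T(a,b)=\log\max\{M(a/b),M(b/a)\}$; Hilbert's metric on $\overline{A}_+^\circ$ is $d_H(\overline{a},\overline{b})=\log(M(a/b)M(b/a))$. $[A]:=A/\mathrm{Span}(e)$, with classes $[a]$,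 carries the variation norm $\|[a]\|_v=\max\sigma(a)-\min\sigma(a)$. The maps $\exp\colon[A]\to\overline{A}_+^\circ$, $\exp([a])=\overline{\exp(a)}$, and $\log\colon\overline{A}_+^\circ\to[A]$, $\log\overline{a}=[\log a]$, are well defined mutually inverse bijections. *)

theory Defs
  imports "HOL-Analysis.Analysis"
begin

text \<open>The product gets its own symbol, since a type may already carry a non-Jordan multiplication.
  Bilinearity follows from linearity in the left argument and commutativity.
  The axiom \<open>e \<noteq> 0\<close> excludes the zero algebra, whose spectra are empty, so
  that \<open>max \<sigma>(a)\<close> and the logarithms in the two metrics would be meaningless there.\<close>

class jb_algebra = banach +
  fixes jprod :: "'a \<Rightarrow> 'a \<Rightarrow> 'a"  (infixl \<open>\<circ>\<^sub>J\<close> 70)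
    and jone :: 'a  (\<open>e\<^sub>J\<close>)
  assumes jprod_commute: "a \<circ>\<^sub>J b = b \<circ>\<^sub>J a"
    and jprod_add_left: "(a + b) \<circ>\<^sub>J c = a \<circ>\<^sub>J c + b \<circ>\<^sub>J c"
    and jprod_scaleR_left: "scaleR r a \<circ>\<^sub>J b = scaleR r (a \<circ>\<^sub>J b)"
    and jordan_identity: "a \<circ>\<^sub>J (b \<circ>\<^sub>J (a \<circ>\<^sub>J a)) = (a \<circ>\<^sub>J b) \<circ>\<^sub>J (a \<circ>\<^sub>J a)"
    and jprod_norm_le: "norm (a \<circ>\<^sub>J b) \<le> norm a * norm b"
    and norm_jsquare: "norm (a \<circ>\<^sub>J a) = (norm a)\<^sup>2"
    and norm_jsquare_le: "norm (a \<circ>\<^sub>J a) \<le> norm (a \<circ>\<^sub>J a + b \<circ>\<^sub>J b)"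
    and jprod_one_left: "e\<^sub>J \<circ>\<^sub>J a = a"
    and jone_neq_zero: "e\<^sub>J \<noteq> 0"

section \<open>Spectrum and continuous functional calculus\<close>

definition closed_jsubalgebra :: "'a::jb_algebra set \<Rightarrow> bool" where
  "closed_jsubalgebra S \<longleftrightarrow> subspace S \<and> closed S \<and> (\<forall>x\<in>S. \<forall>y\<in>S. x \<circ>\<^sub>J y \<in> S)"

text \<open>The JB-algebra \<open>JB(a, e)\<close> generated by \<open>a\<close> and \<open>e\<close>.\<close>

definition jb_gen :: "'a::jb_algebra \<Rightarrow> 'a set" where
  "jb_gen a = closed_jsubalgebra hull {a, e\<^sub>J}"

text \<open>Invertibility is taken in \<open>JB(a, e)\<close>, which is associative. An element \<open>b\<close> of the whole algebra
  with \<open>(a - re) \<circ> b = e\<close> is not enough for Jordan invertibility.\<close>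

definition jb_spectrum :: "'a::jb_algebra \<Rightarrow> real set" where
  "jb_spectrum a = {r. \<not> (\<exists>b\<in>jb_gen a. (a - r *\<^sub>R e\<^sub>J) \<circ>\<^sub>J b = e\<^sub>J)}"

text \<open>\<open>is_cfc a \<Phi>\<close>: the map \<open>\<Phi>\<close> is the isometric isomorphism of \<open>C(\<sigma>(a))\<close> onto \<open>JB(a, e)\<close> that sends
  the constant \<open>1\<close> to \<open>e\<close> and the identity to \<open>a\<close>. Elements of \<open>C(\<sigma>(a))\<close> are represented by
  functions on all reals that are continuous on \<open>\<sigma>(a)\<close>; linearity and the norm condition force
  \<open>\<Phi> f\<close> to depend only on \<open>f\<close> restricted to \<open>\<sigma>(a)\<close>.\<close>

definition is_cfc :: "'a::jb_algebra \<Rightarrow> ((real \<Rightarrow> real) \<Rightarrow> 'a) \<Rightarrow> bool" where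
  "is_cfc a \<Phi> \<longleftrightarrow>
     (let C = {f. continuous_on (jb_spectrum a) f} in
       \<Phi> (\<lambda>_. 1) = e\<^sub>J \<and> \<Phi> (\<lambda>t. t) = a \<and>
       (\<forall>f\<in>C. \<forall>g\<in>C. \<Phi> (\<lambda>t. f t + g t) = \<Phi> f + \<Phi> g) \<and>
       (\<forall>c. \<forall>f\<in>C. \<Phi> (\<lambda>t. c * f t) = c *\<^sub>R \<Phi> f) \<and>
       (\<forall>f\<in>C. \<forall>g\<in>C. \<Phi> (\<lambda>t. f t * g t) = \<Phi> f \<circ>\<^sub>J \<Phi> g) \<and>
       (\<forall>f\<in>C. norm (\<Phi> f) = (SUP t\<in>jb_spectrum a. \<bar>f t\<bar>)) \<and>
       \<Phi> ` C = jb_gen a)"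

text \<open>\<open>jb_cfc f a\<close> is \<open>f(a)\<close>, for \<open>f\<close> continuous on \<open>\<sigma>(a)\<close>.\<close>

definition jb_cfc :: "(real \<Rightarrow> real) \<Rightarrow> 'a::jb_algebra \<Rightarrow> 'a" where
  "jb_cfc f a = (THE b. \<exists>\<Phi>. is_cfc a \<Phi> \<and> b = \<Phi> f)"

definition jb_exp :: "'a::jb_algebra \<Rightarrow> 'a" where
  "jb_exp a = jb_cfc exp a"

definition jb_log :: "'a::jb_algebra \<Rightarrow> 'a" where
  "jb_log a = jb_cfc ln a"

section \<open>The cone and the two metrics\<close>

definition jb_cone :: "'a::jb_algebra set" where
  "jb_cone = range (\<lambda>a. a \<circ>\<^sub>J a)"

definition jb_le :: "'a::jb_algebra \<Rightarrow> 'a \<Rightarrow> bool"  (infix \<open>\<le>\<^sub>J\<close> 50) where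
  "a \<le>\<^sub>J b \<longleftrightarrow> b - a \<in> jb_cone"

definition jb_pos :: "'a::jb_algebra set" where
  "jb_pos = interior jb_cone"

definition jb_M :: "'a::jb_algebra \<Rightarrow> 'a \<Rightarrow> real" where
  "jb_M a b = Inf {\<beta>. \<beta> > 0 \<and> a \<le>\<^sub>J \<beta> *\<^sub>R b}"

definition thompson_dist :: "'a::jb_algebra \<Rightarrow> 'a \<Rightarrow> real" where
  "thompson_dist a b = ln (max (jb_M a b) (jb_M b a))"

definition ray :: "'a::jb_algebra \<Rightarrow> 'a set" where
  "ray a = {c *\<^sub>R a |c. c > 0}"

definition jb_rays :: "'a::jb_algebra set set" where
  "jb_rays = ray ` jb_pos"

text \<open>Here and below, \<open>THE\<close> selects the common value over all representatives of a ray or class.\<close>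

definition hilbert_dist :: "'a::jb_algebra set \<Rightarrow> 'a set \<Rightarrow> real" where
  "hilbert_dist R R' = (THE d. \<forall>a\<in>R. \<forall>b\<in>R'. d = ln (jb_M a b * jb_M b a))"

section \<open>The quotient by the span of the unit\<close>

definition unit_equiv :: "'a::jb_algebra \<Rightarrow> 'a \<Rightarrow> bool" where
  "unit_equiv a b \<longleftrightarrow> a - b \<in> span {e\<^sub>J}"

quotient_type (overloaded) 'a mod_unit = "'a::jb_algebra" / unit_equiv
  morphisms rep_mod_unit unit_class
proof (rule equivpI)
  show "reflp (unit_equiv :: 'a \<Rightarrow> 'a \<Rightarrow> bool)"
    by (simp add: reflp_def unit_equiv_def span_zero)
  show "symp (unit_equiv :: 'a \<Rightarrow> 'a \<Rightarrow> bool)"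
    by (metis minus_diff_eq span_neg sympI unit_equiv_def)
  show "transp (unit_equiv :: 'a \<Rightarrow> 'a \<Rightarrow> bool)"
  proof (rule transpI)
    fix a b c :: 'a
    assume "unit_equiv a b" "unit_equiv b c"
    then have "(a - b) + (b - c) \<in> span {e\<^sub>J}"
      unfolding unit_equiv_def by (rule span_add)
    then show "unit_equiv a c"
      by (simp add: unit_equiv_def)
  qed
qed

instantiation mod_unit :: (jb_algebra) real_vector
begin

lift_definition zero_mod_unit :: "'a mod_unit" is 0 .

lift_definition plus_mod_unit :: "'a mod_unit \<Rightarrow> 'a mod_unit \<Rightarrow> 'a mod_unit" is "(+)"
  unfolding unit_equiv_def by (metis add_diff_add span_add)

lift_definition uminus_mod_unit :: "'a mod_unit \<Rightarrow> 'a mod_unit" is uminus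
  unfolding unit_equiv_def by (metis minus_diff_minus span_neg)

lift_definition minus_mod_unit :: "'a mod_unit \<Rightarrow> 'a mod_unit \<Rightarrow> 'a mod_unit" is "(-)"
proof -
  fix a a' b b' :: 'a
  assume "unit_equiv a a'" "unit_equiv b b'"
  then have "(a - a') - (b - b') \<in> span {e\<^sub>J}"
    unfolding unit_equiv_def by (rule span_diff)
  then show "unit_equiv (a - b) (a' - b')"
    by (simp add: unit_equiv_def algebra_simps)
qed

lift_definition scaleR_mod_unit :: "real \<Rightarrow> 'a mod_unit \<Rightarrow> 'a mod_unit" is scaleR
  unfolding unit_equiv_def by (metis scaleR_diff_right span_mul)

instance
  by standard (transfer; simp add: unit_equiv_def span_zero algebra_simps)+

end

text \<open>\<open>Sup\<close> and \<open>Inf\<close> are the maximum and minimum, as spectra are nonempty and compact. The variation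
  norm is kept as a separate function and not as an instance of class \<^class>\<open>norm\<close>.\<close>

definition var_norm :: "'a::jb_algebra mod_unit \<Rightarrow> real" where
  "var_norm x = (THE r. \<forall>a. unit_class a = x \<longrightarrow> r = Sup (jb_spectrum a) - Inf (jb_spectrum a))"

definition exp_class :: "'a::jb_algebra mod_unit \<Rightarrow> 'a set" where
  "exp_class x = (THE R. \<forall>a. unit_class a = x \<longrightarrow> R = ray (jb_exp a))"

definition log_ray :: "'a::jb_algebra set \<Rightarrow> 'a mod_unit" where
  "log_ray R = (THE x. \<forall>a\<in>R. x = unit_class (jb_log a))"

end

(*
  Write every positive invertible element as exp x and transport both metrics to A. With
  P_v = exp (L_v), the exponential of multiplication by v, one has exp v = P_v e. Each P_v is an
  automorphism of the cone, because b + t (v o b) >= (b + (t/2) v)^2 - (t^2/4) v^2 for 0 <= b <= e,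
  so that the generator L_v does not leave the cone to first order. Moreover U_(P_v b) = P_v U_b P_v,
  since both sides solve the same linear differential equation in the parameter of v. Hence the
  inverse of P_v b is P_(-v) applied to the inverse of b, inversion reverses the order, and
  a |-> P_v (P_(-v) a)^(-1) is an isometric reflection in the point exp v for both metrics. By
  Vaisala's argument such reflections force f to map the midpoint exp (x/2) of e and exp x to the
  midpoint of e and f (exp x), so S commutes with halving. Near e both metrics are asymptotic to the
  order unit norm, respectively the variation norm, of the difference of logarithms. Therefore S is
  an isometry of these norms, and linear by the Mazur-Ulam theorem.
*)
theory Submission
  imports Defs "HOL-Computational_Algebra.Fundamental_Theorem_Algebra"
begin

section \<open>The order induced by the unit\<close>

text \<open>The axioms mention norms only, so order, spectrum and functional calculus have to be
  extracted from them. Positivity is encoded by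
  \<open>norm (s *\<^sub>R e\<^sub>J - x) \<le> s\<close>, which is visibly stable under sums; that
  it means being a square comes out only when the functional calculus supplies square roots.
  Whatever concerns a single element takes place in the associative algebra \<open>jb_gen a\<close>.
  Two elements share no such algebra in general, and for them only operator identities and
  exponentials of multiplications are available. Both metrics symmetrize the same one-sided function
  \<open>log_M\<close>: Thompson's metric is the maximum of \<open>log_M x y\<close> and
  \<open>log_M y x\<close>, Hilbert's is their sum. Likewise \<open>norm\<close> and
  \<open>var_norm\<close> are the maximum and the sum of \<open>unit_sup x\<close> and
  \<open>unit_sup (- x)\<close>. The geometry is therefore proved once for \<open>log_M\<close>, and
  the two cases part only at the end. Reflections are brought in because metric midpoints are in
  general not unique here, so preservation of distances does not by itself single out
  \<open>exp (x/2)\<close>.\<close>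

lemma jprod_bounded_bilinear: "bounded_bilinear ((\<circ>\<^sub>J) :: 'a::jb_algebra \<Rightarrow> 'a \<Rightarrow> 'a)"
proof
  fix a a' b b' :: 'a and r :: real
  show "(a + a') \<circ>\<^sub>J b = a \<circ>\<^sub>J b + a' \<circ>\<^sub>J b" by (rule jprod_add_left)
  show "a \<circ>\<^sub>J (b + b') = a \<circ>\<^sub>J b + a \<circ>\<^sub>J b'"
    by (metis jprod_add_left jprod_commute)
  show "(r *\<^sub>R a) \<circ>\<^sub>J b = r *\<^sub>R (a \<circ>\<^sub>J b)" by (rule jprod_scaleR_left)
  show "a \<circ>\<^sub>J (r *\<^sub>R b) = r *\<^sub>R (a \<circ>\<^sub>J b)"
    by (metis jprod_scaleR_left jprod_commute)
  show "\<exists>K. \<forall>a b :: 'a. norm (a \<circ>\<^sub>J b) \<le> norm a * norm b * K"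
    by (rule exI[of _ 1]) (simp add: jprod_norm_le)
qed

interpretation jprod: bounded_bilinear "(\<circ>\<^sub>J) :: 'a::jb_algebra \<Rightarrow> 'a \<Rightarrow> 'a"
  by (rule jprod_bounded_bilinear)

lemma jprod_one_right [simp]: "a \<circ>\<^sub>J e\<^sub>J = a"
  by (simp add: jprod_commute[of a] jprod_one_left)

declare jprod_one_left [simp] jone_neq_zero [simp] jprod.zero_left [simp] jprod.zero_right [simp]

lemma norm_jone [simp]: "norm (e\<^sub>J :: 'a::jb_algebra) = 1"
proof -
  have "norm (e\<^sub>J :: 'a) = (norm (e\<^sub>J :: 'a))\<^sup>2"
    using norm_jsquare[of "e\<^sub>J :: 'a"] by simp
  then show ?thesis
    by (simp add: power2_eq_square)
qed

lemma jsquare_diff: "a \<circ>\<^sub>J a - b \<circ>\<^sub>J b = (a + b) \<circ>\<^sub>J (a - b)"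
  using jprod_commute[of a b] by (simp add: jprod.add_left jprod.diff_right)

lemma closed_jsubalgebraD:
  assumes "closed_jsubalgebra S"
  shows "subspace S" "closed S" "\<And>x y. x \<in> S \<Longrightarrow> y \<in> S \<Longrightarrow> x \<circ>\<^sub>J y \<in> S"
  using assms by (auto simp: closed_jsubalgebra_def)

lemma closed_jsubalgebra_UNIV [simp]: "closed_jsubalgebra UNIV"
  by (simp add: closed_jsubalgebra_def)

text \<open>With \<open>w = e - v\<close>, the equation \<open>w\<^sup>2 = e - u\<close> is the fixed point equation \<open>v = (u + v\<^sup>2) / 2\<close>.
  Only commutativity is needed to solve it, because \<open>v\<^sup>2 - v'\<^sup>2 = (v + v') \<circ> (v - v')\<close>.\<close>

lemma jsqrt_one_minus:
  fixes u :: "'a::jb_algebra"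
  assumes S: "closed_jsubalgebra S" and u: "u \<in> S" "norm u < 1"
  shows "\<exists>v\<in>S. (e\<^sub>J - v) \<circ>\<^sub>J (e\<^sub>J - v) = e\<^sub>J - u"
proof -
  note S' = closed_jsubalgebraD[OF S]
  \<comment> \<open>The smaller root of \<open>r\<^sup>2 - 2 r + norm u = 0\<close>. It makes the
    ball of radius \<open>r\<close> invariant under \<open>F\<close>, and since \<open>r < 1\<close>
    it serves as the contraction constant as well.\<close>
  define r where "r = 1 - sqrt (1 - norm u)"
  have r: "0 \<le> r" "r < 1" and "(1 - r)\<^sup>2 = 1 - norm u"
    using u by (auto simp: r_def)
  then have r2: "norm u + r\<^sup>2 = 2 * r"
    by (simp add: power2_eq_square algebra_simps)
  define B where "B = S \<inter> cball 0 r"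
  define F where "F v = (1/2) *\<^sub>R (u + v \<circ>\<^sub>J v)" for v
  have "\<exists>!v. v \<in> B \<and> F v = v"
  proof (rule Banach_fix[of B r])
    show "complete B"
      unfolding B_def using S'(2) by (simp add: closed_Int complete_eq_closed)
    show "B \<noteq> {}"
      using subspace_0[OF S'(1)] r by (auto simp: B_def)
    show "F ` B \<subseteq> B"
    proof
      fix x assume "x \<in> F ` B"
      then obtain v where v: "v \<in> S" "norm v \<le> r" and x: "x = F v"
        by (auto simp: B_def)
      have "norm (u + v \<circ>\<^sub>J v) \<le> norm u + (norm v)\<^sup>2"
        using norm_triangle_ineq[of u "v \<circ>\<^sub>J v"] by (simp add: norm_jsquare)
      also have "\<dots> \<le> norm u + r\<^sup>2"
        using v by (simp add: power_mono)
      finally have "norm x \<le> r"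
        using r2 by (simp add: x F_def)
      moreover have "x \<in> S"
        using v u S' by (simp add: x F_def subspace_add subspace_scale)
      ultimately show "x \<in> B" by (simp add: B_def)
    qed
    show "dist (F x) (F y) \<le> r * dist x y" if "x \<in> B" "y \<in> B" for x y
    proof -
      have "F x - F y = (1/2) *\<^sub>R ((x + y) \<circ>\<^sub>J (x - y))"
        unfolding F_def jsquare_diff[symmetric] by (simp add: algebra_simps)
      then have "dist (F x) (F y) \<le> (norm (x + y) / 2) * dist x y"
        using jprod_norm_le[of "x + y" "x - y"] by (simp add: dist_norm)
      moreover have "norm (x + y) / 2 \<le> r"
        using that norm_triangle_ineq[of x y] by (simp add: B_def)
      ultimately show ?thesis
        by (meson mult_right_mono order_trans zero_le_dist)
    qed
  qed (use r in auto)
  then obtain v where v: "v \<in> S" "F v = v" by (auto simp: B_def)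
  have "u + v \<circ>\<^sub>J v = 2 *\<^sub>R F v"
    by (simp add: F_def)
  then have "(e\<^sub>J - v) \<circ>\<^sub>J (e\<^sub>J - v) = e\<^sub>J - u"
    unfolding v(2) by (simp add: jprod.diff_left jprod.diff_right algebra_simps scaleR_2)
  with v(1) show ?thesis by blast
qed

text \<open>This turns out to be the cone of squares; see \<open>order_cone_eq_jb_cone\<close>.\<close>

definition order_cone :: "'a::jb_algebra set" where
  "order_cone = {x. \<exists>s. norm (s *\<^sub>R e\<^sub>J - x) \<le> s}"

text \<open>Adding the two radii is enough, whereas a sum of two squares is not visibly a square.
  This is the gain of describing the cone by the norm.\<close>

lemma order_cone_add:
  assumes "x \<in> order_cone" "y \<in> order_cone"
  shows "x + y \<in> order_cone"
proof -
  obtain s t where "norm (s *\<^sub>R e\<^sub>J - x) \<le> s" "norm (t *\<^sub>R e\<^sub>J - y) \<le> t"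
    using assms by (auto simp: order_cone_def)
  then have "norm ((s + t) *\<^sub>R e\<^sub>J - (x + y)) \<le> s + t"
    using norm_triangle_ineq[of "s *\<^sub>R e\<^sub>J - x" "t *\<^sub>R e\<^sub>J - y"] by (simp add: algebra_simps)
  then show ?thesis by (auto simp: order_cone_def)
qed

lemma order_cone_scaleR:
  assumes "x \<in> order_cone" "0 \<le> c"
  shows "c *\<^sub>R x \<in> order_cone"
proof -
  obtain s where "norm (s *\<^sub>R e\<^sub>J - x) \<le> s"
    using assms by (auto simp: order_cone_def)
  then have "norm (c *\<^sub>R (s *\<^sub>R e\<^sub>J - x)) \<le> c * s"
    using assms(2) by (simp add: mult_left_mono)
  then show ?thesis
    by (auto simp: order_cone_def scaleR_diff_right intro!: exI[of _ "c * s"])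
qed

lemma order_cone_one_minus:
  assumes "norm x \<le> s"
  shows "s *\<^sub>R e\<^sub>J - x \<in> order_cone"
  using assms by (auto simp: order_cone_def intro!: exI[of _ s])

lemma order_cone_one_plus:
  assumes "norm x \<le> s"
  shows "x + s *\<^sub>R e\<^sub>J \<in> order_cone"
  using order_cone_one_minus[of "- x" s] assms by (simp add: add.commute)

lemma order_cone_unit: "0 \<le> s \<Longrightarrow> s *\<^sub>R e\<^sub>J \<in> order_cone"
  using order_cone_one_minus[of 0 s] by simp

lemma order_cone_zero [simp]: "0 \<in> order_cone"
  using order_cone_unit[of 0] by simp

text \<open>\<open>e\<^sub>J - a \<circ>\<^sub>J a\<close> is itself a square by
  \<open>jsqrt_one_minus\<close>; adding \<open>a \<circ>\<^sub>J a\<close> to it gives the unit, so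
  the axiom \<open>norm_jsquare_le\<close> bounds its norm by 1.\<close>

lemma norm_one_minus_square:
  fixes a :: "'a::jb_algebra"
  assumes "norm a < 1"
  shows "norm (e\<^sub>J - a \<circ>\<^sub>J a) \<le> 1"
proof -
  have "norm (a \<circ>\<^sub>J a) < 1"
    using assms by (simp add: norm_jsquare power_less_one_iff)
  then obtain v where v: "(e\<^sub>J - v) \<circ>\<^sub>J (e\<^sub>J - v) = e\<^sub>J - a \<circ>\<^sub>J a"
    using jsqrt_one_minus[of UNIV "a \<circ>\<^sub>J a"] by auto
  then have "norm (e\<^sub>J - a \<circ>\<^sub>J a) \<le> norm (e\<^sub>J - a \<circ>\<^sub>J a + a \<circ>\<^sub>J a)"
    using norm_jsquare_le[of "e\<^sub>J - v" a] by simp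
  then show ?thesis by simp
qed

lemma norm_unit_minus_square:
  fixes a :: "'a::jb_algebra"
  assumes "(norm a)\<^sup>2 < s"
  shows "norm (s *\<^sub>R e\<^sub>J - a \<circ>\<^sub>J a) \<le> s"
proof -
  have s: "0 < s"
    using assms by (meson le_less_trans zero_le_power2)
  define b where "b = (1 / sqrt s) *\<^sub>R a"
  have "norm a < sqrt s"
    using assms by (simp add: real_less_rsqrt)
  then have "norm b < 1"
    using s by (simp add: b_def divide_less_eq)
  then have "norm (e\<^sub>J - b \<circ>\<^sub>J b) \<le> 1"
    by (rule norm_one_minus_square)
  moreover have "s *\<^sub>R e\<^sub>J - a \<circ>\<^sub>J a = s *\<^sub>R (e\<^sub>J - b \<circ>\<^sub>J b)"
    using s by (simp add: b_def jprod.scaleR_left jprod.scaleR_right algebra_simps)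
  ultimately show ?thesis
    using s by (simp add: mult_left_le)
qed

lemma square_in_order_cone: "a \<circ>\<^sub>J a \<in> order_cone"
  using norm_unit_minus_square[of a "(norm a)\<^sup>2 + 1"] by (auto simp: order_cone_def)

text \<open>With \<open>t = s + \<epsilon>\<close> the shifted element is
  \<open>t *\<^sub>R (e\<^sub>J - u)\<close>, and the shift by \<epsilon> is what makes
  \<open>norm u < 1\<close> strict. That the root stays in \<open>S\<close> is needed later to
  multiply positive elements of \<open>jb_gen a\<close>.\<close>

lemma order_cone_plus_unit_square:
  assumes "closed_jsubalgebra S" "e\<^sub>J \<in> S" "x \<in> S" "x \<in> order_cone" "0 < \<epsilon>"
  shows "\<exists>w\<in>S. w \<circ>\<^sub>J w = x + \<epsilon> *\<^sub>R e\<^sub>J"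
proof -
  note S = closed_jsubalgebraD[OF assms(1)]
  obtain s where s: "norm (s *\<^sub>R e\<^sub>J - x) \<le> s"
    using assms by (auto simp: order_cone_def)
  then have s0: "0 \<le> s"
    using norm_ge_zero order_trans by blast
  define t where "t = s + \<epsilon>"
  have t: "0 < t" using s0 assms by (simp add: t_def)
  define u where "u = (1 / t) *\<^sub>R (s *\<^sub>R e\<^sub>J - x)"
  have "norm u < 1"
    using s t assms by (simp add: u_def t_def divide_less_eq)
  moreover have "u \<in> S"
    using assms S by (simp add: u_def subspace_scale subspace_diff)
  ultimately obtain v where v: "v \<in> S" "(e\<^sub>J - v) \<circ>\<^sub>J (e\<^sub>J - v) = e\<^sub>J - u"
    using jsqrt_one_minus[OF assms(1)] by blast
  have "(sqrt t *\<^sub>R (e\<^sub>J - v)) \<circ>\<^sub>J (sqrt t *\<^sub>R (e\<^sub>J - v)) = t *\<^sub>R (e\<^sub>J - u)"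
    using t by (simp add: jprod.scaleR_left jprod.scaleR_right v(2))
  also have "\<dots> = x + \<epsilon> *\<^sub>R e\<^sub>J"
    using t by (simp add: u_def scaleR_diff_right) (simp add: t_def algebra_simps)
  finally show ?thesis
    using v(1) assms(2) S by (meson subspace_diff subspace_scale)
qed

text \<open>Up to a small multiple of the unit, \<open>x\<close> is a square, to which
  \<open>norm_unit_minus_square\<close> applies. The point is that the witness in
  \<open>order_cone\<close> can be chosen from the norm alone, hence uniformly along a convergent
  sequence; this makes the cone closed.\<close>

lemma norm_unit_minus_order_cone:
  fixes x :: "'a::jb_algebra"
  assumes "x \<in> order_cone" "norm x < s"
  shows "norm (s *\<^sub>R e\<^sub>J - x) \<le> s"
proof -
  have le: "norm (s *\<^sub>R e\<^sub>J - x) \<le> s + \<epsilon>" if \<epsilon>: "0 < \<epsilon>" "\<epsilon> < s - norm x" for \<epsilon>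
  proof -
    obtain w where w: "w \<circ>\<^sub>J w = x + \<epsilon> *\<^sub>R e\<^sub>J"
      using order_cone_plus_unit_square[of UNIV x \<epsilon>] assms \<epsilon> by auto
    have "(norm w)\<^sup>2 = norm (x + \<epsilon> *\<^sub>R e\<^sub>J)"
      by (simp add: norm_jsquare[symmetric] w)
    also have "\<dots> < s"
      using norm_triangle_ineq[of x "\<epsilon> *\<^sub>R e\<^sub>J"] \<epsilon> by simp
    finally have "norm (s *\<^sub>R e\<^sub>J - (x + \<epsilon> *\<^sub>R e\<^sub>J)) \<le> s"
      using norm_unit_minus_square[of w s] w by simp
    then show ?thesis
      using norm_triangle_ineq[of "s *\<^sub>R e\<^sub>J - (x + \<epsilon> *\<^sub>R e\<^sub>J)" "\<epsilon> *\<^sub>R e\<^sub>J"] \<epsilon> by simp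
  qed
  show ?thesis
  proof (rule field_le_epsilon)
    fix d :: real assume "0 < d"
    define m where "m = min d ((s - norm x) / 2)"
    have "0 < m" "m < s - norm x" "m \<le> d"
      using \<open>0 < d\<close> assms(2) by (auto simp: m_def min_def field_simps)
    then show "norm (s *\<^sub>R e\<^sub>J - x) \<le> s + d"
      using le[of m] by simp
  qed
qed

lemma closed_order_cone: "closed (order_cone :: 'a::jb_algebra set)"
  unfolding closed_sequential_limits
proof (intro allI impI, elim conjE)
  fix f :: "nat \<Rightarrow> 'a" and x
  assume f: "\<forall>n. f n \<in> order_cone" "f \<longlonglongrightarrow> x"
  define s where "s = norm x + 1"
  have "eventually (\<lambda>n. norm (f n) < s) sequentially"
    using order_tendstoD(2)[OF tendsto_norm[OF f(2)], of s] by (simp add: s_def)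
  then have "eventually (\<lambda>n. norm (s *\<^sub>R e\<^sub>J - f n) \<le> s) sequentially"
    by eventually_elim (use f norm_unit_minus_order_cone in auto)
  moreover have "(\<lambda>n. norm (s *\<^sub>R e\<^sub>J - f n)) \<longlonglongrightarrow> norm (s *\<^sub>R e\<^sub>J - x)"
    by (intro tendsto_intros f)
  ultimately have "norm (s *\<^sub>R e\<^sub>J - x) \<le> s"
    using tendsto_upperbound trivial_limit_sequentially by blast
  then show "x \<in> order_cone"
    by (auto simp: order_cone_def)
qed

lemma order_cone_epsilon:
  fixes x :: "'a::jb_algebra"
  assumes "\<And>\<epsilon>. 0 < \<epsilon> \<Longrightarrow> x + \<epsilon> *\<^sub>R y \<in> order_cone"
  shows "x \<in> order_cone"
proof -
  have "(\<lambda>n. x + inverse (real (Suc n)) *\<^sub>R y) \<longlonglongrightarrow> x + 0 *\<^sub>R y"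
    by (intro tendsto_intros LIMSEQ_inverse_real_of_nat)
  then have lim: "(\<lambda>n. x + inverse (real (Suc n)) *\<^sub>R y) \<longlonglongrightarrow> x"
    by simp
  show ?thesis
    by (rule closed_sequentially[OF closed_order_cone _ lim]) (rule assms, simp)
qed

text \<open>This is the axiom \<open>norm_jsquare_le\<close> for squares close to \<open>x\<close>
  and \<open>y - x\<close>. Shifting both by d/3 costs 2d/3 on the side of \<open>y\<close> and
  another d/3 for removing the shift from \<open>x\<close>.\<close>

lemma norm_mono_order_cone:
  fixes x y :: "'a::jb_algebra"
  assumes "x \<in> order_cone" "y - x \<in> order_cone"
  shows "norm x \<le> norm y"
proof (rule field_le_epsilon)
  fix d :: real assume d: "0 < d"
  obtain p where p: "p \<circ>\<^sub>J p = x + (d/3) *\<^sub>R e\<^sub>J"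
    using order_cone_plus_unit_square[of UNIV x "d/3"] assms d by auto
  obtain q where q: "q \<circ>\<^sub>J q = (y - x) + (d/3) *\<^sub>R e\<^sub>J"
    using order_cone_plus_unit_square[of UNIV "y - x" "d/3"] assms d by auto
  have "norm (x + (d/3) *\<^sub>R e\<^sub>J) \<le> norm (y + (2*d/3) *\<^sub>R e\<^sub>J)"
  proof -
    have "p \<circ>\<^sub>J p + q \<circ>\<^sub>J q = y + (2*d/3) *\<^sub>R e\<^sub>J"
      by (simp add: p q flip: scaleR_add_left)
    then show ?thesis
      using norm_jsquare_le[of p q] by (simp add: p)
  qed
  also have "\<dots> \<le> norm y + 2*d/3"
    using norm_triangle_ineq[of y "(2*d/3) *\<^sub>R e\<^sub>J"] d by simp
  finally show "norm x \<le> norm y + d"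
    using norm_triangle_ineq4[of "x + (d/3) *\<^sub>R e\<^sub>J" "(d/3) *\<^sub>R e\<^sub>J"] d by simp
qed

lemma order_cone_minus_unit:
  assumes "c *\<^sub>R e\<^sub>J \<in> (order_cone :: 'a::jb_algebra set)"
  shows "0 \<le> c"
proof (rule ccontr)
  assume "\<not> 0 \<le> c"
  then have "norm ((- c) *\<^sub>R (e\<^sub>J :: 'a)) \<le> norm (0 :: 'a)"
    using assms by (intro norm_mono_order_cone order_cone_unit) auto
  then show False
    using \<open>\<not> 0 \<le> c\<close> by simp
qed

text \<open>This is the maximum of the spectrum, see \<open>Sup_jb_spectrum\<close>, but phrased by
  the order so that it is at hand before anything is known about spectra.\<close>

definition unit_sup :: "'a::jb_algebra \<Rightarrow> real" where
  "unit_sup x = Inf {s. s *\<^sub>R e\<^sub>J - x \<in> order_cone}"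

text \<open>The infimum is finite by \<open>order_cone_minus_unit\<close> and attained because the
  cone is closed. Later facts about \<open>unit_sup\<close> are read off from this
  equivalence.\<close>

lemma unit_sup_le_iff: "unit_sup x \<le> s \<longleftrightarrow> s *\<^sub>R e\<^sub>J - x \<in> order_cone"
proof -
  let ?T = "{s. s *\<^sub>R e\<^sub>J - x \<in> order_cone}"
  have "norm x \<in> ?T"
    by (simp add: order_cone_one_minus)
  then have ne: "?T \<noteq> {}" by blast
  have bdd: "bdd_below ?T"
  proof (rule bdd_belowI)
    fix s assume "s \<in> ?T"
    then have "(s *\<^sub>R e\<^sub>J - x) + (x + norm x *\<^sub>R e\<^sub>J) \<in> order_cone"
      using order_cone_add order_cone_one_plus by blast
    then have "(s + norm x) *\<^sub>R e\<^sub>J \<in> (order_cone :: 'a set)"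
      by (simp add: algebra_simps)
    then show "- norm x \<le> s"
      using order_cone_minus_unit by fastforce
  qed
  have "closed ((\<lambda>s. s *\<^sub>R e\<^sub>J - x) -` order_cone)"
    by (intro continuous_closed_vimage closed_order_cone continuous_intros)
  then have "unit_sup x \<in> ?T"
    unfolding unit_sup_def using closed_contains_Inf[OF ne bdd] by (simp add: vimage_def)
  then have att: "unit_sup x *\<^sub>R e\<^sub>J - x \<in> order_cone" by simp
  show ?thesis
  proof
    assume "unit_sup x \<le> s"
    then have "(unit_sup x *\<^sub>R e\<^sub>J - x) + (s - unit_sup x) *\<^sub>R e\<^sub>J \<in> order_cone"
      by (intro order_cone_add att order_cone_unit) simp
    then show "s *\<^sub>R e\<^sub>J - x \<in> order_cone"
      by (simp add: algebra_simps)
  next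
    assume "s *\<^sub>R e\<^sub>J - x \<in> order_cone"
    then show "unit_sup x \<le> s"
      unfolding unit_sup_def using bdd by (simp add: cInf_lower)
  qed
qed

lemma unit_sup_attained: "unit_sup x *\<^sub>R e\<^sub>J - x \<in> order_cone"
  using unit_sup_le_iff[of x "unit_sup x"] by simp

lemma unit_sup_le_norm: "unit_sup x \<le> norm x"
  by (simp add: unit_sup_le_iff order_cone_one_minus)

lemma unit_sup_add: "unit_sup (x + y) \<le> unit_sup x + unit_sup y"
  using order_cone_add[OF unit_sup_attained[of x] unit_sup_attained[of y]]
  by (simp add: unit_sup_le_iff algebra_simps)

lemma unit_sup_add_unit [simp]: "unit_sup (x + c *\<^sub>R e\<^sub>J) = unit_sup x + c"
proof -
  have "unit_sup (x + c *\<^sub>R e\<^sub>J) \<le> s \<longleftrightarrow> unit_sup x + c \<le> s" for s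
    using unit_sup_le_iff[of x "s - c"] unit_sup_le_iff[of "x + c *\<^sub>R e\<^sub>J" s]
    by (simp add: algebra_simps)
  from this[of "unit_sup (x + c *\<^sub>R e\<^sub>J)"] this[of "unit_sup x + c"] show ?thesis by simp
qed

lemma unit_sup_scaleR:
  assumes "0 < c"
  shows "unit_sup (c *\<^sub>R x) = c * unit_sup x"
proof -
  have "unit_sup (d *\<^sub>R y) \<le> d * unit_sup y" if "0 < d" for d and y :: 'a
    using order_cone_scaleR[OF unit_sup_attained[of y], of d] that
    by (simp add: unit_sup_le_iff algebra_simps)
  from this[OF assms, of x] this[of "1/c" "c *\<^sub>R x"] assms show ?thesis
    by (simp add: field_simps)
qed

lemma unit_sup_zero [simp]: "unit_sup 0 = 0"
  using unit_sup_scaleR[of 2 0] by simp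

lemma unit_sup_diff_le: "\<bar>unit_sup x - unit_sup y\<bar> \<le> norm (x - y)"
  using unit_sup_add[of "x - y" y] unit_sup_add[of "y - x" x]
    unit_sup_le_norm[of "x - y"] unit_sup_le_norm[of "y - x"]
  by (simp add: norm_minus_commute abs_le_iff)

lemma order_cone_antisym:
  assumes "x \<in> order_cone" "- x \<in> order_cone"
  shows "x = 0"
  using norm_mono_order_cone[of x 0] assms by simp

text \<open>The inverse is obtained as the fixed point of \<open>y = e + u \<circ> y\<close>.
  Compared with summing a geometric series this avoids powers of \<open>u\<close>, about which
  nothing is known at this stage.\<close>

lemma jneumann_inverse:
  fixes u :: "'a::jb_algebra"
  assumes S: "closed_jsubalgebra S" "e\<^sub>J \<in> S" and u: "u \<in> S" "norm u < 1"
  shows "\<exists>y\<in>S. (e\<^sub>J - u) \<circ>\<^sub>J y = e\<^sub>J"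
proof -
  note S' = closed_jsubalgebraD[OF S(1)]
  have "\<exists>!y. y \<in> S \<and> e\<^sub>J + u \<circ>\<^sub>J y = y"
  proof (rule Banach_fix[of S "norm u"])
    show "complete S" using S'(2) by (simp add: complete_eq_closed)
    show "(\<lambda>y. e\<^sub>J + u \<circ>\<^sub>J y) ` S \<subseteq> S"
      using S S' u by (auto intro: subspace_add)
    show "dist (e\<^sub>J + u \<circ>\<^sub>J x) (e\<^sub>J + u \<circ>\<^sub>J y) \<le> norm u * dist x y" for x y
      using jprod_norm_le[of u "x - y"] by (simp add: dist_norm jprod.diff_right)
  qed (use S u in auto)
  then obtain y where "y \<in> S" "e\<^sub>J + u \<circ>\<^sub>J y = y" by blast
  then show ?thesis
    by (intro bexI[of _ y]) (simp_all add: jprod.diff_left algebra_simps)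
qed

lemma order_cone_plus_unit_inverse:
  fixes x :: "'a::jb_algebra"
  assumes S: "closed_jsubalgebra S" "e\<^sub>J \<in> S" and x: "x \<in> S" "x \<in> order_cone" "0 < \<epsilon>"
  shows "\<exists>y\<in>S. (x + \<epsilon> *\<^sub>R e\<^sub>J) \<circ>\<^sub>J y = e\<^sub>J"
proof -
  note S' = closed_jsubalgebraD[OF S(1)]
  obtain s where s: "norm (s *\<^sub>R e\<^sub>J - x) \<le> s"
    using x by (auto simp: order_cone_def)
  then have s0: "0 \<le> s"
    using norm_ge_zero order_trans by blast
  define t where "t = s + \<epsilon>"
  have t: "0 < t" using s0 x by (simp add: t_def)
  define u where "u = (1 / t) *\<^sub>R (s *\<^sub>R e\<^sub>J - x)"
  have "norm u < 1"
    using s t x by (simp add: u_def t_def divide_less_eq)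
  moreover have "u \<in> S"
    using S x S' by (simp add: u_def subspace_scale subspace_diff)
  ultimately obtain y where y: "y \<in> S" "(e\<^sub>J - u) \<circ>\<^sub>J y = e\<^sub>J"
    using jneumann_inverse[OF S] by blast
  have "x + \<epsilon> *\<^sub>R e\<^sub>J = t *\<^sub>R (e\<^sub>J - u)"
    using t by (simp add: u_def scaleR_diff_right) (simp add: t_def algebra_simps)
  then have "(x + \<epsilon> *\<^sub>R e\<^sub>J) \<circ>\<^sub>J ((1/t) *\<^sub>R y) = e\<^sub>J"
    using y t by (simp add: jprod.scaleR_left jprod.scaleR_right)
  then show ?thesis
    using y(1) S' subspace_scale by blast
qed

section \<open>Jordan identities and powers\<close>

text \<open>The Jordan identity says that a cubic map \<open>F\<close> vanishes;
  \<open>F (a + c) - F (a - c) - 2 F c\<close> isolates twice its component that is quadratic in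
  \<open>a\<close> and linear in \<open>c\<close>.\<close>

lemma jordan_linearized_once:
  fixes a b c :: "'a::jb_algebra"
  shows "c \<circ>\<^sub>J ((a \<circ>\<^sub>J a) \<circ>\<^sub>J b) + 2 *\<^sub>R (a \<circ>\<^sub>J ((a \<circ>\<^sub>J c) \<circ>\<^sub>J b))
       = (a \<circ>\<^sub>J a) \<circ>\<^sub>J (c \<circ>\<^sub>J b) + 2 *\<^sub>R ((a \<circ>\<^sub>J c) \<circ>\<^sub>J (a \<circ>\<^sub>J b))"
proof -
  define F where "F a = a \<circ>\<^sub>J ((a \<circ>\<^sub>J a) \<circ>\<^sub>J b) - (a \<circ>\<^sub>J a) \<circ>\<^sub>J (a \<circ>\<^sub>J b)" for a
  have F: "F a = 0" for a
    using jordan_identity[of a b] by (simp add: F_def jprod_commute)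
  have ca: "c \<circ>\<^sub>J a = a \<circ>\<^sub>J c" by (rule jprod_commute)
  have "2 *\<^sub>R (c \<circ>\<^sub>J ((a \<circ>\<^sub>J a) \<circ>\<^sub>J b) + 2 *\<^sub>R (a \<circ>\<^sub>J ((a \<circ>\<^sub>J c) \<circ>\<^sub>J b))
       - ((a \<circ>\<^sub>J a) \<circ>\<^sub>J (c \<circ>\<^sub>J b) + 2 *\<^sub>R ((a \<circ>\<^sub>J c) \<circ>\<^sub>J (a \<circ>\<^sub>J b))))
     = F (a + c) - F (a - c) - 2 *\<^sub>R F c"
    unfolding F_def
    by (simp add: jprod.add_left jprod.add_right jprod.diff_left jprod.diff_right ca
        scaleR_2 algebra_simps)
  then show ?thesis
    by (simp add: F)
qed

text \<open>The previous identity is quadratic in \<open>a\<close>, so polarizing it by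
  \<open>F (a + b) - F a - F b\<close> gives the fully multilinear form.\<close>

lemma jordan_linearized:
  fixes a b c x :: "'a::jb_algebra"
  shows "a \<circ>\<^sub>J ((b \<circ>\<^sub>J c) \<circ>\<^sub>J x) + b \<circ>\<^sub>J ((c \<circ>\<^sub>J a) \<circ>\<^sub>J x) + c \<circ>\<^sub>J ((a \<circ>\<^sub>J b) \<circ>\<^sub>J x)
       = (b \<circ>\<^sub>J c) \<circ>\<^sub>J (a \<circ>\<^sub>J x) + (c \<circ>\<^sub>J a) \<circ>\<^sub>J (b \<circ>\<^sub>J x) + (a \<circ>\<^sub>J b) \<circ>\<^sub>J (c \<circ>\<^sub>J x)"
proof -
  define F where "F a = c \<circ>\<^sub>J ((a \<circ>\<^sub>J a) \<circ>\<^sub>J x) + 2 *\<^sub>R (a \<circ>\<^sub>J ((a \<circ>\<^sub>J c) \<circ>\<^sub>J x))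
      - ((a \<circ>\<^sub>J a) \<circ>\<^sub>J (c \<circ>\<^sub>J x) + 2 *\<^sub>R ((a \<circ>\<^sub>J c) \<circ>\<^sub>J (a \<circ>\<^sub>J x)))" for a
  have F: "F a = 0" for a
    using jordan_linearized_once[of c a x] by (simp add: F_def)
  have comm: "b \<circ>\<^sub>J a = a \<circ>\<^sub>J b" "c \<circ>\<^sub>J a = a \<circ>\<^sub>J c" "c \<circ>\<^sub>J b = b \<circ>\<^sub>J c"
    by (rule jprod_commute)+
  have "2 *\<^sub>R ((a \<circ>\<^sub>J ((b \<circ>\<^sub>J c) \<circ>\<^sub>J x) + b \<circ>\<^sub>J ((c \<circ>\<^sub>J a) \<circ>\<^sub>J x) + c \<circ>\<^sub>J ((a \<circ>\<^sub>J b) \<circ>\<^sub>J x))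
       - ((b \<circ>\<^sub>J c) \<circ>\<^sub>J (a \<circ>\<^sub>J x) + (c \<circ>\<^sub>J a) \<circ>\<^sub>J (b \<circ>\<^sub>J x) + (a \<circ>\<^sub>J b) \<circ>\<^sub>J (c \<circ>\<^sub>J x)))
     = F (a + b) - F a - F b"
    unfolding F_def
    by (simp add: jprod.add_left jprod.add_right comm scaleR_2 algebra_simps)
  then show ?thesis
    by (simp add: F)
qed

text \<open>The previous identity, read as an identity between operators applied to \<open>b\<close>.\<close>

lemma jordan_operator_identity:
  fixes a b c x :: "'a::jb_algebra"
  shows "a \<circ>\<^sub>J (x \<circ>\<^sub>J (c \<circ>\<^sub>J b)) + c \<circ>\<^sub>J (x \<circ>\<^sub>J (a \<circ>\<^sub>J b)) + ((c \<circ>\<^sub>J a) \<circ>\<^sub>J x) \<circ>\<^sub>J b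
       = (a \<circ>\<^sub>J x) \<circ>\<^sub>J (c \<circ>\<^sub>J b) + (c \<circ>\<^sub>J a) \<circ>\<^sub>J (x \<circ>\<^sub>J b) + (c \<circ>\<^sub>J x) \<circ>\<^sub>J (a \<circ>\<^sub>J b)"
  using jordan_linearized[of a b c x]
  by (simp add: jprod_commute[of b] jprod_commute[of _ x] jprod_commute[of "x \<circ>\<^sub>J a"]
      jprod_commute[of "x \<circ>\<^sub>J c"] algebra_simps)

primrec jpow :: "'a::jb_algebra \<Rightarrow> nat \<Rightarrow> 'a" where
  "jpow a 0 = e\<^sub>J"
| "jpow a (Suc n) = a \<circ>\<^sub>J jpow a n"

text \<open>\<open>jordan_operator_identity\<close> expresses multiplication by the power n + 2
  through multiplications by \<open>a\<close>, its square and the powers n and n + 1. Each of these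
  commutes with multiplication by \<open>a\<close>, the square by the Jordan identity; hence the
  induction over two predecessors.\<close>

lemma jpow_operator_commute: "a \<circ>\<^sub>J (jpow a n \<circ>\<^sub>J b) = jpow a n \<circ>\<^sub>J (a \<circ>\<^sub>J b)"
proof (induction n arbitrary: b rule: induct_nat_012)
  case (ge2 n)
  have sq: "a \<circ>\<^sub>J ((a \<circ>\<^sub>J a) \<circ>\<^sub>J b) = (a \<circ>\<^sub>J a) \<circ>\<^sub>J (a \<circ>\<^sub>J b)" for b
    using jordan_identity[of a b] by (simp add: jprod_commute)
  define p q where "p = jpow a n" and "q = a \<circ>\<^sub>J p"
  have p: "a \<circ>\<^sub>J (p \<circ>\<^sub>J b) = p \<circ>\<^sub>J (a \<circ>\<^sub>J b)" and q: "a \<circ>\<^sub>J (q \<circ>\<^sub>J b) = q \<circ>\<^sub>J (a \<circ>\<^sub>J b)" for b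
    using ge2.IH by (simp_all add: p_def q_def)
  have "(a \<circ>\<^sub>J q) \<circ>\<^sub>J b = (a \<circ>\<^sub>J a) \<circ>\<^sub>J (p \<circ>\<^sub>J b) + q \<circ>\<^sub>J (a \<circ>\<^sub>J b) + q \<circ>\<^sub>J (a \<circ>\<^sub>J b)
      - a \<circ>\<^sub>J (a \<circ>\<^sub>J (p \<circ>\<^sub>J b)) - p \<circ>\<^sub>J (a \<circ>\<^sub>J (a \<circ>\<^sub>J b))" for b
    using jordan_operator_identity[of a a p b]
    by (simp add: jprod_commute[of p a] q_def[symmetric] jprod_commute[of q a] algebra_simps)
  then show ?case
    by (simp add: p_def[symmetric] q_def[symmetric] jprod.add_right jprod.diff_right sq p q)
qed simp_all

section \<open>Polynomials in one element\<close>

definition jpoly :: "real poly \<Rightarrow> 'a::jb_algebra \<Rightarrow> 'a" where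
  "jpoly p a = fold_coeffs (\<lambda>c x. c *\<^sub>R e\<^sub>J + a \<circ>\<^sub>J x) p 0"

lemma jpoly_0 [simp]: "jpoly 0 a = 0"
  by (simp add: jpoly_def)

lemma jpoly_pCons [simp]: "jpoly (pCons c p) a = c *\<^sub>R e\<^sub>J + a \<circ>\<^sub>J jpoly p a"
  by (cases "p = 0 \<and> c = 0") (auto simp: jpoly_def)

lemma jpoly_1 [simp]: "jpoly 1 a = e\<^sub>J"
  by (simp add: one_pCons)

lemma jpoly_add [simp]: "jpoly (p + q) a = jpoly p a + jpoly q a"
  by (induction p q rule: poly_induct2) (simp_all add: jprod.add_right algebra_simps)

lemma jpoly_smult [simp]: "jpoly (smult c p) a = c *\<^sub>R jpoly p a"
  by (induction p) (simp_all add: jprod.scaleR_right algebra_simps)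

lemma jpoly_diff [simp]: "jpoly (p - q) a = jpoly p a - jpoly q a"
  using jpoly_add[of p "smult (-1) q" a] jpoly_smult[of "-1" q a] by simp

lemma jpoly_monom [simp]: "jpoly (monom c n) a = c *\<^sub>R jpow a n"
  by (induction n) (simp_all add: monom_0 monom_Suc jprod.scaleR_right)

lemma jpoly_operator_commute: "a \<circ>\<^sub>J (jpoly p a \<circ>\<^sub>J b) = jpoly p a \<circ>\<^sub>J (a \<circ>\<^sub>J b)"
proof -
  have "jpoly p a \<in> span (range (jpow a))"
  proof (induction p)
    case (pCons c p)
    have "a \<circ>\<^sub>J x \<in> span (range (jpow a))" if "x \<in> span (range (jpow a))" for x
      using that
    proof (induction rule: span_induct_alt)
      case (step c x y)
      then obtain n where "x = jpow a n" by blast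
      then have "a \<circ>\<^sub>J x = jpow a (Suc n)" by simp
      then have "a \<circ>\<^sub>J x \<in> span (range (jpow a))"
        by (metis rangeI span_base)
      then show ?case
        using step by (simp add: jprod.add_right jprod.scaleR_right span_add span_mul)
    qed (simp add: span_zero)
    moreover have "e\<^sub>J \<in> span (range (jpow a))"
      by (metis jpow.simps(1) rangeI span_base)
    ultimately show ?case
      using pCons by (simp add: span_add span_mul)
  qed (simp add: span_zero)
  then show ?thesis
  proof (induction rule: span_induct_alt)
    case (step c x y)
    then show ?case
      by (auto simp: jprod.add_left jprod.add_right jprod.scaleR_left jprod.scaleR_right
          jpow_operator_commute)
  qed simp
qed

text \<open>Power associativity, obtained from commutativity and from the fact that multiplications
  by \<open>a\<close> and by a polynomial in \<open>a\<close> commute.\<close>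

lemma jpoly_mult [simp]: "jpoly (p * q) a = jpoly p a \<circ>\<^sub>J jpoly q a"
proof (induction p)
  case (pCons c p)
  have "(a \<circ>\<^sub>J jpoly p a) \<circ>\<^sub>J jpoly q a = jpoly q a \<circ>\<^sub>J (a \<circ>\<^sub>J jpoly p a)"
    by (rule jprod_commute)
  also have "\<dots> = a \<circ>\<^sub>J (jpoly q a \<circ>\<^sub>J jpoly p a)"
    by (rule jpoly_operator_commute[symmetric])
  also have "\<dots> = a \<circ>\<^sub>J jpoly (p * q) a"
    by (simp add: pCons jprod_commute)
  finally show ?case
    by (simp add: jprod.add_left jprod.scaleR_left)
qed simp

lemma closed_jsubalgebra_jb_gen: "closed_jsubalgebra (jb_gen a)"
  unfolding jb_gen_def
proof (rule hull_in)
  fix T :: "'a set set" assume "Ball T closed_jsubalgebra"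
  then show "closed_jsubalgebra (\<Inter>T)"
    unfolding closed_jsubalgebra_def by (auto intro: subspace_Inter closed_Inter)
qed

lemma jb_gen_generator [simp]: "a \<in> jb_gen a" and jb_gen_unit [simp]: "e\<^sub>J \<in> jb_gen a"
  unfolding jb_gen_def by (auto intro: hull_inc)

lemma jb_gen_jprod [simp]: "x \<in> jb_gen a \<Longrightarrow> y \<in> jb_gen a \<Longrightarrow> x \<circ>\<^sub>J y \<in> jb_gen a"
  and jb_gen_add [simp]: "x \<in> jb_gen a \<Longrightarrow> y \<in> jb_gen a \<Longrightarrow> x + y \<in> jb_gen a"
  and jb_gen_diff [simp]: "x \<in> jb_gen a \<Longrightarrow> y \<in> jb_gen a \<Longrightarrow> x - y \<in> jb_gen a"
  and jb_gen_scaleR [simp]: "x \<in> jb_gen a \<Longrightarrow> c *\<^sub>R x \<in> jb_gen a"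
  and jb_gen_zero [simp]: "0 \<in> jb_gen a"
  using closed_jsubalgebraD[OF closed_jsubalgebra_jb_gen[of a]]
  by (simp_all add: subspace_add subspace_diff subspace_scale subspace_0)

lemma jpoly_in_jb_gen [simp]: "jpoly p a \<in> jb_gen a"
  by (induction p) simp_all

text \<open>The closure of the polynomials in \<open>a\<close> is a closed subalgebra containing
  both generators, so minimality of the hull places \<open>jb_gen a\<close> inside it.\<close>

lemma jb_gen_limit:
  assumes "x \<in> jb_gen a"
  shows "\<exists>p. (\<lambda>n. jpoly (p n) a) \<longlonglongrightarrow> x"
proof -
  let ?C = "closure (range (\<lambda>p. jpoly p a))"
  have seq: "x \<in> ?C \<longleftrightarrow> (\<exists>p. (\<lambda>n. jpoly (p n) a) \<longlonglongrightarrow> x)" for x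
  proof
    assume "x \<in> ?C"
    then obtain f where f: "\<forall>n. f n \<in> range (\<lambda>p. jpoly p a)" "f \<longlonglongrightarrow> x"
      unfolding closure_sequential by blast
    then have "\<forall>n. \<exists>p. f n = jpoly p a" by blast
    then obtain p where "\<And>n. f n = jpoly (p n) a" by metis
    then have "f = (\<lambda>n. jpoly (p n) a)" by blast
    with f(2) show "\<exists>p. (\<lambda>n. jpoly (p n) a) \<longlonglongrightarrow> x" by blast
  next
    assume "\<exists>p. (\<lambda>n. jpoly (p n) a) \<longlonglongrightarrow> x"
    then obtain p where "(\<lambda>n. jpoly (p n) a) \<longlonglongrightarrow> x" ..
    then show "x \<in> ?C"
      unfolding closure_sequential by (intro exI[of _ "\<lambda>n. jpoly (p n) a"]) auto
  qed
  have "closed_jsubalgebra ?C"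
    unfolding closed_jsubalgebra_def
  proof (intro conjI ballI subspaceI closed_closure)
    have "jpoly 0 a \<in> range (\<lambda>p. jpoly p a)" by (rule rangeI)
    then show "0 \<in> ?C"
      unfolding jpoly_0 by (rule subsetD[OF closure_subset])
    fix x y c assume "x \<in> ?C" "y \<in> ?C"
    then obtain p q where p: "(\<lambda>n. jpoly (p n) a) \<longlonglongrightarrow> x" and q: "(\<lambda>n. jpoly (q n) a) \<longlonglongrightarrow> y"
      unfolding seq by blast
    have "(\<lambda>n. jpoly (p n + q n) a) \<longlonglongrightarrow> x + y" "(\<lambda>n. jpoly (p n * q n) a) \<longlonglongrightarrow> x \<circ>\<^sub>J y"
      using tendsto_add[OF p q] jprod.tendsto[OF p q] by simp_all
    then show "x + y \<in> ?C" "x \<circ>\<^sub>J y \<in> ?C"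
      unfolding seq by - (rule exI, assumption)+
  next
    fix c x assume "x \<in> ?C"
    then obtain p where p: "(\<lambda>n. jpoly (p n) a) \<longlonglongrightarrow> x"
      unfolding seq by blast
    have "(\<lambda>n. jpoly (smult c (p n)) a) \<longlonglongrightarrow> c *\<^sub>R x"
      using tendsto_scaleR[OF tendsto_const p] by simp
    then show "c *\<^sub>R x \<in> ?C"
      unfolding seq by - (rule exI, assumption)
  qed
  moreover have "{a, e\<^sub>J} \<subseteq> ?C"
  proof -
    have "jpoly [:0, 1:] a \<in> ?C" "jpoly 1 a \<in> ?C"
      by (rule subsetD[OF closure_subset], rule rangeI)+
    then show ?thesis by simp
  qed
  ultimately have "jb_gen a \<subseteq> ?C"
    unfolding jb_gen_def by (intro hull_minimal)
  with assms show ?thesis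
    unfolding seq[symmetric] by blast
qed

lemma jb_gen_assoc:
  assumes "x \<in> jb_gen a" "y \<in> jb_gen a" "z \<in> jb_gen a"
  shows "(x \<circ>\<^sub>J y) \<circ>\<^sub>J z = x \<circ>\<^sub>J (y \<circ>\<^sub>J z)"
proof -
  obtain p q r where p: "(\<lambda>n. jpoly (p n) a) \<longlonglongrightarrow> x" and q: "(\<lambda>n. jpoly (q n) a) \<longlonglongrightarrow> y"
    and r: "(\<lambda>n. jpoly (r n) a) \<longlonglongrightarrow> z"
    using jb_gen_limit[OF assms(1)] jb_gen_limit[OF assms(2)] jb_gen_limit[OF assms(3)] by blast
  have "(\<lambda>n. jpoly (p n * q n * r n) a) \<longlonglongrightarrow> (x \<circ>\<^sub>J y) \<circ>\<^sub>J z"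
    using jprod.tendsto[OF jprod.tendsto[OF p q] r] by simp
  moreover have "(\<lambda>n. jpoly (p n * q n * r n) a) \<longlonglongrightarrow> x \<circ>\<^sub>J (y \<circ>\<^sub>J z)"
    using jprod.tendsto[OF p jprod.tendsto[OF q r]] by (simp only: mult.assoc jpoly_mult)
  ultimately show ?thesis
    by (rule LIMSEQ_unique)
qed

lemma jb_gen_square_mult:
  assumes "x \<in> jb_gen a" "y \<in> jb_gen a"
  shows "(x \<circ>\<^sub>J x) \<circ>\<^sub>J (y \<circ>\<^sub>J y) = (x \<circ>\<^sub>J y) \<circ>\<^sub>J (x \<circ>\<^sub>J y)"
proof -
  have "(x \<circ>\<^sub>J x) \<circ>\<^sub>J (y \<circ>\<^sub>J y) = x \<circ>\<^sub>J (x \<circ>\<^sub>J (y \<circ>\<^sub>J y))"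
    using assms by (intro jb_gen_assoc[of _ a]) simp_all
  also have "x \<circ>\<^sub>J (y \<circ>\<^sub>J y) = (x \<circ>\<^sub>J y) \<circ>\<^sub>J y"
    using assms by (intro jb_gen_assoc[of _ a, symmetric]) simp_all
  also have "\<dots> = y \<circ>\<^sub>J (x \<circ>\<^sub>J y)"
    by (rule jprod_commute)
  also have "x \<circ>\<^sub>J (y \<circ>\<^sub>J (x \<circ>\<^sub>J y)) = (x \<circ>\<^sub>J y) \<circ>\<^sub>J (x \<circ>\<^sub>J y)"
    using assms by (intro jb_gen_assoc[of _ a, symmetric]) simp_all
  finally show ?thesis .
qed

text \<open>Small shifts turn both factors into squares of elements of \<open>jb_gen a\<close>,
  whose product is a square by associativity; closedness of the cone removes the shifts one at a
  time. For elements without a common associative subalgebra a product of positive elements need not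
  be positive.\<close>

lemma order_cone_mult_jb_gen:
  assumes "x \<in> jb_gen a" "y \<in> jb_gen a" "x \<in> order_cone" "y \<in> order_cone"
  shows "x \<circ>\<^sub>J y \<in> order_cone"
proof -
  have 1: "(x + \<epsilon> *\<^sub>R e\<^sub>J) \<circ>\<^sub>J (y + \<delta> *\<^sub>R e\<^sub>J) \<in> order_cone" if pos: "0 < \<epsilon>" "0 < \<delta>" for \<epsilon> \<delta>
  proof -
    obtain p where p: "p \<in> jb_gen a" "p \<circ>\<^sub>J p = x + \<epsilon> *\<^sub>R e\<^sub>J"
      using order_cone_plus_unit_square[OF closed_jsubalgebra_jb_gen[of a], of x \<epsilon>] assms pos(1) jb_gen_unit by blast
    obtain q where q: "q \<in> jb_gen a" "q \<circ>\<^sub>J q = y + \<delta> *\<^sub>R e\<^sub>J"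
      using order_cone_plus_unit_square[OF closed_jsubalgebra_jb_gen[of a], of y \<delta>] assms pos(2) jb_gen_unit by blast
    have "(p \<circ>\<^sub>J p) \<circ>\<^sub>J (q \<circ>\<^sub>J q) = (p \<circ>\<^sub>J q) \<circ>\<^sub>J (p \<circ>\<^sub>J q)"
      using p(1) q(1) by (rule jb_gen_square_mult)
    then show ?thesis
      using square_in_order_cone[of "p \<circ>\<^sub>J q"] p q by simp
  qed
  have 2: "x \<circ>\<^sub>J (y + \<delta> *\<^sub>R e\<^sub>J) \<in> order_cone" if "0 < \<delta>" for \<delta>
    by (rule order_cone_epsilon[of _ "y + \<delta> *\<^sub>R e\<^sub>J"])
      (use 1[OF _ that] in \<open>simp add: jprod.add_left jprod.scaleR_left\<close>)
  show ?thesis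
    by (rule order_cone_epsilon[of _ x])
      (use 2 in \<open>simp add: jprod.add_right jprod.scaleR_right\<close>)
qed

section \<open>The spectrum\<close>

lemma jpoly_eq_linear_times:
  assumes "poly p r = 0"
  obtains q where "jpoly p a = (a - r *\<^sub>R e\<^sub>J) \<circ>\<^sub>J jpoly q a" "p = [:- r, 1:] * q"
proof -
  obtain q where q: "p = [:- r, 1:] * q"
    using assms by (auto simp: poly_eq_0_iff_dvd)
  have "jpoly p a = jpoly [:- r, 1:] a \<circ>\<^sub>J jpoly q a"
    unfolding q by (rule jpoly_mult)
  then show ?thesis
    using that q by simp
qed

text \<open>If \<open>poly p r\<close> were negative, then \<open>p(a) - p(r) e\<close> would be
  positive plus a positive multiple of the unit and hence invertible, and so would be its factor
  \<open>a - r e\<close>.\<close>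

lemma jb_spectrum_poly_nonneg:
  assumes "jpoly p a \<in> order_cone" "r \<in> jb_spectrum a"
  shows "0 \<le> poly p r"
proof (rule ccontr)
  assume "\<not> 0 \<le> poly p r"
  then have neg: "0 < - poly p r" by simp
  have "poly (p - [:poly p r:]) r = 0" by simp
  then obtain q where "jpoly (p - [:poly p r:]) a = (a - r *\<^sub>R e\<^sub>J) \<circ>\<^sub>J jpoly q a"
    by (rule jpoly_eq_linear_times)
  then have q: "jpoly p a + (- poly p r) *\<^sub>R e\<^sub>J = (a - r *\<^sub>R e\<^sub>J) \<circ>\<^sub>J jpoly q a"
    by simp
  obtain y where y: "y \<in> jb_gen a" "(jpoly p a + (- poly p r) *\<^sub>R e\<^sub>J) \<circ>\<^sub>J y = e\<^sub>J"
    using order_cone_plus_unit_inverse[OF closed_jsubalgebra_jb_gen[of a], of "jpoly p a", OF _ _ _ neg]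
      assms by auto
  have "(a - r *\<^sub>R e\<^sub>J) \<circ>\<^sub>J (jpoly q a \<circ>\<^sub>J y) = e\<^sub>J"
    using y q jb_gen_assoc[of "a - r *\<^sub>R e\<^sub>J" a "jpoly q a" y] by simp
  moreover have "jpoly q a \<circ>\<^sub>J y \<in> jb_gen a"
    using y by simp
  ultimately show False
    using assms(2) by (auto simp: jb_spectrum_def)
qed

text \<open>Multiplying \<open>y\<^sup>2 \<le> M e\<close> by \<open>x\<^sup>2\<close> gives
  \<open>e \<le> M x\<^sup>2\<close>, and \<open>x \<le> s e\<close> gives
  \<open>x\<^sup>2 \<le> s x\<close>. Together \<open>e \<le> M s x\<close>, which yields \<epsilon>
  = 1/(M s).\<close>

lemma order_cone_invertible_minus_unit:
  assumes x: "x \<in> jb_gen a" "x \<in> order_cone" and y: "y \<in> jb_gen a" "x \<circ>\<^sub>J y = e\<^sub>J"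
  shows "\<exists>\<epsilon>>0. x - \<epsilon> *\<^sub>R e\<^sub>J \<in> order_cone"
proof -
  define M s where "M = norm (y \<circ>\<^sub>J y) + 1" and "s = norm x + 1"
  have pos: "0 < M" "0 < s"
    by (auto simp: M_def s_def add_nonneg_pos)
  have in_gen: "x \<circ>\<^sub>J x \<in> jb_gen a" "y \<circ>\<^sub>J y \<in> jb_gen a" "M *\<^sub>R e\<^sub>J - y \<circ>\<^sub>J y \<in> jb_gen a"
      "s *\<^sub>R e\<^sub>J - x \<in> jb_gen a"
    using x y by simp_all
  have "(x \<circ>\<^sub>J x) \<circ>\<^sub>J (y \<circ>\<^sub>J y) = e\<^sub>J"
    using jb_gen_square_mult[OF x(1) y(1)] y(2) by simp
  moreover have "(x \<circ>\<^sub>J x) \<circ>\<^sub>J (M *\<^sub>R e\<^sub>J - y \<circ>\<^sub>J y) \<in> order_cone"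
  proof (rule order_cone_mult_jb_gen[of _ a])
    show "M *\<^sub>R e\<^sub>J - y \<circ>\<^sub>J y \<in> order_cone"
      by (rule order_cone_one_minus) (simp add: M_def)
  qed (use in_gen in \<open>simp_all add: square_in_order_cone\<close>)
  ultimately have 1: "M *\<^sub>R (x \<circ>\<^sub>J x) - e\<^sub>J \<in> order_cone"
    by (simp add: jprod.diff_right jprod.scaleR_right)
  have "x \<circ>\<^sub>J (s *\<^sub>R e\<^sub>J - x) \<in> order_cone"
  proof (rule order_cone_mult_jb_gen[of _ a])
    show "s *\<^sub>R e\<^sub>J - x \<in> order_cone"
      by (rule order_cone_one_minus) (simp add: s_def)
  qed (use in_gen x in simp_all)
  then have "M *\<^sub>R (s *\<^sub>R x - x \<circ>\<^sub>J x) \<in> order_cone"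
    using pos by (intro order_cone_scaleR) (auto simp: jprod.diff_right jprod.scaleR_right)
  from order_cone_add[OF 1 this] have "(M * s) *\<^sub>R x - e\<^sub>J \<in> order_cone"
    by (simp add: algebra_simps)
  then have "(1 / (M * s)) *\<^sub>R ((M * s) *\<^sub>R x - e\<^sub>J) \<in> order_cone"
    using pos by (intro order_cone_scaleR) auto
  then have "x - (1 / (M * s)) *\<^sub>R e\<^sub>J \<in> order_cone"
    using pos by (simp add: scaleR_diff_right)
  then show ?thesis
    using pos by (intro exI[of _ "1 / (M * s)"]) auto
qed

section \<open>Complex roots and factorization of real polynomials\<close>

abbreviation cpoly :: "real poly \<Rightarrow> complex \<Rightarrow> complex" where
  "cpoly p z \<equiv> poly (map_poly complex_of_real p) z"

lemma cpoly_add: "cpoly (p + q) z = cpoly p z + cpoly q z"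
  by (induction p q rule: poly_induct2) (simp_all add: map_poly_pCons algebra_simps)

lemma cpoly_smult: "cpoly (smult c p) z = of_real c * cpoly p z"
  by (induction p) (simp_all add: map_poly_pCons algebra_simps)

lemma cpoly_mult: "cpoly (p * q) z = cpoly p z * cpoly q z"
  by (induction p) (simp_all add: map_poly_pCons cpoly_add cpoly_smult algebra_simps)

lemma cpoly_of_real: "cpoly p (of_real r) = of_real (poly p r)"
  by (induction p) (simp_all add: map_poly_pCons)

text \<open>For a non-real root, the remainder modulo its real quadratic is real of degree below 2
  and vanishes at a non-real point, hence is zero. The quadratic is written as a square plus a
  positive constant, the shape in which \<open>order_cone_plus_unit_inverse\<close> inverts
  it.\<close>

lemma real_poly_factor:
  fixes p :: "real poly"
  assumes "0 < degree p"
  obtains (linear) r q where "p = [:- r, 1:] * q"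
  | (quadratic) \<alpha> \<beta> q where "\<beta> \<noteq> 0" "p = ([:- \<alpha>, 1:]\<^sup>2 + [:\<beta>\<^sup>2:]) * q"
proof -
  have "degree (map_poly complex_of_real p) = degree p"
    by (rule degree_map_poly) auto
  then have "\<not> constant (poly (map_poly complex_of_real p))"
    using assms by (simp add: constant_degree)
  then obtain z where z: "cpoly p z = 0"
    using fundamental_theorem_of_algebra by blast
  define \<alpha> \<beta> where "\<alpha> = Re z" and "\<beta> = Im z"
  have z_eq: "z = of_real \<alpha> + \<i> * of_real \<beta>"
    by (simp add: \<alpha>_def \<beta>_def complex_eq)
  show thesis
  proof (cases "\<beta> = 0")
    case True
    then have "poly p \<alpha> = 0"
      using z by (simp add: z_eq cpoly_of_real)
    then show thesis
      using linear by (auto simp: poly_eq_0_iff_dvd)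
  next
    case False
    define d where "d = [:- \<alpha>, 1:]\<^sup>2 + [:\<beta>\<^sup>2:]"
    have d: "d = [:\<alpha>\<^sup>2 + \<beta>\<^sup>2, - 2 * \<alpha>, 1:]"
      by (simp add: d_def power2_eq_square)
    then have deg: "degree d = 2" by simp
    have dz: "cpoly d z = 0"
      by (simp add: d map_poly_pCons z_eq power2_eq_square algebra_simps)
    have "p = d * (p div d) + p mod d" by simp
    then have "cpoly (p mod d) z = 0"
      using z dz by (metis add_0 cpoly_add cpoly_mult mult_zero_left)
    moreover have "degree (p mod d) < 2"
      using degree_mod_less'[of d p] deg by (cases "p mod d = 0"; cases "d = 0") auto
    then obtain c0 c1 where c: "p mod d = [:c0, c1:]"
      by (metis One_nat_def Suc_1 degree_eq_zeroE degree_pCons_eq_if less_2_cases less_Suc_eq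
          pCons_cases pCons_0_0 nat.inject zero_neq_one)
    ultimately have "of_real c0 + z * of_real c1 = 0"
      by (simp add: map_poly_pCons)
    then have "c1 = 0" "c0 = 0"
      using False by (auto simp: z_eq complex_eq_iff)
    then have "d dvd p"
      using c by (simp add: dvd_eq_mod_eq_0)
    then show thesis
      using quadratic False by (auto simp: d_def)
  qed
qed

text \<open>Linear factors are invertible because their roots lie off the spectrum, by its very
  definition; quadratic factors without real roots are invertible unconditionally. Inverses of
  factors multiply because \<open>jb_gen a\<close> is associative.\<close>

lemma jpoly_invertible:
  assumes "p \<noteq> 0" "\<And>r. r \<in> jb_spectrum a \<Longrightarrow> poly p r \<noteq> 0"
  shows "\<exists>y\<in>jb_gen a. jpoly p a \<circ>\<^sub>J y = e\<^sub>J"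
  using assms
proof (induction "degree p" arbitrary: p rule: less_induct)
  case less
  have prod: "\<exists>y\<in>jb_gen a. jpoly (d * q) a \<circ>\<^sub>J y = e\<^sub>J"
    if inv: "\<exists>y\<in>jb_gen a. jpoly d a \<circ>\<^sub>J y = e\<^sub>J" "\<exists>y\<in>jb_gen a. jpoly q a \<circ>\<^sub>J y = e\<^sub>J" for d q
  proof -
    obtain y where y: "y \<in> jb_gen a" "jpoly d a \<circ>\<^sub>J y = e\<^sub>J"
      using inv(1) by blast
    obtain z where z: "z \<in> jb_gen a" "jpoly q a \<circ>\<^sub>J z = e\<^sub>J"
      using inv(2) by blast
    have "(jpoly d a \<circ>\<^sub>J jpoly q a) \<circ>\<^sub>J (z \<circ>\<^sub>J y) = jpoly d a \<circ>\<^sub>J (jpoly q a \<circ>\<^sub>J (z \<circ>\<^sub>J y))"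
      using y z by (intro jb_gen_assoc[of _ a]) simp_all
    also have "jpoly q a \<circ>\<^sub>J (z \<circ>\<^sub>J y) = y"
      using y z jb_gen_assoc[of "jpoly q a" a z y] by simp
    finally show ?thesis
      using y z by (auto intro!: bexI[of _ "z \<circ>\<^sub>J y"])
  qed
  show ?case
  proof (cases "degree p = 0")
    case True
    then obtain c where c: "p = [:c:]" by (rule degree_eq_zeroE)
    then have "jpoly p a \<circ>\<^sub>J ((1/c) *\<^sub>R e\<^sub>J) = e\<^sub>J"
      using less.prems(1) by (simp add: jprod.scaleR_left)
    then show ?thesis
      by (meson jb_gen_unit jb_gen_scaleR)
  next
    case False
    then have "0 < degree p" by simp
    then show ?thesis
    proof (cases rule: real_poly_factor)
      case (linear r q)
      then have "q \<noteq> 0" using less.prems by auto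
      then have "degree p = 1 + degree q"
        unfolding linear by (subst degree_mult_eq) auto
      then have "degree q < degree p" by simp
      then have "\<exists>y\<in>jb_gen a. jpoly q a \<circ>\<^sub>J y = e\<^sub>J"
        using less \<open>q \<noteq> 0\<close> linear by auto
      moreover have "r \<notin> jb_spectrum a"
        using less.prems(2)[of r] linear by auto
      then have "\<exists>y\<in>jb_gen a. jpoly [:- r, 1:] a \<circ>\<^sub>J y = e\<^sub>J"
        by (auto simp: jb_spectrum_def)
      ultimately show ?thesis
        unfolding linear by (intro prod)
    next
      case (quadratic \<alpha> \<beta> q)
      then have "q \<noteq> 0" using less.prems by auto
      let ?d = "[:- \<alpha>, 1:]\<^sup>2 + [:\<beta>\<^sup>2:]"
      have "degree ?d = 2" "?d \<noteq> 0"
        by (simp_all add: power2_eq_square)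
      then have "degree q < degree p"
        using quadratic \<open>q \<noteq> 0\<close> by (simp add: degree_mult_eq)
      then have "\<exists>y\<in>jb_gen a. jpoly q a \<circ>\<^sub>J y = e\<^sub>J"
        using less \<open>q \<noteq> 0\<close> quadratic by auto
      moreover have "\<exists>y\<in>jb_gen a. (jpoly ([:- \<alpha>, 1:]\<^sup>2) a + \<beta>\<^sup>2 *\<^sub>R e\<^sub>J) \<circ>\<^sub>J y = e\<^sub>J"
      proof (rule order_cone_plus_unit_inverse[OF closed_jsubalgebra_jb_gen])
        show "jpoly ([:- \<alpha>, 1:]\<^sup>2) a \<in> order_cone"
          unfolding power2_eq_square jpoly_mult by (rule square_in_order_cone)
      qed (use quadratic in auto)
      then have "\<exists>y\<in>jb_gen a. jpoly ?d a \<circ>\<^sub>J y = e\<^sub>J"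
        unfolding jpoly_add by simp
      ultimately show ?thesis
        unfolding quadratic by (intro prod)
    qed
  qed
qed

text \<open>The largest \<open>m\<close> with \<open>m e \<le> p(a)\<close> is attained on the spectrum, because \<open>p(a) - m e\<close>
  is not invertible and hence \<open>p - m\<close> has a root there.\<close>

lemma jpoly_minimum_nonconst:
  assumes "0 < degree p"
  shows "\<exists>r\<in>jb_spectrum a. jpoly p a - poly p r *\<^sub>R e\<^sub>J \<in> order_cone"
proof -
  define m where "m = - unit_sup (- jpoly p a)"
  define q where "q = p - [:m:]"
  have q_cone: "jpoly q a \<in> order_cone"
    using unit_sup_attained[of "- jpoly p a"] by (simp add: q_def m_def add.commute)
  have not_inv: "\<not> (\<exists>y\<in>jb_gen a. jpoly q a \<circ>\<^sub>J y = e\<^sub>J)"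
  proof
    assume "\<exists>y\<in>jb_gen a. jpoly q a \<circ>\<^sub>J y = e\<^sub>J"
    then obtain \<epsilon> where \<epsilon>: "0 < \<epsilon>" "jpoly q a - \<epsilon> *\<^sub>R e\<^sub>J \<in> order_cone"
      using order_cone_invertible_minus_unit[of "jpoly q a" a] q_cone by auto
    moreover have "jpoly q a - \<epsilon> *\<^sub>R e\<^sub>J = (- m - \<epsilon>) *\<^sub>R e\<^sub>J - (- jpoly p a)"
      by (simp add: q_def algebra_simps)
    ultimately have "unit_sup (- jpoly p a) \<le> - m - \<epsilon>"
      by (simp only: unit_sup_le_iff)
    with \<epsilon>(1) show False by (simp add: m_def)
  qed
  have "q \<noteq> 0" using assms by (auto simp: q_def)
  then obtain r where r: "r \<in> jb_spectrum a" "poly q r = 0"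
    using jpoly_invertible not_inv by blast
  then show ?thesis
    using q_cone by (intro bexI[of _ r]) (auto simp: q_def)
qed

lemma jb_spectrum_nonempty: "jb_spectrum a \<noteq> {}"
  using jpoly_minimum_nonconst[of "[:0, 1:]" a] by auto

lemma jpoly_minimum: "\<exists>r\<in>jb_spectrum a. jpoly p a - poly p r *\<^sub>R e\<^sub>J \<in> order_cone"
proof (cases "degree p = 0")
  case True
  then obtain c where "p = [:c:]" by (rule degree_eq_zeroE)
  then show ?thesis
    using jb_spectrum_nonempty[of a] by auto
qed (use jpoly_minimum_nonconst in auto)

lemma jpoly_in_order_cone_iff: "jpoly p a \<in> order_cone \<longleftrightarrow> (\<forall>r\<in>jb_spectrum a. 0 \<le> poly p r)"
proof
  assume nonneg: "\<forall>r\<in>jb_spectrum a. 0 \<le> poly p r"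
  obtain r where r: "r \<in> jb_spectrum a" "jpoly p a - poly p r *\<^sub>R e\<^sub>J \<in> order_cone"
    using jpoly_minimum by blast
  then have "(jpoly p a - poly p r *\<^sub>R e\<^sub>J) + poly p r *\<^sub>R e\<^sub>J \<in> order_cone"
    using nonneg by (intro order_cone_add order_cone_unit) auto
  then show "jpoly p a \<in> order_cone" by simp
qed (use jb_spectrum_poly_nonneg in blast)

lemma compact_jb_spectrum: "compact (jb_spectrum a)"
proof -
  have "\<bar>r\<bar> \<le> norm a" if "r \<in> jb_spectrum a" for r
  proof -
    have "jpoly [:norm a, - 1:] a \<in> order_cone" "jpoly [:norm a, 1:] a \<in> order_cone"
      using order_cone_one_minus[of a "norm a"] order_cone_one_plus[of a "norm a"]
      by (simp_all add: add.commute jprod.minus_right jprod.diff_right)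
    from this[THEN jb_spectrum_poly_nonneg, OF that] show ?thesis by simp
  qed
  then have "bounded (jb_spectrum a)"
    unfolding bounded_iff by auto
  \<comment> \<open>For \<open>r\<close> off the spectrum the square of \<open>a - r e\<close> is
    positive and invertible, so it dominates some \<epsilon> e. Evaluated on the spectrum this keeps
    every spectral point at distance at least \<open>sqrt \<epsilon>\<close> from
    \<open>r\<close>.\<close>
  moreover have "\<exists>d>0. ball r d \<subseteq> - jb_spectrum a" if "r \<notin> jb_spectrum a" for r
  proof -
    let ?p = "[:- r, 1:]"
    have "\<exists>y\<in>jb_gen a. jpoly (?p * ?p) a \<circ>\<^sub>J y = e\<^sub>J"
    proof (rule jpoly_invertible)
      fix s assume "s \<in> jb_spectrum a"
      then have "s \<noteq> r" using that by blast
      then show "poly (?p * ?p) s \<noteq> 0"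
        unfolding poly_mult by simp
    qed simp
    moreover have "jpoly (?p * ?p) a \<in> order_cone"
      unfolding jpoly_mult by (rule square_in_order_cone)
    ultimately obtain \<epsilon> where \<epsilon>: "0 < \<epsilon>" "jpoly (?p * ?p) a - \<epsilon> *\<^sub>R e\<^sub>J \<in> order_cone"
      using order_cone_invertible_minus_unit[of "jpoly (?p * ?p) a" a] jpoly_in_jb_gen by blast
    then have "jpoly (?p * ?p - [:\<epsilon>:]) a \<in> order_cone"
      unfolding jpoly_diff by simp
    from jb_spectrum_poly_nonneg[OF this] have far: "\<epsilon> \<le> (s - r)\<^sup>2" if "s \<in> jb_spectrum a" for s
      using that by (fastforce simp: power2_eq_square algebra_simps)
    have "ball r (sqrt \<epsilon>) \<subseteq> - jb_spectrum a"
    proof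
      fix s assume "s \<in> ball r (sqrt \<epsilon>)"
      then have "\<bar>s - r\<bar> < sqrt \<epsilon>"
        by (simp add: dist_real_def abs_minus_commute)
      then have "(s - r)\<^sup>2 < \<epsilon>"
        using \<epsilon>(1) by (metis abs_ge_zero power2_abs power_strict_mono real_sqrt_pow2 less_imp_le zero_less_numeral)
      then show "s \<in> - jb_spectrum a"
        using far by force
    qed
    then show ?thesis
      using \<epsilon>(1) by (intro exI[of _ "sqrt \<epsilon>"]) auto
  qed
  then have "open (- jb_spectrum a)"
    unfolding open_contains_ball by auto
  then have "closed (jb_spectrum a)"
    by (simp add: closed_def)
  ultimately show ?thesis
    by (simp add: compact_eq_bounded_closed)
qed

text \<open>For the converse, the product of the two positive elements is
  \<open>s\<^sup>2 e - x\<^sup>2\<close>, so monotonicity of the norm together with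
  \<open>norm (x\<^sup>2) = (norm x)\<^sup>2\<close> bounds \<open>norm x\<close>.\<close>

lemma norm_le_iff_jb_gen:
  assumes "x \<in> jb_gen a"
  shows "norm x \<le> s \<longleftrightarrow> s *\<^sub>R e\<^sub>J - x \<in> order_cone \<and> s *\<^sub>R e\<^sub>J + x \<in> order_cone"
proof
  assume le: "s *\<^sub>R e\<^sub>J - x \<in> order_cone \<and> s *\<^sub>R e\<^sub>J + x \<in> order_cone"
  then have "(s *\<^sub>R e\<^sub>J - x) + (s *\<^sub>R e\<^sub>J + x) \<in> order_cone"
    using order_cone_add by blast
  moreover have "(s *\<^sub>R e\<^sub>J - x) + (s *\<^sub>R e\<^sub>J + x) = (2 * s) *\<^sub>R e\<^sub>J"
    using scaleR_add_left[of s s "e\<^sub>J :: 'a"] by (simp only: mult_2) simp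
  ultimately have "(2 * s) *\<^sub>R e\<^sub>J \<in> (order_cone :: 'a set)"
    by (simp only:)
  from order_cone_minus_unit[OF this] have s: "0 \<le> s"
    by simp
  have "(s *\<^sub>R e\<^sub>J - x) \<circ>\<^sub>J (s *\<^sub>R e\<^sub>J + x) \<in> order_cone"
    using le assms by (intro order_cone_mult_jb_gen[of _ a]) simp_all
  then have "s\<^sup>2 *\<^sub>R e\<^sub>J - x \<circ>\<^sub>J x \<in> order_cone"
    by (simp add: jprod.diff_left jprod.add_right jprod.scaleR_left jprod.scaleR_right power2_eq_square algebra_simps)
  then have "norm (x \<circ>\<^sub>J x) \<le> norm (s\<^sup>2 *\<^sub>R (e\<^sub>J :: 'a))"
    by (intro norm_mono_order_cone square_in_order_cone)
  then have "(norm x)\<^sup>2 \<le> s\<^sup>2"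
    by (simp add: norm_jsquare)
  then show "norm x \<le> s"
    using s by (rule power2_le_imp_le)
qed (use order_cone_one_minus order_cone_one_plus in \<open>auto simp: add.commute\<close>)

lemma norm_eq_unit_sup: "norm x = max (unit_sup x) (unit_sup (- x))"
proof -
  have "norm x \<le> s \<longleftrightarrow> max (unit_sup x) (unit_sup (- x)) \<le> s" for s
    using norm_le_iff_jb_gen[of x x s] by (simp add: unit_sup_le_iff)
  from this[of "norm x"] this[of "max (unit_sup x) (unit_sup (- x))"] show ?thesis
    by (intro antisym) simp_all
qed

lemma norm_jpoly_le_iff: "norm (jpoly p a) \<le> s \<longleftrightarrow> (\<forall>r\<in>jb_spectrum a. \<bar>poly p r\<bar> \<le> s)"
proof -
  have "norm (jpoly p a) \<le> s \<longleftrightarrow> jpoly ([:s:] - p) a \<in> order_cone \<and> jpoly ([:s:] + p) a \<in> order_cone"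
    using norm_le_iff_jb_gen[of "jpoly p a" a s] by simp
  also have "\<dots> \<longleftrightarrow> (\<forall>r\<in>jb_spectrum a. \<bar>poly p r\<bar> \<le> s)"
    unfolding jpoly_in_order_cone_iff by (auto simp: abs_le_iff)
  finally show ?thesis .
qed

section \<open>Existence and uniqueness of the functional calculus\<close>

lemma continuous_on_poly_function [simp]: "continuous_on S (poly (p :: real poly))"
  using continuous_on_poly[OF continuous_on_id, of S p] by simp

lemma uniform_polynomial_approximation:
  fixes f :: "real \<Rightarrow> real"
  assumes "compact S" "continuous_on S f"
  obtains p :: "nat \<Rightarrow> real poly" where "uniform_limit S (\<lambda>n. poly (p n)) f sequentially"
proof -
  have "\<exists>p. \<forall>t\<in>S. \<bar>f t - poly p t\<bar> < inverse (real (Suc n))" for n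
  proof -
    obtain g where g: "real_polynomial_function g" "\<And>t. t \<in> S \<Longrightarrow> \<bar>f t - g t\<bar> < inverse (real (Suc n))"
      using Stone_Weierstrass_real_polynomial_function[OF assms, of "inverse (real (Suc n))"] by auto
    obtain c k where "g = (\<lambda>t. \<Sum>i\<le>k. c i * t ^ i)"
      using g(1) unfolding real_polynomial_function_iff_sum by blast
    then have "g = poly (\<Sum>i\<le>k. monom (c i) i)"
      by (simp add: poly_sum poly_monom fun_eq_iff)
    then show ?thesis
      using g(2) by blast
  qed
  then obtain p where p: "\<And>n t. t \<in> S \<Longrightarrow> \<bar>f t - poly (p n) t\<bar> < inverse (real (Suc n))"
    by metis
  have "uniform_limit S (\<lambda>n. poly (p n)) f sequentially"
    unfolding uniform_limit_iff
  proof (intro allI impI)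
    fix \<epsilon> :: real assume "0 < \<epsilon>"
    then have "eventually (\<lambda>n. inverse (real (Suc n)) < \<epsilon>) sequentially"
      using order_tendstoD(2)[OF LIMSEQ_inverse_real_of_nat] by blast
    then show "\<forall>\<^sub>F n in sequentially. \<forall>t\<in>S. dist (poly (p n) t) (f t) < \<epsilon>"
    proof eventually_elim
      case (elim n)
      show ?case
        unfolding dist_real_def using p[of _ n] elim by (metis abs_minus_commute less_trans)
    qed
  qed
  then show thesis by (rule that)
qed

lemma norm_jpoly_diff_less:
  assumes "0 < \<epsilon>" "\<And>t. t \<in> jb_spectrum a \<Longrightarrow> \<bar>poly p t - poly q t\<bar> < \<epsilon>"
  shows "norm (jpoly p a - jpoly q a) \<le> \<epsilon>"
proof -
  have "norm (jpoly (p - q) a) \<le> \<epsilon>"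
    unfolding norm_jpoly_le_iff using assms by (auto intro: less_imp_le)
  then show ?thesis by simp
qed

lemma jpoly_uniform_limit_Cauchy:
  assumes "uniform_limit (jb_spectrum a) (\<lambda>n. poly (p n)) f sequentially"
  shows "Cauchy (\<lambda>n. jpoly (p n) a)"
  unfolding Cauchy_def
proof (intro allI impI)
  fix \<epsilon> :: real assume \<epsilon>: "0 < \<epsilon>"
  then have "\<forall>\<^sub>F n in sequentially. \<forall>t\<in>jb_spectrum a. dist (poly (p n) t) (f t) < \<epsilon> / 4"
    using assms unfolding uniform_limit_iff by (meson divide_pos_pos zero_less_numeral)
  then obtain N where N: "\<And>n t. N \<le> n \<Longrightarrow> t \<in> jb_spectrum a \<Longrightarrow> dist (poly (p n) t) (f t) < \<epsilon> / 4"
    unfolding eventually_sequentially by blast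
  have "dist (jpoly (p m) a) (jpoly (p n) a) < \<epsilon>" if "N \<le> m" "N \<le> n" for m n
  proof -
    have "norm (jpoly (p m) a - jpoly (p n) a) \<le> \<epsilon> / 2"
    proof (rule norm_jpoly_diff_less)
      fix t assume t: "t \<in> jb_spectrum a"
      show "\<bar>poly (p m) t - poly (p n) t\<bar> < \<epsilon> / 2"
        using N[OF that(1) t] N[OF that(2) t] unfolding dist_real_def by linarith
    qed (use \<epsilon> in simp)
    then show ?thesis
      using \<epsilon> by (simp add: dist_norm)
  qed
  then show "\<exists>N. \<forall>m\<ge>N. \<forall>n\<ge>N. dist (jpoly (p m) a) (jpoly (p n) a) < \<epsilon>"
    by blast
qed

lemma jpoly_uniform_limit_unique:
  assumes "uniform_limit (jb_spectrum a) (\<lambda>n. poly (p n)) f sequentially"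
    and "uniform_limit (jb_spectrum a) (\<lambda>n. poly (q n)) f sequentially"
    and "(\<lambda>n. jpoly (p n) a) \<longlonglongrightarrow> x"
  shows "(\<lambda>n. jpoly (q n) a) \<longlonglongrightarrow> x"
proof -
  have "(\<lambda>n. jpoly (q n) a - jpoly (p n) a) \<longlonglongrightarrow> 0"
    unfolding tendsto_iff
  proof (intro allI impI)
    fix \<epsilon> :: real assume \<epsilon>: "0 < \<epsilon>"
    have "\<forall>\<^sub>F n in sequentially. \<forall>t\<in>jb_spectrum a. dist (poly (p n) t) (f t) < \<epsilon> / 4"
      "\<forall>\<^sub>F n in sequentially. \<forall>t\<in>jb_spectrum a. dist (poly (q n) t) (f t) < \<epsilon> / 4"
      using assms \<epsilon> unfolding uniform_limit_iff by (meson divide_pos_pos zero_less_numeral)+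
    then show "\<forall>\<^sub>F n in sequentially. dist (jpoly (q n) a - jpoly (p n) a) 0 < \<epsilon>"
    proof eventually_elim
      case (elim n)
      have "norm (jpoly (q n) a - jpoly (p n) a) \<le> \<epsilon> / 2"
      proof (rule norm_jpoly_diff_less)
        fix t assume t: "t \<in> jb_spectrum a"
        show "\<bar>poly (q n) t - poly (p n) t\<bar> < \<epsilon> / 2"
          using bspec[OF elim(1) t] bspec[OF elim(2) t] unfolding dist_real_def by linarith
      qed (use \<epsilon> in simp)
      then show ?case using \<epsilon> by simp
    qed
  qed
  from tendsto_add[OF this assms(3)] show ?thesis by simp
qed

text \<open>The choice is harmless: by \<open>norm_jpoly_le_iff\<close> uniformly convergent
  polynomials give Cauchy sequences, and by \<open>jpoly_uniform_limit_unique\<close> the limit does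
  not depend on the sequence.\<close>

definition cfc_limit :: "'a::jb_algebra \<Rightarrow> (real \<Rightarrow> real) \<Rightarrow> 'a" where
  "cfc_limit a f = (SOME x. \<exists>p. uniform_limit (jb_spectrum a) (\<lambda>n. poly (p n)) f sequentially
      \<and> (\<lambda>n. jpoly (p n) a) \<longlonglongrightarrow> x)"

lemma cfc_limit_tendsto:
  assumes "uniform_limit (jb_spectrum a) (\<lambda>n. poly (p n)) f sequentially"
  shows "(\<lambda>n. jpoly (p n) a) \<longlonglongrightarrow> cfc_limit a f"
proof -
  obtain x where "(\<lambda>n. jpoly (p n) a) \<longlonglongrightarrow> x"
    using jpoly_uniform_limit_Cauchy[OF assms] Cauchy_convergent convergent_def by blast
  then have "\<exists>x p. uniform_limit (jb_spectrum a) (\<lambda>n. poly (p n)) f sequentially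
      \<and> (\<lambda>n. jpoly (p n) a) \<longlonglongrightarrow> x"
    using assms by blast
  from someI_ex[OF this] show ?thesis
    unfolding cfc_limit_def using jpoly_uniform_limit_unique assms by blast
qed

lemma cfc_limit_eq:
  assumes "uniform_limit (jb_spectrum a) (\<lambda>n. poly (p n)) f sequentially"
    and "(\<lambda>n. jpoly (p n) a) \<longlonglongrightarrow> x"
  shows "cfc_limit a f = x"
  using cfc_limit_tendsto[OF assms(1)] assms(2) by (rule LIMSEQ_unique)

lemma cfc_limit_poly [simp]: "cfc_limit a (poly p) = jpoly p a"
  by (rule cfc_limit_eq[where p = "\<lambda>_. p"]) (simp_all add: uniform_limit_const)

lemma cfc_approximation:
  assumes "continuous_on (jb_spectrum a) f"
  obtains p where "uniform_limit (jb_spectrum a) (\<lambda>n. poly (p n)) f sequentially"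
    "(\<lambda>n. jpoly (p n) a) \<longlonglongrightarrow> cfc_limit a f"
proof -
  obtain p where p: "uniform_limit (jb_spectrum a) (\<lambda>n. poly (p n)) f sequentially"
    using uniform_polynomial_approximation[OF compact_jb_spectrum assms] .
  show thesis
    by (rule that[OF p cfc_limit_tendsto[OF p]])
qed

lemma cfc_limit_add:
  assumes "continuous_on (jb_spectrum a) f" "continuous_on (jb_spectrum a) g"
  shows "cfc_limit a (\<lambda>t. f t + g t) = cfc_limit a f + cfc_limit a g"
proof -
  obtain p where p: "uniform_limit (jb_spectrum a) (\<lambda>n. poly (p n)) f sequentially"
      "(\<lambda>n. jpoly (p n) a) \<longlonglongrightarrow> cfc_limit a f"
    using cfc_approximation[OF assms(1)] .
  obtain q where q: "uniform_limit (jb_spectrum a) (\<lambda>n. poly (q n)) g sequentially"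
      "(\<lambda>n. jpoly (q n) a) \<longlonglongrightarrow> cfc_limit a g"
    using cfc_approximation[OF assms(2)] .
  have "poly (p n + q n) = (\<lambda>t. poly (p n) t + poly (q n) t)" for n
    by (simp add: fun_eq_iff)
  then have "uniform_limit (jb_spectrum a) (\<lambda>n. poly (p n + q n)) (\<lambda>t. f t + g t) sequentially"
    using uniform_limit_add[OF p(1) q(1)] by (simp only:)
  then show ?thesis
    by (rule cfc_limit_eq) (use tendsto_add[OF p(2) q(2)] in simp)
qed

lemma continuous_on_spectrum_bounded:
  fixes f :: "real \<Rightarrow> real"
  assumes "continuous_on (jb_spectrum a) f"
  shows "bounded (f ` jb_spectrum a)"
  using assms by (simp add: compact_continuous_image compact_imp_bounded compact_jb_spectrum)

lemma cfc_limit_mult: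
  assumes "continuous_on (jb_spectrum a) f" "continuous_on (jb_spectrum a) g"
  shows "cfc_limit a (\<lambda>t. f t * g t) = cfc_limit a f \<circ>\<^sub>J cfc_limit a g"
proof -
  obtain p where p: "uniform_limit (jb_spectrum a) (\<lambda>n. poly (p n)) f sequentially"
      "(\<lambda>n. jpoly (p n) a) \<longlonglongrightarrow> cfc_limit a f"
    using cfc_approximation[OF assms(1)] .
  obtain q where q: "uniform_limit (jb_spectrum a) (\<lambda>n. poly (q n)) g sequentially"
      "(\<lambda>n. jpoly (q n) a) \<longlonglongrightarrow> cfc_limit a g"
    using cfc_approximation[OF assms(2)] .
  have "poly (p n * q n) = (\<lambda>t. poly (p n) t * poly (q n) t)" for n
    by (simp add: fun_eq_iff)
  then have "uniform_limit (jb_spectrum a) (\<lambda>n. poly (p n * q n)) (\<lambda>t. f t * g t) sequentially"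
    using uniform_lim_mult[OF p(1) q(1) assms[THEN continuous_on_spectrum_bounded]] by (simp only:)
  then show ?thesis
    by (rule cfc_limit_eq) (use jprod.tendsto[OF p(2) q(2)] in simp)
qed

lemma norm_cfc_limit_le_iff:
  assumes "continuous_on (jb_spectrum a) f"
  shows "norm (cfc_limit a f) \<le> s \<longleftrightarrow> (\<forall>t\<in>jb_spectrum a. \<bar>f t\<bar> \<le> s)"
proof -
  obtain p where p: "uniform_limit (jb_spectrum a) (\<lambda>n. poly (p n)) f sequentially"
      "(\<lambda>n. jpoly (p n) a) \<longlonglongrightarrow> cfc_limit a f"
    using cfc_approximation[OF assms] .
  have near: "\<forall>\<^sub>F n in sequentially. (\<forall>t\<in>jb_spectrum a. \<bar>poly (p n) t - f t\<bar> < \<epsilon>)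
      \<and> norm (jpoly (p n) a - cfc_limit a f) < \<epsilon>" if "0 < \<epsilon>" for \<epsilon>
    using p that unfolding uniform_limit_iff tendsto_iff dist_norm by (auto intro: eventually_conj)
  show ?thesis
  proof
    assume s: "norm (cfc_limit a f) \<le> s"
    show "\<forall>t\<in>jb_spectrum a. \<bar>f t\<bar> \<le> s"
    proof (rule ballI, rule field_le_epsilon)
      fix t \<epsilon> :: real assume t: "t \<in> jb_spectrum a" and "0 < \<epsilon>"
      then obtain n where n: "\<forall>t\<in>jb_spectrum a. \<bar>poly (p n) t - f t\<bar> < \<epsilon> / 2"
          "norm (jpoly (p n) a - cfc_limit a f) < \<epsilon> / 2"
        using near[of "\<epsilon> / 2"] unfolding eventually_sequentially by auto
      have "norm (jpoly (p n) a) \<le> s + \<epsilon> / 2"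
        using n(2) s norm_triangle_ineq2[of "jpoly (p n) a" "cfc_limit a f"] by linarith
      then have "\<bar>poly (p n) t\<bar> \<le> s + \<epsilon> / 2"
        using t norm_jpoly_le_iff by blast
      then show "\<bar>f t\<bar> \<le> s + \<epsilon>"
        using bspec[OF n(1) t] by linarith
    qed
  next
    assume s: "\<forall>t\<in>jb_spectrum a. \<bar>f t\<bar> \<le> s"
    show "norm (cfc_limit a f) \<le> s"
    proof (rule field_le_epsilon)
      fix \<epsilon> :: real assume "0 < \<epsilon>"
      then obtain n where n: "\<forall>t\<in>jb_spectrum a. \<bar>poly (p n) t - f t\<bar> < \<epsilon> / 2"
          "norm (jpoly (p n) a - cfc_limit a f) < \<epsilon> / 2"
        using near[of "\<epsilon> / 2"] unfolding eventually_sequentially by auto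
      have "norm (jpoly (p n) a) \<le> s + \<epsilon> / 2"
        unfolding norm_jpoly_le_iff
      proof
        fix t assume t: "t \<in> jb_spectrum a"
        show "\<bar>poly (p n) t\<bar> \<le> s + \<epsilon> / 2"
          using bspec[OF n(1) t] bspec[OF s t] by linarith
      qed
      then show "norm (cfc_limit a f) \<le> s + \<epsilon>"
        using n(2) norm_triangle_ineq3[of "jpoly (p n) a" "cfc_limit a f"] by linarith
    qed
  qed
qed

lemma cfc_limit_const: "cfc_limit a (\<lambda>_. c) = c *\<^sub>R e\<^sub>J"
proof -
  have "poly [:c:] = (\<lambda>_. c)" by (simp add: fun_eq_iff)
  then show ?thesis
    using cfc_limit_poly[of a "[:c:]"] by simp
qed

lemma cfc_limit_cmult:
  assumes "continuous_on (jb_spectrum a) f"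
  shows "cfc_limit a (\<lambda>t. c * f t) = c *\<^sub>R cfc_limit a f"
  using cfc_limit_mult[OF continuous_on_const assms] by (simp add: cfc_limit_const jprod.scaleR_left)

lemma cfc_limit_id [simp]: "cfc_limit a (\<lambda>t. t) = a"
proof -
  have "poly [:0, 1:] = (\<lambda>t :: real. t)" by (simp add: fun_eq_iff)
  then show ?thesis
    using cfc_limit_poly[of a "[:0, 1:]"] by simp
qed

lemma norm_cfc_limit:
  assumes "continuous_on (jb_spectrum a) f"
  shows "norm (cfc_limit a f) = (SUP t\<in>jb_spectrum a. \<bar>f t\<bar>)"
proof (rule antisym)
  have "bdd_above ((\<lambda>t. \<bar>f t\<bar>) ` jb_spectrum a)"
    using assms by (intro bounded_imp_bdd_above continuous_on_spectrum_bounded continuous_intros)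
  then show "norm (cfc_limit a f) \<le> (SUP t\<in>jb_spectrum a. \<bar>f t\<bar>)"
    unfolding norm_cfc_limit_le_iff[OF assms] by (auto intro: cSUP_upper)
  show "(SUP t\<in>jb_spectrum a. \<bar>f t\<bar>) \<le> norm (cfc_limit a f)"
    using jb_spectrum_nonempty norm_cfc_limit_le_iff[OF assms, of "norm (cfc_limit a f)"]
    by (intro cSUP_least) auto
qed

lemma cfc_limit_range: "cfc_limit a ` {f. continuous_on (jb_spectrum a) f} = jb_gen a"
proof (intro equalityI subsetI)
  fix x assume "x \<in> cfc_limit a ` {f. continuous_on (jb_spectrum a) f}"
  then obtain f where "continuous_on (jb_spectrum a) f" "x = cfc_limit a f" by blast
  then obtain p where "(\<lambda>n. jpoly (p n) a) \<longlonglongrightarrow> x"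
    using cfc_approximation by blast
  then show "x \<in> jb_gen a"
    using closed_jsubalgebraD(2)[OF closed_jsubalgebra_jb_gen]
    by (rule closed_sequentially[rotated 2]) simp
next
  fix x assume "x \<in> jb_gen a"
  then obtain p where p: "(\<lambda>n. jpoly (p n) a) \<longlonglongrightarrow> x"
    using jb_gen_limit by blast
  \<comment> \<open>Surjectivity runs the isometry backwards: a sequence of polynomials converging
    in the algebra is uniformly Cauchy on the spectrum, and its uniform limit is the function
    sought.\<close>
  have "uniformly_Cauchy_on (jb_spectrum a) (\<lambda>n. poly (p n))"
    unfolding uniformly_Cauchy_on_def
  proof (intro allI impI)
    fix \<epsilon> :: real assume \<epsilon>: "0 < \<epsilon>"
    obtain N where N: "\<And>m n. N \<le> m \<Longrightarrow> N \<le> n \<Longrightarrow> dist (jpoly (p m) a) (jpoly (p n) a) < \<epsilon> / 2"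
      using LIMSEQ_imp_Cauchy[OF p] \<epsilon> unfolding Cauchy_def by (meson half_gt_zero)
    have "dist (poly (p m) t) (poly (p n) t) < \<epsilon>"
      if "t \<in> jb_spectrum a" "N \<le> m" "N \<le> n" for t m n
    proof -
      have "norm (jpoly (p m - p n) a) \<le> \<epsilon> / 2"
        using N[of m n] that by (simp add: dist_norm less_imp_le)
      then have "\<bar>poly (p m - p n) t\<bar> \<le> \<epsilon> / 2"
        using that norm_jpoly_le_iff by blast
      then show ?thesis
        using \<epsilon> by (simp add: dist_real_def)
    qed
    then show "\<exists>M. \<forall>t\<in>jb_spectrum a. \<forall>m\<ge>M. \<forall>n\<ge>M. dist (poly (p m) t) (poly (p n) t) < \<epsilon>"
      by blast
  qed
  then obtain f where f: "uniform_limit (jb_spectrum a) (\<lambda>n. poly (p n)) f sequentially"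
    using Cauchy_uniformly_convergent unfolding uniformly_convergent_on_def by blast
  have "continuous_on (jb_spectrum a) f"
    by (rule uniform_limit_theorem[OF _ f]) simp_all
  moreover have "x = cfc_limit a f"
    using cfc_limit_eq[OF f p] by simp
  ultimately show "x \<in> cfc_limit a ` {f. continuous_on (jb_spectrum a) f}"
    by blast
qed

lemma is_cfc_cfc_limit: "is_cfc a (cfc_limit a)"
  unfolding is_cfc_def Let_def
  by (simp add: cfc_limit_const cfc_limit_add cfc_limit_cmult cfc_limit_mult norm_cfc_limit cfc_limit_range)

text \<open>The algebraic conditions force the values at polynomials. The norm condition, applied to
  the difference of \<open>f\<close> and an approximating polynomial, then forces the value at
  \<open>f\<close>.\<close>

lemma is_cfc_unique:
  assumes \<Phi>: "is_cfc a \<Phi>" and f: "continuous_on (jb_spectrum a) f"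
  shows "\<Phi> f = cfc_limit a f"
proof -
  let ?C = "{f. continuous_on (jb_spectrum a) f}"
  have one: "\<Phi> (\<lambda>_. 1) = e\<^sub>J" and id: "\<Phi> (\<lambda>t. t) = a"
    and add: "\<And>f g. f \<in> ?C \<Longrightarrow> g \<in> ?C \<Longrightarrow> \<Phi> (\<lambda>t. f t + g t) = \<Phi> f + \<Phi> g"
    and cmult: "\<And>c f. f \<in> ?C \<Longrightarrow> \<Phi> (\<lambda>t. c * f t) = c *\<^sub>R \<Phi> f"
    and mult: "\<And>f g. f \<in> ?C \<Longrightarrow> g \<in> ?C \<Longrightarrow> \<Phi> (\<lambda>t. f t * g t) = \<Phi> f \<circ>\<^sub>J \<Phi> g"
    and norm: "\<And>f. f \<in> ?C \<Longrightarrow> norm (\<Phi> f) = (SUP t\<in>jb_spectrum a. \<bar>f t\<bar>)"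
    using \<Phi> unfolding is_cfc_def Let_def by blast+
  have poly_C: "poly p \<in> ?C" for p :: "real poly"
    by simp
  have const: "\<Phi> (\<lambda>_. c) = c *\<^sub>R e\<^sub>J" for c
    using cmult[of "\<lambda>_. 1" c] one by simp
  have poly: "\<Phi> (poly p) = jpoly p a" for p
  proof (induction p)
    case 0
    show ?case using const[of 0] by (simp add: fun_eq_iff)
  next
    case (pCons c p)
    have "\<Phi> (\<lambda>t. c + t * poly p t) = \<Phi> (\<lambda>_. c) + \<Phi> (\<lambda>t. t * poly p t)"
      by (rule add) (auto intro!: continuous_intros)
    also have "\<Phi> (\<lambda>t. t * poly p t) = a \<circ>\<^sub>J jpoly p a"
      using mult[of "\<lambda>t. t" "poly p"] poly_C id pCons by simp
    also have "(\<lambda>t. c + t * poly p t) = poly (pCons c p)"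
      by (simp add: fun_eq_iff)
    finally show ?case by (simp add: const)
  qed
  obtain p where p: "uniform_limit (jb_spectrum a) (\<lambda>n. poly (p n)) f sequentially"
      "(\<lambda>n. jpoly (p n) a) \<longlonglongrightarrow> cfc_limit a f"
    using cfc_approximation[OF f] .
  have "(\<lambda>n. jpoly (p n) a) \<longlonglongrightarrow> \<Phi> f"
    unfolding tendsto_iff
  proof (intro allI impI)
    fix \<epsilon> :: real assume \<epsilon>: "0 < \<epsilon>"
    then have "\<forall>\<^sub>F n in sequentially. \<forall>t\<in>jb_spectrum a. dist (poly (p n) t) (f t) < \<epsilon> / 2"
      using p(1) unfolding uniform_limit_iff by (meson half_gt_zero)
    then show "\<forall>\<^sub>F n in sequentially. dist (jpoly (p n) a) (\<Phi> f) < \<epsilon>"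
    proof eventually_elim
      case (elim n)
      have "\<Phi> (\<lambda>t. poly (p n) t + (- 1) * f t) = \<Phi> (poly (p n)) + \<Phi> (\<lambda>t. (- 1) * f t)"
        by (rule add) (use f poly_C in \<open>auto intro!: continuous_intros\<close>)
      also have "\<Phi> (\<lambda>t. (- 1) * f t) = (- 1) *\<^sub>R \<Phi> f"
        by (rule cmult) (use f in simp)
      finally have "jpoly (p n) a - \<Phi> f = \<Phi> (\<lambda>t. poly (p n) t + (- 1) * f t)"
        by (simp add: poly)
      also have "norm \<dots> = (SUP t\<in>jb_spectrum a. \<bar>poly (p n) t + (- 1) * f t\<bar>)"
        by (rule norm) (use f in \<open>auto intro!: continuous_intros\<close>)
      also have "\<dots> \<le> \<epsilon> / 2"
        using elim jb_spectrum_nonempty by (intro cSUP_least) (auto simp: dist_real_def less_imp_le)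
      finally show ?case
        using \<epsilon> by (simp add: dist_norm)
    qed
  qed
  then show ?thesis
    using p(2) LIMSEQ_unique by blast
qed

text \<open>The description in \<open>jb_cfc\<close> ranges over the value and not over \<Phi>,
  which is arbitrary at functions that are discontinuous on the spectrum; continuity of
  \<open>f\<close> makes it denote.\<close>

lemma jb_cfc_eq_cfc_limit:
  assumes "continuous_on (jb_spectrum a) f"
  shows "jb_cfc f a = cfc_limit a f"
  unfolding jb_cfc_def using is_cfc_cfc_limit is_cfc_unique[OF _ assms] by (intro the_equality) blast+

section \<open>Properties of the functional calculus\<close>

lemma jb_cfc_const: "jb_cfc (\<lambda>_. c) a = c *\<^sub>R e\<^sub>J"
  by (simp add: jb_cfc_eq_cfc_limit cfc_limit_const)

lemma jb_cfc_id: "jb_cfc (\<lambda>t. t) a = a"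
  by (simp add: jb_cfc_eq_cfc_limit)

lemma jb_cfc_tendsto:
  assumes "uniform_limit (jb_spectrum a) (\<lambda>n. poly (p n)) f sequentially"
  shows "(\<lambda>n. jpoly (p n) a) \<longlonglongrightarrow> jb_cfc f a"
proof -
  have "continuous_on (jb_spectrum a) f"
    by (rule uniform_limit_theorem[OF _ assms]) simp_all
  then show ?thesis
    using cfc_limit_tendsto[OF assms] by (simp add: jb_cfc_eq_cfc_limit)
qed

context
  fixes a :: "'a::jb_algebra" and f g :: "real \<Rightarrow> real"
  assumes f: "continuous_on (jb_spectrum a) f" and g: "continuous_on (jb_spectrum a) g"
begin

lemma jb_cfc_add: "jb_cfc (\<lambda>t. f t + g t) a = jb_cfc f a + jb_cfc g a"
  using f g by (simp add: jb_cfc_eq_cfc_limit cfc_limit_add continuous_on_add)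

lemma jb_cfc_mult: "jb_cfc (\<lambda>t. f t * g t) a = jb_cfc f a \<circ>\<^sub>J jb_cfc g a"
  using f g by (simp add: jb_cfc_eq_cfc_limit cfc_limit_mult continuous_on_mult)

lemma jb_cfc_diff: "jb_cfc (\<lambda>t. f t - g t) a = jb_cfc f a - jb_cfc g a"
proof -
  have "continuous_on (jb_spectrum a) (\<lambda>t. (- 1) * g t)"
    using g by (intro continuous_intros)
  then have "jb_cfc (\<lambda>t. f t + (- 1) * g t) a = jb_cfc f a + (- 1) *\<^sub>R jb_cfc g a"
    using f g cfc_limit_add[of a f "\<lambda>t. (- 1) * g t"] cfc_limit_cmult[OF g, of "- 1"]
    by (simp add: jb_cfc_eq_cfc_limit continuous_on_diff)
  then show ?thesis by simp
qed

end

lemma norm_jb_cfc_le_iff: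
  assumes "continuous_on (jb_spectrum a) f"
  shows "norm (jb_cfc f a) \<le> s \<longleftrightarrow> (\<forall>t\<in>jb_spectrum a. \<bar>f t\<bar> \<le> s)"
  using assms by (simp add: jb_cfc_eq_cfc_limit norm_cfc_limit_le_iff)

lemma jb_spectrum_abs_le: "t \<in> jb_spectrum a \<Longrightarrow> \<bar>t\<bar> \<le> norm a"
  using norm_jb_cfc_le_iff[of a "\<lambda>t. t" "norm a"] by (simp add: jb_cfc_id)

lemma jb_cfc_cong:
  assumes "continuous_on (jb_spectrum a) f" "\<And>t. t \<in> jb_spectrum a \<Longrightarrow> f t = g t"
  shows "jb_cfc f a = jb_cfc g a"
proof -
  have g: "continuous_on (jb_spectrum a) g"
    using assms by (simp cong: continuous_on_cong)
  have "norm (jb_cfc (\<lambda>t. f t - g t) a) \<le> 0"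
    using assms g by (subst norm_jb_cfc_le_iff) (auto intro!: continuous_intros)
  then show ?thesis
    using jb_cfc_diff[OF assms(1) g] by simp
qed

lemma jb_cfc_in_order_cone_iff:
  assumes "continuous_on (jb_spectrum a) f"
  shows "jb_cfc f a \<in> order_cone \<longleftrightarrow> (\<forall>t\<in>jb_spectrum a. 0 \<le> f t)"
proof
  assume nonneg: "\<forall>t\<in>jb_spectrum a. 0 \<le> f t"
  have c: "continuous_on (jb_spectrum a) (\<lambda>t. sqrt (f t))"
    using assms by (intro continuous_intros)
  have "jb_cfc (\<lambda>t. sqrt (f t)) a \<circ>\<^sub>J jb_cfc (\<lambda>t. sqrt (f t)) a = jb_cfc f a"
    unfolding jb_cfc_mult[OF c c, symmetric]
    by (rule jb_cfc_cong[symmetric]) (use assms nonneg in simp_all)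
  then show "jb_cfc f a \<in> order_cone"
    using square_in_order_cone by metis
next
  assume "jb_cfc f a \<in> order_cone"
  then obtain s where "norm (s *\<^sub>R e\<^sub>J - jb_cfc f a) \<le> s"
    by (auto simp: order_cone_def)
  then have "norm (jb_cfc (\<lambda>t. s - f t) a) \<le> s"
    using assms by (simp add: jb_cfc_diff jb_cfc_const)
  then have "\<forall>t\<in>jb_spectrum a. \<bar>s - f t\<bar> \<le> s"
    using assms by (subst (asm) norm_jb_cfc_le_iff) (auto intro!: continuous_intros)
  then show "\<forall>t\<in>jb_spectrum a. 0 \<le> f t" by fastforce
qed

lemma unit_sup_le_iff_spectrum: "unit_sup a \<le> s \<longleftrightarrow> (\<forall>t\<in>jb_spectrum a. t \<le> s)"
  using jpoly_in_order_cone_iff[of "[:s, - 1:]" a]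
  by (auto simp: unit_sup_le_iff jprod.diff_right jprod.minus_right)

text \<open>The functional calculus gives an exact square root, where the fixed point construction
  needed a shift by a multiple of the unit.\<close>

lemma order_cone_eq_jb_cone: "order_cone = jb_cone"
proof
  show "order_cone \<subseteq> (jb_cone :: 'a set)"
  proof
    fix x :: 'a assume "x \<in> order_cone"
    then have pos: "\<forall>t\<in>jb_spectrum x. 0 \<le> t"
      using jb_cfc_in_order_cone_iff[of x "\<lambda>t. t"] by (simp add: jb_cfc_id)
    have c: "continuous_on (jb_spectrum x) sqrt"
      by (intro continuous_intros)
    have "jb_cfc sqrt x \<circ>\<^sub>J jb_cfc sqrt x = jb_cfc (\<lambda>t. t) x"
      unfolding jb_cfc_mult[OF c c, symmetric]
      by (rule jb_cfc_cong[symmetric]) (use pos in simp_all)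
    then show "x \<in> jb_cone"
      unfolding jb_cone_def by (intro range_eqI[of _ _ "jb_cfc sqrt x"]) (simp add: jb_cfc_id)
  qed
qed (auto simp: jb_cone_def square_in_order_cone)

lemma jpoly_jb_cfc:
  assumes "continuous_on (jb_spectrum a) g"
  shows "jpoly p (jb_cfc g a) = jb_cfc (\<lambda>t. poly p (g t)) a"
proof (induction p)
  case 0
  show ?case using jb_cfc_const[of 0 a] by simp
next
  case (pCons c p)
  have "continuous_on (jb_spectrum a) (\<lambda>t. poly p (g t))"
    using assms by (intro continuous_intros)
  then show ?case
    using assms pCons by (simp add: jb_cfc_add jb_cfc_mult jb_cfc_const continuous_on_mult)
qed

text \<open>Working on an interval around the range of \<open>g\<close> makes an exact spectral
  mapping theorem unnecessary: it contains both the range and the spectrum of \<open>g(a)\<close>,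
  and for polynomials approximating \<open>h\<close> on it the claim is
  \<open>jpoly_jb_cfc\<close>.\<close>

lemma jb_cfc_compose:
  assumes g: "continuous_on (jb_spectrum a) g" "g ` jb_spectrum a \<subseteq> {m..M}"
    and h: "continuous_on {m..M} h"
  shows "jb_cfc h (jb_cfc g a) = jb_cfc (\<lambda>t. h (g t)) a"
proof -
  let ?b = "jb_cfc g a"
  obtain p where p: "uniform_limit {m..M} (\<lambda>n. poly (p n)) h sequentially"
    using uniform_polynomial_approximation[OF compact_Icc h] .
  have "jpoly [:- m, 1:] ?b \<in> order_cone" "jpoly [:M, - 1:] ?b \<in> order_cone"
    unfolding jpoly_jb_cfc[OF g(1)]
    by (subst jb_cfc_in_order_cone_iff; use g in \<open>force intro!: continuous_intros\<close>)+
  then have "jb_spectrum ?b \<subseteq> {m..M}"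
    unfolding jpoly_in_order_cone_iff by auto
  then have "(\<lambda>n. jpoly (p n) ?b) \<longlonglongrightarrow> jb_cfc h ?b"
    by (intro jb_cfc_tendsto uniform_limit_on_subset[OF p])
  moreover have "(\<lambda>n. jpoly (p n) ?b) \<longlonglongrightarrow> jb_cfc (\<lambda>t. h (g t)) a"
    unfolding tendsto_iff
  proof (intro allI impI)
    fix \<epsilon> :: real assume \<epsilon>: "0 < \<epsilon>"
    then have "\<forall>\<^sub>F n in sequentially. \<forall>t\<in>{m..M}. dist (poly (p n) t) (h t) < \<epsilon> / 2"
      using p unfolding uniform_limit_iff by (meson half_gt_zero)
    then show "\<forall>\<^sub>F n in sequentially. dist (jpoly (p n) ?b) (jb_cfc (\<lambda>t. h (g t)) a) < \<epsilon>"
    proof eventually_elim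
      case (elim n)
      have c: "continuous_on (jb_spectrum a) (\<lambda>t. poly (p n) (g t))"
        "continuous_on (jb_spectrum a) (\<lambda>t. h (g t))"
        using g h by (auto intro!: continuous_intros intro: continuous_on_compose2)
      have "norm (jb_cfc (\<lambda>t. poly (p n) (g t) - h (g t)) a) \<le> \<epsilon> / 2"
        using elim g(2) continuous_on_diff[OF c]
        by (subst norm_jb_cfc_le_iff) (force simp: dist_real_def less_imp_le)+
      then show ?case
        using \<epsilon> by (simp add: jpoly_jb_cfc[OF g(1)] dist_norm jb_cfc_diff[OF c])
    qed
  qed
  ultimately show ?thesis
    by (rule LIMSEQ_unique)
qed

section \<open>Exponential and logarithm\<close>

text \<open>The Taylor polynomials converge uniformly on the bounded spectrum. The series form is
  what connects the functional calculus with exponentials of operators.\<close>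

lemma jb_exp_sums: "(\<lambda>n. (1 / fact n) *\<^sub>R jpow a n) sums jb_exp a"
proof -
  define p :: "nat \<Rightarrow> real poly" where "p n = (\<Sum>i<n. monom (1 / fact i) i)" for n
  obtain M where M: "\<And>t. t \<in> jb_spectrum a \<Longrightarrow> norm t \<le> M"
    using compact_imp_bounded[OF compact_jb_spectrum] unfolding bounded_iff by blast
  have "uniform_limit (jb_spectrum a) (\<lambda>n t. \<Sum>i<n. t ^ i / fact i) (\<lambda>t. \<Sum>i. t ^ i / fact i) sequentially"
  proof (rule Weierstrass_m_test)
    show "summable (\<lambda>n. M ^ n / fact n)"
      using summable_exp[of M] by (simp add: field_simps)
    show "norm (t ^ n / fact n) \<le> M ^ n / fact n" if "t \<in> jb_spectrum a" for n t
      using M[OF that] by (simp add: power_abs divide_right_mono power_mono)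
  qed
  moreover have "(\<lambda>t :: real. \<Sum>i. t ^ i / fact i) = exp"
    by (simp add: fun_eq_iff exp_def divide_inverse mult.commute)
  moreover have "poly (p n) = (\<lambda>t. \<Sum>i<n. t ^ i / fact i)" for n
    by (simp add: p_def poly_sum poly_monom fun_eq_iff)
  ultimately have "uniform_limit (jb_spectrum a) (\<lambda>n. poly (p n)) exp sequentially"
    by (simp only:)
  from jb_cfc_tendsto[OF this] have "(\<lambda>n. jpoly (p n) a) \<longlonglongrightarrow> jb_exp a"
    by (simp add: jb_exp_def)
  moreover have "jpoly (p n) a = (\<Sum>i<n. (1 / fact i) *\<^sub>R jpow a i)" for n
    by (induction n) (simp_all add: p_def)
  ultimately show ?thesis
    by (simp add: sums_def)
qed

lemma jb_log_exp [simp]: "jb_log (jb_exp a) = a"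
proof -
  let ?n = "norm a"
  have "jb_spectrum a \<subseteq> {- ?n..?n}"
    using jb_spectrum_abs_le[of _ a] by (force simp: abs_le_iff)
  then have "jb_cfc ln (jb_cfc exp a) = jb_cfc (\<lambda>t. ln (exp t)) a"
    by (intro jb_cfc_compose[of _ _ "exp (- ?n)" "exp ?n"])
      (auto intro!: continuous_intros dest: subsetD)
  then show ?thesis
    by (simp add: jb_exp_def jb_log_def jb_cfc_id)
qed

lemma jb_exp_log:
  assumes "b - \<epsilon> *\<^sub>R e\<^sub>J \<in> order_cone" "0 < \<epsilon>"
  shows "jb_exp (jb_log b) = b"
proof -
  let ?n = "norm b"
  have "jpoly [:- \<epsilon>, 1:] b \<in> order_cone"
    using assms by simp
  then have low: "\<epsilon> \<le> t" if "t \<in> jb_spectrum b" for t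
    unfolding jpoly_in_order_cone_iff using that by fastforce
  have spec: "t \<in> {\<epsilon>..?n}" if "t \<in> jb_spectrum b" for t
    using jb_spectrum_abs_le[OF that] low[OF that] by simp
  have "jb_cfc exp (jb_cfc ln b) = jb_cfc (\<lambda>t. exp (ln t)) b"
  proof (rule jb_cfc_compose[of _ _ "ln \<epsilon>" "ln ?n"])
    show "ln ` jb_spectrum b \<subseteq> {ln \<epsilon>..ln ?n}"
    proof
      fix s assume "s \<in> ln ` jb_spectrum b"
      then obtain t where t: "t \<in> jb_spectrum b" "s = ln t" by blast
      then show "s \<in> {ln \<epsilon>..ln ?n}"
        using spec[OF t(1)] assms(2) by (auto intro!: ln_mono)
    qed
  qed (use assms(2) low in \<open>force intro!: continuous_intros\<close>)+
  also have "\<dots> = jb_cfc (\<lambda>t. t) b"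
    by (rule jb_cfc_cong) (use assms(2) low in \<open>fastforce intro!: continuous_intros\<close>)+
  finally show ?thesis
    by (simp add: jb_exp_def jb_log_def jb_cfc_id)
qed

lemma jb_exp_ge: "jb_exp a - exp (- norm a) *\<^sub>R e\<^sub>J \<in> order_cone"
proof -
  have "jb_exp a - exp (- norm a) *\<^sub>R e\<^sub>J = jb_cfc (\<lambda>t. exp t - exp (- norm a)) a"
    by (simp add: jb_exp_def jb_cfc_diff jb_cfc_const continuous_intros)
  also have "\<dots> \<in> order_cone"
    using jb_spectrum_abs_le[of _ a]
    by (subst jb_cfc_in_order_cone_iff) (force intro!: continuous_intros simp: abs_le_iff)+
  finally show ?thesis .
qed

lemma jb_pos_iff: "b \<in> jb_pos \<longleftrightarrow> (\<exists>\<epsilon>>0. b - \<epsilon> *\<^sub>R e\<^sub>J \<in> order_cone)"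
proof
  assume "b \<in> jb_pos"
  then obtain d where d: "0 < d" "cball b d \<subseteq> order_cone"
    unfolding jb_pos_def order_cone_eq_jb_cone by (auto simp: mem_interior_cball)
  have "b - d *\<^sub>R e\<^sub>J \<in> cball b d"
    using d(1) by (simp add: dist_norm)
  then show "\<exists>\<epsilon>>0. b - \<epsilon> *\<^sub>R e\<^sub>J \<in> order_cone"
    using d by blast
next
  assume "\<exists>\<epsilon>>0. b - \<epsilon> *\<^sub>R e\<^sub>J \<in> order_cone"
  then obtain \<epsilon> where \<epsilon>: "0 < \<epsilon>" "b - \<epsilon> *\<^sub>R e\<^sub>J \<in> order_cone" by blast
  have "cball b \<epsilon> \<subseteq> order_cone"
  proof
    fix x assume "x \<in> cball b \<epsilon>"
    then have "(x - b) + \<epsilon> *\<^sub>R e\<^sub>J \<in> order_cone"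
      by (intro order_cone_one_plus) (simp add: dist_norm norm_minus_commute)
    from order_cone_add[OF \<epsilon>(2) this] show "x \<in> order_cone" by simp
  qed
  then show "b \<in> jb_pos"
    unfolding jb_pos_def order_cone_eq_jb_cone[symmetric] mem_interior_cball using \<epsilon>(1) by blast
qed

lemma jb_exp_pos [simp]: "jb_exp a \<in> jb_pos"
  unfolding jb_pos_iff using jb_exp_ge[of a] by (intro exI[of _ "exp (- norm a)"]) simp

lemma jb_exp_jb_log [simp]: "b \<in> jb_pos \<Longrightarrow> jb_exp (jb_log b) = b"
  unfolding jb_pos_iff using jb_exp_log by blast

section \<open>The Banach algebra of bounded operators\<close>

text \<open>A copy of the type of bounded endomorphisms of \<open>'a\<close>, on which composition is the multiplication of a
  Banach algebra, so that the library function \<^const>\<open>exp\<close> applies.\<close>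

typedef (overloaded) 'a jop = "UNIV :: ('a::jb_algebra \<Rightarrow>\<^sub>L 'a) set"
  by simp

setup_lifting type_definition_jop

instantiation jop :: (jb_algebra) real_normed_vector
begin

lift_definition zero_jop :: "'a jop" is 0 .
lift_definition plus_jop :: "'a jop \<Rightarrow> 'a jop \<Rightarrow> 'a jop" is "(+)" .
lift_definition minus_jop :: "'a jop \<Rightarrow> 'a jop \<Rightarrow> 'a jop" is "(-)" .
lift_definition uminus_jop :: "'a jop \<Rightarrow> 'a jop" is uminus .
lift_definition scaleR_jop :: "real \<Rightarrow> 'a jop \<Rightarrow> 'a jop" is scaleR .
lift_definition norm_jop :: "'a jop \<Rightarrow> real" is norm .

definition dist_jop :: "'a jop \<Rightarrow> 'a jop \<Rightarrow> real"
  where "dist_jop S T = norm (S - T)"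

definition sgn_jop :: "'a jop \<Rightarrow> 'a jop"
  where "sgn_jop S = scaleR (inverse (norm S)) S"

definition uniformity_jop :: "('a jop \<times> 'a jop) filter"
  where "uniformity_jop = (INF e\<in>{0<..}. principal {(S, T). dist S T < e})"

definition open_jop :: "'a jop set \<Rightarrow> bool"
  where "open_jop U \<longleftrightarrow> (\<forall>S\<in>U. \<forall>\<^sub>F (S', T) in uniformity. S' = S \<longrightarrow> T \<in> U)"

instance
proof
  fix S T R :: "'a jop" and c d :: real
  show "S + T + R = S + (T + R)" "S + T = T + S" "0 + S = S" "- S + S = 0" "S - T = S + - T"
    by (transfer; simp)+
  show "c *\<^sub>R (S + T) = c *\<^sub>R S + c *\<^sub>R T" "(c + d) *\<^sub>R S = c *\<^sub>R S + d *\<^sub>R S"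
    "c *\<^sub>R d *\<^sub>R S = (c * d) *\<^sub>R S" "1 *\<^sub>R S = S"
    by (transfer; simp add: scaleR_add_left scaleR_add_right)+
  show "(norm S = 0) = (S = 0)" "norm (c *\<^sub>R S) = \<bar>c\<bar> * norm S"
    by (transfer; simp)+
  show "norm (S + T) \<le> norm S + norm T"
    by transfer (rule norm_triangle_ineq)
qed (simp_all add: dist_jop_def sgn_jop_def uniformity_jop_def open_jop_def)

end

instantiation jop :: (jb_algebra) real_normed_algebra_1
begin

lift_definition one_jop :: "'a jop" is id_blinfun .
lift_definition times_jop :: "'a jop \<Rightarrow> 'a jop \<Rightarrow> 'a jop" is "(o\<^sub>L)" .

instance
proof
  fix S T R :: "'a jop" and c :: real
  show "S * T * R = S * (T * R)" "1 * S = S" "S * 1 = S"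
    by (transfer; rule blinfun_eqI; simp)+
  show "(S + T) * R = S * R + T * R" "S * (T + R) = S * T + S * R"
    by (transfer; rule blinfun_eqI; simp add: blinfun.bilinear_simps)+
  show "c *\<^sub>R S * T = c *\<^sub>R (S * T)" "S * c *\<^sub>R T = c *\<^sub>R (S * T)"
    by (transfer; rule blinfun_eqI; simp add: blinfun.bilinear_simps)+
  show "(0 :: 'a jop) \<noteq> 1"
  proof (transfer, rule notI)
    assume zero: "(0 :: 'a \<Rightarrow>\<^sub>L 'a) = id_blinfun"
    have "(e\<^sub>J :: 'a) = blinfun_apply id_blinfun e\<^sub>J" by simp
    also have "\<dots> = 0" unfolding zero[symmetric] by simp
    finally show False by simp
  qed
  show "norm (S * T) \<le> norm S * norm T"
    by transfer (rule norm_blinfun_compose)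
  show "norm (1 :: 'a jop) = 1"
  proof transfer
    have "norm (blinfun_apply id_blinfun (e\<^sub>J :: 'a)) \<le> norm (id_blinfun :: 'a \<Rightarrow>\<^sub>L 'a) * norm (e\<^sub>J :: 'a)"
      by (rule norm_blinfun)
    moreover have "norm (id_blinfun :: 'a \<Rightarrow>\<^sub>L 'a) \<le> 1"
      by (rule norm_blinfun_bound) auto
    ultimately show "norm (id_blinfun :: 'a \<Rightarrow>\<^sub>L 'a) = 1" by simp
  qed
qed

end

instance jop :: (jb_algebra) banach
proof
  fix X :: "nat \<Rightarrow> 'a jop" assume X: "Cauchy X"
  have dist: "dist S T = dist (Rep_jop S) (Rep_jop T)" for S T :: "'a jop"
    unfolding dist_norm by transfer simp
  have "Cauchy (\<lambda>n. Rep_jop (X n))"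
    using X unfolding Cauchy_def dist .
  then obtain L where L: "(\<lambda>n. Rep_jop (X n)) \<longlonglongrightarrow> L"
    using Cauchy_convergent convergent_def by blast
  have "X \<longlonglongrightarrow> Abs_jop L"
    using L unfolding tendsto_iff dist by (simp add: Abs_jop_inverse)
  then show "convergent X"
    by (auto simp: convergent_def)
qed

lift_definition jop_apply :: "'a::jb_algebra jop \<Rightarrow> 'a \<Rightarrow> 'a" is blinfun_apply .

lemma jop_eqI:
  assumes "\<And>x. jop_apply S x = jop_apply T x"
  shows "S = T"
  using assms by transfer (rule blinfun_eqI)

lemma bounded_bilinear_jop_apply: "bounded_bilinear (jop_apply :: 'a::jb_algebra jop \<Rightarrow> _)"
proof
  fix S T :: "'a jop" and x y :: 'a and c :: real
  show "jop_apply (S + T) x = jop_apply S x + jop_apply T x"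
    "jop_apply S (x + y) = jop_apply S x + jop_apply S y"
    "jop_apply (c *\<^sub>R S) x = c *\<^sub>R jop_apply S x"
    "jop_apply S (c *\<^sub>R x) = c *\<^sub>R jop_apply S x"
    by (transfer; simp add: blinfun.bilinear_simps)+
  have "norm (jop_apply S x) \<le> norm S * norm x" for S :: "'a jop" and x
    by transfer (rule norm_blinfun)
  then show "\<exists>K. \<forall>S x. norm (jop_apply S (x :: 'a)) \<le> norm S * norm x * K"
    by (intro exI[of _ 1]) simp
qed

interpretation jop: bounded_bilinear "jop_apply :: 'a::jb_algebra jop \<Rightarrow> _"
  by (rule bounded_bilinear_jop_apply)

lemma norm_jop_apply: "norm (jop_apply S x) \<le> norm S * norm x"
  by transfer (rule norm_blinfun)

lemma jop_apply_mult [simp]: "jop_apply (S * T) x = jop_apply S (jop_apply T x)"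
  by transfer simp

lemma jop_apply_one [simp]: "jop_apply 1 x = x"
  by transfer simp

lift_definition jmult :: "'a::jb_algebra \<Rightarrow> 'a jop" is "\<lambda>a. Blinfun ((\<circ>\<^sub>J) a)" .

lemma jop_apply_jmult [simp]: "jop_apply (jmult a) x = a \<circ>\<^sub>J x"
  by transfer (simp add: bounded_linear_Blinfun_apply jprod.bounded_linear_right)

lemma bounded_linear_jmult: "bounded_linear (jmult :: 'a::jb_algebra \<Rightarrow> 'a jop)"
proof
  fix a b :: 'a and c :: real
  show "jmult (a + b) = jmult a + jmult b"
    by (rule jop_eqI) (simp add: jop.add_left jprod.add_left)
  show "jmult (c *\<^sub>R a) = c *\<^sub>R jmult a"
    by (rule jop_eqI) (simp add: jop.scaleR_left jprod.scaleR_left)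
  have "norm (jmult a) \<le> norm a" for a :: 'a
    by transfer (rule norm_blinfun_bound,
        simp_all add: bounded_linear_Blinfun_apply jprod.bounded_linear_right jprod_norm_le)
  then show "\<exists>K. \<forall>a. norm (jmult (a :: 'a)) \<le> norm a * K"
    by (intro exI[of _ 1]) simp
qed

lemmas linear_jmult = bounded_linear.linear[OF bounded_linear_jmult]

section \<open>Exponentials of multiplication operators are order automorphisms\<close>

abbreviation jexp_op :: "'a::jb_algebra \<Rightarrow> 'a jop" where
  "jexp_op a \<equiv> exp (jmult a)"

text \<open>Iterated multiplication by \<open>a\<close> produces the powers of \<open>a\<close> from
  the unit, so the two exponential series agree term by term.\<close>

lemma jexp_op_unit [simp]: "jop_apply (jexp_op a) e\<^sub>J = jb_exp a"
proof -
  have pow: "jop_apply (jmult a ^ n) e\<^sub>J = jpow a n" for n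
    by (induction n) simp_all
  have "(\<lambda>n. jmult a ^ n /\<^sub>R fact n) sums jexp_op a"
    unfolding exp_def by (rule summable_sums) (rule summable_exp_generic)
  from bounded_linear.sums[OF jop.bounded_linear_left this, of e\<^sub>J]
  have "(\<lambda>n. (1 / fact n) *\<^sub>R jpow a n) sums jop_apply (jexp_op a) e\<^sub>J"
    by (simp add: jop.scaleR_left pow divide_inverse)
  then show ?thesis
    using jb_exp_sums sums_unique2 by blast
qed

lemma jexp_op_minus [simp]:
  "jop_apply (jexp_op (- a)) (jop_apply (jexp_op a) x) = x"
  "jop_apply (jexp_op a) (jop_apply (jexp_op (- a)) x) = x"
  using exp_minus_inverse[of "jmult (- a)"] exp_minus_inverse[of "jmult a"]
  by (simp_all add: linear_neg[OF linear_jmult] flip: jop_apply_mult)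

lemma jexp_op_eq_iff [simp]: "jop_apply (jexp_op a) x = jop_apply (jexp_op a) y \<longleftrightarrow> x = y"
  by (metis jexp_op_minus(1))

text \<open>The square \<open>(b + (t/2) a)\<^sup>2\<close> is positive and \<open>b\<^sup>2 \<le> b\<close> when \<open>0 \<le> b \<le> e\<close>.\<close>

lemma order_cone_first_order:
  assumes "b \<in> order_cone"
  shows "b + t *\<^sub>R (a \<circ>\<^sub>J b) + (t\<^sup>2 * (norm a)\<^sup>2 * norm b / 4) *\<^sub>R e\<^sub>J \<in> order_cone"
proof -
  have unit: "b + t *\<^sub>R (a \<circ>\<^sub>J b) + (t\<^sup>2 * (norm a)\<^sup>2 / 4) *\<^sub>R e\<^sub>J \<in> order_cone"
    if b: "b \<in> order_cone" "norm b \<le> 1" for b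
  proof -
    have spec: "0 \<le> s \<and> s \<le> 1" if "s \<in> jb_spectrum b" for s
      using jb_cfc_in_order_cone_iff[of b "\<lambda>t. t"] jb_spectrum_abs_le[OF that] b that
      by (auto simp: jb_cfc_id)
    have "b - b \<circ>\<^sub>J b = jb_cfc (\<lambda>s. s - s * s) b"
      by (simp add: jb_cfc_diff jb_cfc_mult jb_cfc_id continuous_intros)
    moreover have "jb_cfc (\<lambda>s. s - s * s) b \<in> order_cone"
      by (subst jb_cfc_in_order_cone_iff)
        (use spec in \<open>auto intro!: continuous_intros simp: mult_left_le\<close>)
    ultimately have 1: "b - b \<circ>\<^sub>J b \<in> order_cone" by simp
    have 2: "(b + (t/2) *\<^sub>R a) \<circ>\<^sub>J (b + (t/2) *\<^sub>R a) \<in> order_cone"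
      by (rule square_in_order_cone)
    have "(norm a)\<^sup>2 *\<^sub>R e\<^sub>J - a \<circ>\<^sub>J a \<in> order_cone"
      by (rule order_cone_one_minus) (simp add: norm_jsquare)
    then have 3: "(t\<^sup>2 / 4) *\<^sub>R ((norm a)\<^sup>2 *\<^sub>R e\<^sub>J - a \<circ>\<^sub>J a) \<in> order_cone"
      by (rule order_cone_scaleR) simp
    have "(b - b \<circ>\<^sub>J b) + ((b + (t/2) *\<^sub>R a) \<circ>\<^sub>J (b + (t/2) *\<^sub>R a))
        + (t\<^sup>2 / 4) *\<^sub>R ((norm a)\<^sup>2 *\<^sub>R e\<^sub>J - a \<circ>\<^sub>J a)
      = b + t *\<^sub>R (a \<circ>\<^sub>J b) + (t\<^sup>2 * (norm a)\<^sup>2 / 4) *\<^sub>R e\<^sub>J"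
      using jprod_commute[of b a] scaleR_add_left[of "t/2" "t/2" "a \<circ>\<^sub>J b"]
      by (simp add: jprod.add_left jprod.add_right jprod.scaleR_left jprod.scaleR_right
          scaleR_diff_right scaleR_add_right power2_eq_square)
    then show ?thesis
      using order_cone_add[OF order_cone_add[OF 1 2] 3] by (simp only:)
  qed
  show ?thesis
  proof (cases "b = 0")
    case False
    define c where "c = (1 / norm b) *\<^sub>R b"
    have "c \<in> order_cone" "norm c \<le> 1"
      using assms False by (auto simp: c_def intro: order_cone_scaleR)
    from order_cone_scaleR[OF unit[OF this], of "norm b"] False show ?thesis
      by (simp add: c_def jprod.scaleR_right scaleR_add_right mult.commute)
  qed simp
qed

text \<open>Half of \<epsilon> pays for the Taylor remainder of the operator exponential, the other
  half for the quadratic term in \<open>order_cone_first_order\<close>. The error is uniform in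
  \<open>b\<close> up to the factor \<open>norm b\<close>, as the iteration of small steps
  requires.\<close>

lemma jexp_op_almost_positive:
  fixes a :: "'a::jb_algebra"
  assumes "0 < \<epsilon>"
  obtains d where "0 < d" and "\<And>h b. 0 < h \<Longrightarrow> h < d \<Longrightarrow> b \<in> order_cone
      \<Longrightarrow> jop_apply (exp (h *\<^sub>R jmult a)) b + (\<epsilon> * h * norm b) *\<^sub>R e\<^sub>J \<in> order_cone"
proof -
  have "((\<lambda>h. exp (h *\<^sub>R jmult a)) has_derivative (\<lambda>h. h *\<^sub>R jmult a)) (at 0)"
    using exp_scaleR_has_vector_derivative_right[of "jmult a" 0 UNIV]
    by (simp add: has_vector_derivative_def)
  then have "\<exists>d>0. \<forall>h. norm (h - 0) < d \<longrightarrow> norm (exp (h *\<^sub>R jmult a) - exp (0 *\<^sub>R jmult a)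
      - (h - 0) *\<^sub>R jmult a) \<le> \<epsilon> / 2 * norm (h - 0)"
    using half_gt_zero[OF assms] unfolding has_derivative_at_alt by blast
  then obtain d1 where d1: "0 < d1"
    "\<And>h. \<bar>h\<bar> < d1 \<Longrightarrow> norm (exp (h *\<^sub>R jmult a) - 1 - h *\<^sub>R jmult a) \<le> \<epsilon> / 2 * \<bar>h\<bar>"
    by auto
  \<comment> \<open>The second bound ensures
    \<open>h\<^sup>2 (norm a)\<^sup>2 / 4 \<le> \<epsilon> h / 2\<close>.\<close>
  define d where "d = min d1 (2 * \<epsilon> / ((norm a)\<^sup>2 + 1))"
  have pos: "0 < (norm a)\<^sup>2 + 1"
    by (simp add: add_nonneg_pos)
  have d: "0 < d"
    using d1(1) assms pos by (simp add: d_def)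
  show thesis
  proof (rule that[OF d])
    fix h :: real and b :: 'a assume h: "0 < h" "h < d" and b: "b \<in> order_cone"
    define R where "R = exp (h *\<^sub>R jmult a) - 1 - h *\<^sub>R jmult a"
    have "norm (jop_apply R b) \<le> norm R * norm b"
      by (rule norm_jop_apply)
    also have "norm R \<le> \<epsilon> / 2 * h"
      unfolding R_def using d1(2)[of h] h by (simp add: d_def)
    finally have "norm (jop_apply R b) \<le> \<epsilon> / 2 * h * norm b"
      by (simp add: mult_right_mono)
    then have 1: "jop_apply R b + (\<epsilon> / 2 * h * norm b) *\<^sub>R e\<^sub>J \<in> order_cone"
      by (rule order_cone_one_plus)
    have 2: "b + h *\<^sub>R (a \<circ>\<^sub>J b) + (h\<^sup>2 * (norm a)\<^sup>2 * norm b / 4) *\<^sub>R e\<^sub>J \<in> order_cone"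
      using b by (rule order_cone_first_order)
    have "h * ((norm a)\<^sup>2 + 1) \<le> 2 * \<epsilon>"
      using h pos by (simp add: d_def pos_less_divide_eq less_imp_le)
    then have "h * (norm a)\<^sup>2 \<le> 2 * \<epsilon>"
      using h(1) by (simp add: distrib_left)
    then have "(h * (norm a)\<^sup>2) * (h * norm b / 4) \<le> (2 * \<epsilon>) * (h * norm b / 4)"
      using h(1) by (intro mult_right_mono) auto
    then have 3: "(\<epsilon> / 2 * h * norm b - h\<^sup>2 * (norm a)\<^sup>2 * norm b / 4) *\<^sub>R e\<^sub>J \<in> (order_cone :: 'a set)"
      by (intro order_cone_unit) (simp add: power2_eq_square algebra_simps)
    have "exp (h *\<^sub>R jmult a) = 1 + h *\<^sub>R jmult a + R"
      by (simp add: R_def)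
    then have "jop_apply (exp (h *\<^sub>R jmult a)) b = b + h *\<^sub>R (a \<circ>\<^sub>J b) + jop_apply R b"
      by (simp add: jop.add_left jop.scaleR_left)
    moreover have "\<epsilon> * h * norm b = \<epsilon> / 2 * h * norm b + h\<^sup>2 * (norm a)\<^sup>2 * norm b / 4
        + (\<epsilon> / 2 * h * norm b - h\<^sup>2 * (norm a)\<^sup>2 * norm b / 4)"
      by simp
    ultimately show "jop_apply (exp (h *\<^sub>R jmult a)) b + (\<epsilon> * h * norm b) *\<^sub>R e\<^sub>J \<in> order_cone"
      using order_cone_add[OF order_cone_add[OF 1 2] 3]
      by (simp only: scaleR_add_left add_ac)
  qed
qed

text \<open>The unit time interval is cut into \<open>N\<close> steps of length \<open>h\<close>.
  Each loses positivity by an arbitrarily small multiple of \<open>h\<close>, so the total loss is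
  at most \<delta> times a constant that does not depend on \<open>N\<close>, and \<delta> is
  arbitrary because the cone is closed.\<close>

lemma jexp_op_order_cone:
  fixes a b :: "'a::jb_algebra"
  assumes b: "b \<in> order_cone"
  shows "jop_apply (jexp_op a) b \<in> order_cone"
proof (rule order_cone_epsilon)
  fix \<delta> :: real assume \<delta>: "0 < \<delta>"
  define c where "c = norm (jmult a)"
  have c: "0 \<le> c" by (simp add: c_def)
  \<comment> \<open>An a priori bound for the norm of \<open>y\<close> at every step. Calling the
    one-step estimate with \<delta>/B makes each fresh loss at most
    \<open>\<delta> * h\<close>.\<close>
  define B where "B = exp c * norm b + \<delta> * exp (c + 1) + 1"
  have B: "0 < B"
    using \<delta> by (simp add: B_def add_nonneg_pos)
  obtain d where d: "0 < d" and almost: "\<And>h b. 0 < h \<Longrightarrow> h < d \<Longrightarrow> b \<in> order_cone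
      \<Longrightarrow> jop_apply (exp (h *\<^sub>R jmult a)) b + (\<delta> / B * h * norm b) *\<^sub>R e\<^sub>J \<in> order_cone"
    using jexp_op_almost_positive[of "\<delta> / B" a] \<delta> B by auto
  obtain n where n: "inverse (real (Suc n)) < d"
    using reals_Archimedean[OF d] by blast
  define N h where "N = Suc n" and "h = inverse (real N)"
  have h: "0 < h" "h < d" "real N * h = 1"
    using n by (auto simp: N_def h_def)
  define T where "T = exp (h *\<^sub>R jmult a)"
  have T_norm: "norm T \<le> exp (c * h)"
    using norm_exp[of "h *\<^sub>R jmult a"] h(1) by (simp add: T_def c_def mult.commute)
  have T_pow: "T ^ k = exp ((real k * h) *\<^sub>R jmult a)" for k
  proof (induction k)
    case (Suc k)
    have "exp (h *\<^sub>R jmult a + (real k * h) *\<^sub>R jmult a) = T * exp ((real k * h) *\<^sub>R jmult a)"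
      unfolding T_def by (rule exp_add_commuting) simp
    then show ?case
      by (simp add: Suc distrib_right scaleR_add_left)
  qed simp
  \<comment> \<open>The accumulated defect is multiplied by at most \<open>exp (c * h)\<close> when
    \<open>T\<close> acts on it, and the fresh loss is absorbed by \<open>1 + h \<le> exp h\<close>;
    this explains the rate \<open>c + 1\<close>. The factor \<delta> at time 0 makes
    \<open>\<delta> \<le> s\<close>, so that the fresh loss is at most \<open>s * h\<close>.\<close>
  have step: "jop_apply (T ^ k) b + (\<delta> * exp ((c + 1) * (real k * h))) *\<^sub>R e\<^sub>J \<in> order_cone"
    if "k \<le> N" for k
    using that
  proof (induction k)
    case 0
    show ?case
      using order_cone_add[OF b order_cone_unit[of \<delta>]] \<delta> by simp
  next
    case (Suc k)
    define s where "s = \<delta> * exp ((c + 1) * (real k * h))"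
    define y where "y = jop_apply (T ^ k) b + s *\<^sub>R e\<^sub>J"
    have s: "0 < s" "\<delta> \<le> s"
      using \<delta> c h by (simp_all add: s_def)
    have kh: "real k * h \<le> 1"
      using mult_right_mono[of "real k" "real N" h] Suc.prems h by simp
    have "norm (jop_apply (T ^ k) b) \<le> norm (T ^ k) * norm b"
      by (rule norm_jop_apply)
    also have "norm (T ^ k) \<le> exp c"
    proof -
      have "norm (T ^ k) \<le> exp (norm ((real k * h) *\<^sub>R jmult a))"
        unfolding T_pow by (rule norm_exp)
      also have "norm ((real k * h) *\<^sub>R jmult a) \<le> c"
        using kh c h by (simp add: c_def[symmetric] abs_mult mult_left_le_one_le)
      finally show ?thesis by simp
    qed
    finally have "norm (jop_apply (T ^ k) b) \<le> exp c * norm b"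
      by (simp add: mult_right_mono)
    moreover have "s \<le> \<delta> * exp (c + 1)"
      using kh c \<delta> by (simp add: s_def mult_left_le)
    ultimately have "norm y \<le> B"
      using norm_triangle_ineq[of "jop_apply (T ^ k) b" "s *\<^sub>R e\<^sub>J"] s(1)
      by (simp add: y_def B_def)
    then have "\<delta> / B * h * norm y \<le> \<delta> / B * h * B"
      using \<delta> B h by (intro mult_left_mono) auto
    then have err: "\<delta> / B * h * norm y \<le> \<delta> * h"
      using B by simp
    have "y \<in> order_cone"
      using Suc by (simp add: y_def s_def)
    then have 1: "jop_apply T y + (\<delta> / B * h * norm y) *\<^sub>R e\<^sub>J \<in> order_cone"
      unfolding T_def by (rule almost[OF h(1,2)])
    have "norm (jop_apply T (s *\<^sub>R e\<^sub>J)) \<le> norm T * norm (s *\<^sub>R (e\<^sub>J :: 'a))"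
      by (rule norm_jop_apply)
    also have "\<dots> \<le> exp (c * h) * s"
      using T_norm s(1) by (simp add: mult_right_mono)
    finally have 2: "(exp (c * h) * s) *\<^sub>R e\<^sub>J - jop_apply T (s *\<^sub>R e\<^sub>J) \<in> order_cone"
      by (rule order_cone_one_minus)
    have "exp (c * h) * s + \<delta> * h \<le> exp (c * h) * s + exp (c * h) * (s * h)"
    proof -
      have "\<delta> * h \<le> 1 * (s * h)"
        using s(2) h(1) by (simp add: mult_right_mono)
      also have "\<dots> \<le> exp (c * h) * (s * h)"
        using c h(1) s(1) by (intro mult_right_mono) auto
      finally show ?thesis by simp
    qed
    also have "\<dots> = exp (c * h) * s * (1 + h)"
      by (simp add: algebra_simps)
    also have "\<dots> \<le> exp (c * h) * s * exp h"
      using s(1) by (intro mult_left_mono) auto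
    also have "\<dots> = \<delta> * exp ((c + 1) * (real (Suc k) * h))"
      by (simp add: s_def algebra_simps flip: exp_add)
    finally have "exp (c * h) * s + \<delta> / B * h * norm y \<le> \<delta> * exp ((c + 1) * (real (Suc k) * h))"
      using err by linarith
    then have 3: "(\<delta> * exp ((c + 1) * (real (Suc k) * h)) - (exp (c * h) * s + \<delta> / B * h * norm y)) *\<^sub>R e\<^sub>J
        \<in> (order_cone :: 'a set)"
      by (intro order_cone_unit) simp
    have "jop_apply T y = jop_apply (T ^ Suc k) b + jop_apply T (s *\<^sub>R e\<^sub>J)"
      by (simp add: y_def jop.add_right)
    then show ?case
      using order_cone_add[OF order_cone_add[OF 1 2] 3] by (simp add: scaleR_diff_left scaleR_add_left)
  qed
  from step[of N] show "jop_apply (jexp_op a) b + \<delta> *\<^sub>R (exp (c + 1) *\<^sub>R e\<^sub>J) \<in> order_cone"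
    by (simp add: T_pow h(3))
qed

lemma jexp_op_order_cone_iff [simp]: "jop_apply (jexp_op a) b \<in> order_cone \<longleftrightarrow> b \<in> order_cone"
  using jexp_op_order_cone[of b a] jexp_op_order_cone[of "jop_apply (jexp_op a) b" "- a"] by auto

lemma jexp_op_pos:
  assumes "b \<in> jb_pos"
  shows "jop_apply (jexp_op a) b \<in> jb_pos"
proof -
  obtain \<epsilon> where \<epsilon>: "0 < \<epsilon>" "b - \<epsilon> *\<^sub>R e\<^sub>J \<in> order_cone"
    using assms by (auto simp: jb_pos_iff)
  then have 1: "jop_apply (jexp_op a) b - \<epsilon> *\<^sub>R jb_exp a \<in> order_cone"
    using jexp_op_order_cone[OF \<epsilon>(2), of a] by (simp add: jop.diff_right jop.scaleR_right)
  define m where "m = exp (- norm a)"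
  have "\<epsilon> *\<^sub>R (jb_exp a - m *\<^sub>R e\<^sub>J) \<in> order_cone"
    unfolding m_def using \<epsilon>(1) by (intro order_cone_scaleR jb_exp_ge) simp
  from order_cone_add[OF 1 this] have "jop_apply (jexp_op a) b - (\<epsilon> * m) *\<^sub>R e\<^sub>J \<in> order_cone"
    by (simp add: scaleR_diff_right)
  moreover have "0 < \<epsilon> * m"
    using \<epsilon>(1) by (simp add: m_def)
  ultimately show ?thesis
    unfolding jb_pos_iff by blast
qed

section \<open>The quadratic representation and inverses\<close>

text \<open>The operator U of Jordan theory. For the symmetrized product of an associative algebra
  it is the map \<open>z \<mapsto> b z b\<close>.\<close>

definition quad_rep :: "'a::jb_algebra \<Rightarrow> 'a jop" where
  "quad_rep b = 2 *\<^sub>R (jmult b * jmult b) - jmult (b \<circ>\<^sub>J b)"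

lemma quad_rep_unit [simp]: "quad_rep e\<^sub>J = 1"
  by (rule jop_eqI) (simp add: quad_rep_def jop.add_left jop.diff_left jop.scaleR_left scaleR_2)

text \<open>The left side is the derivative of \<open>quad_rep\<close> at \<open>b\<close> in the
  direction \<open>y \<circ>\<^sub>J b\<close>. The identity results from subtracting twice
  \<open>jordan_operator_identity\<close> from \<open>jordan_linearized\<close>, both taken with
  \<open>b\<close> repeated.\<close>

lemma quad_rep_linearized:
  "2 *\<^sub>R (jmult (y \<circ>\<^sub>J b) * jmult b + jmult b * jmult (y \<circ>\<^sub>J b)) - 2 *\<^sub>R jmult ((y \<circ>\<^sub>J b) \<circ>\<^sub>J b)
     = jmult y * quad_rep b + quad_rep b * jmult y"
proof (rule jop_eqI)
  fix z
  define A B C D E F G where "A = b \<circ>\<^sub>J (b \<circ>\<^sub>J (y \<circ>\<^sub>J z))" and "B = y \<circ>\<^sub>J (b \<circ>\<^sub>J (b \<circ>\<^sub>J z))"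
    and "C = ((y \<circ>\<^sub>J b) \<circ>\<^sub>J b) \<circ>\<^sub>J z" and "D = (b \<circ>\<^sub>J b) \<circ>\<^sub>J (y \<circ>\<^sub>J z)"
    and "E = (y \<circ>\<^sub>J b) \<circ>\<^sub>J (b \<circ>\<^sub>J z)" and "F = b \<circ>\<^sub>J ((y \<circ>\<^sub>J b) \<circ>\<^sub>J z)"
    and "G = y \<circ>\<^sub>J ((b \<circ>\<^sub>J b) \<circ>\<^sub>J z)"
  note defs = A_def B_def C_def D_def E_def F_def G_def
  have 1: "A + B + C = D + 2 *\<^sub>R E"
    using jordan_operator_identity[of b b y z] by (simp add: defs scaleR_2)
  have 2: "2 *\<^sub>R F + G = 2 *\<^sub>R E + D"
    using jordan_linearized[of b b y z] jprod_commute[of b y] by (simp add: defs scaleR_2)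
  have "2 *\<^sub>R (E + F) - 2 *\<^sub>R C - ((2 *\<^sub>R B - G) + (2 *\<^sub>R A - D))
      = (2 *\<^sub>R F + G) - (2 *\<^sub>R E + D) - 2 *\<^sub>R ((A + B + C) - (D + 2 *\<^sub>R E))"
    by (simp add: scaleR_2 algebra_simps)
  then have "2 *\<^sub>R (E + F) - 2 *\<^sub>R C = (2 *\<^sub>R B - G) + (2 *\<^sub>R A - D)"
    using 1 2 by simp
  then show "jop_apply (2 *\<^sub>R (jmult (y \<circ>\<^sub>J b) * jmult b + jmult b * jmult (y \<circ>\<^sub>J b)) - 2 *\<^sub>R jmult ((y \<circ>\<^sub>J b) \<circ>\<^sub>J b)) z
     = jop_apply (jmult y * quad_rep b + quad_rep b * jmult y) z"
    by (simp add: quad_rep_def jop.add_left jop.diff_left jop.scaleR_left jprod.diff_right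
        jprod.scaleR_right defs)
qed

text \<open>Both sides solve the linear differential equation \<open>G' = L\<^sub>y G + G L\<^sub>y\<close>.\<close>

lemma quad_rep_jexp_op: "quad_rep (jop_apply (jexp_op y) b) = jexp_op y * quad_rep b * jexp_op y"
proof -
  define P where "P s = exp (s *\<^sub>R jmult y)" for s
  define v where "v s = jop_apply (P s) b" for s
  define G where "G s = quad_rep (v s)" for s
  have P: "(P has_vector_derivative jmult y * P s) (at s)"
    and P_minus: "((\<lambda>s. P (- s)) has_vector_derivative - (jmult y * P (- s))) (at s)"
    and P_minus': "((\<lambda>s. P (- s)) has_vector_derivative - (P (- s) * jmult y)) (at s)" for s
    unfolding P_def
    using exp_scaleR_has_vector_derivative_left[of "jmult y" s]
      exp_scaleR_has_vector_derivative_left[of "- jmult y" s]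
      exp_scaleR_has_vector_derivative_right[of "- jmult y" s UNIV] by simp_all
  have v: "(v has_vector_derivative y \<circ>\<^sub>J v s) (at s)" for s
    unfolding v_def
    using bounded_linear.has_vector_derivative[OF jop.bounded_linear_left P, of b] by simp
  have "(G has_vector_derivative
      2 *\<^sub>R (jmult (v s) * jmult (y \<circ>\<^sub>J v s) + jmult (y \<circ>\<^sub>J v s) * jmult (v s))
      - jmult (v s \<circ>\<^sub>J (y \<circ>\<^sub>J v s) + (y \<circ>\<^sub>J v s) \<circ>\<^sub>J v s)) (at s)" for s
    unfolding G_def quad_rep_def
    by (intro has_vector_derivative_diff has_vector_derivative_mult v
        bounded_linear.has_vector_derivative[OF bounded_linear_jmult]
        bounded_linear.has_vector_derivative[OF bounded_linear_scaleR_right]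
        bounded_bilinear.has_vector_derivative[OF jprod_bounded_bilinear])
  moreover have "2 *\<^sub>R (jmult (v s) * jmult (y \<circ>\<^sub>J v s) + jmult (y \<circ>\<^sub>J v s) * jmult (v s))
      - jmult (v s \<circ>\<^sub>J (y \<circ>\<^sub>J v s) + (y \<circ>\<^sub>J v s) \<circ>\<^sub>J v s) = jmult y * G s + G s * jmult y" for s
    using quad_rep_linearized[of y "v s"] jprod_commute[of "v s" "y \<circ>\<^sub>J v s"]
    by (simp add: G_def linear_add[OF linear_jmult] scaleR_2 add.commute)
  ultimately have G: "(G has_vector_derivative jmult y * G s + G s * jmult y) (at s)" for s
    by simp
  \<comment> \<open>The factors \<open>P (- s)\<close> on both sides act as integrating factors for
    the equation satisfied by \<open>G\<close>.\<close>
  have deriv_zero: "((\<lambda>s. P (- s) * G s * P (- s)) has_vector_derivative 0) (at s)" for s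
  proof -
    have cancel: "(p * g) * - (l * p) + (p * (l * g + g * l) + - (p * l) * g) * p = 0"
      for p g l :: "'a jop"
      by (simp only: distrib_left distrib_right mult.assoc mult_minus_left mult_minus_right) simp
    show ?thesis
      using has_vector_derivative_mult[OF has_vector_derivative_mult[OF P_minus' G] P_minus, of s]
      unfolding cancel .
  qed
  obtain c where "P (- s) * G s * P (- s) = c" for s
    by (rule has_vector_derivative_zero_constant[OF convex_UNIV deriv_zero]) blast
  from this[of 1] this[of 0] have "P (- 1) * G 1 * P (- 1) = P 0 * G 0 * P 0"
    by (simp only: minus_zero)
  then have eq: "P (- 1) * G 1 * P (- 1) = quad_rep b"
    by (simp add: P_def G_def v_def)
  have inv: "P 1 * P (- 1) = 1" "P (- 1) * P 1 = 1"
    using exp_minus_inverse[of "jmult y"] exp_minus_inverse[of "- jmult y"] by (simp_all add: P_def)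
  have "G 1 = (P 1 * P (- 1)) * G 1 * (P (- 1) * P 1)"
    by (simp add: inv)
  also have "\<dots> = P 1 * (P (- 1) * G 1 * P (- 1)) * P 1"
    by (simp only: mult.assoc)
  finally show ?thesis
    by (simp add: eq) (simp add: G_def v_def P_def)
qed

text \<open>\<open>quad_rep (jb_exp w)\<close> is injective, being the square of an operator
  exponential, and maps the inverse \<open>jb_exp (- w)\<close> to \<open>jb_exp w\<close>. By
  \<open>quad_rep_jexp_op\<close> it maps the claimed expression to the same element.\<close>

lemma jb_exp_minus_transform:
  assumes "jb_exp w = jop_apply (jexp_op y) (jb_exp x)"
  shows "jb_exp (- w) = jop_apply (jexp_op (- y)) (jb_exp (- x))"
proof -
  have quad: "quad_rep (jb_exp z) = jexp_op z * jexp_op z" for z :: 'a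
    using quad_rep_jexp_op[of z "e\<^sub>J"] by simp
  have cancel: "jop_apply (jexp_op z) (jb_exp (- z)) = e\<^sub>J" for z :: 'a
    by (simp flip: jexp_op_unit)
  have Q: "quad_rep (jb_exp w) = jexp_op y * (jexp_op x * jexp_op x) * jexp_op y"
    unfolding assms quad_rep_jexp_op quad ..
  have "jop_apply (quad_rep (jb_exp w)) (jb_exp (- w))
      = jop_apply (quad_rep (jb_exp w)) (jop_apply (jexp_op (- y)) (jb_exp (- x)))"
    (is "_ = ?r")
  proof -
    have "?r = jb_exp w"
      unfolding Q by (simp add: cancel assms)
    then show ?thesis
      by (simp add: quad cancel)
  qed
  then show ?thesis
    by (simp add: quad)
qed

section \<open>The two metrics in logarithmic coordinates\<close>

lemma jb_exp_inject [simp]: "jb_exp x = jb_exp y \<longleftrightarrow> x = y"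
  by (metis jb_log_exp)

lemma jb_exp_zero [simp]: "jb_exp 0 = e\<^sub>J"
  using jexp_op_unit[of 0, symmetric] by (simp add: linear_0[OF linear_jmult] del: jexp_op_unit)

text \<open>Multiplication by the unit is the identity operator and commutes with everything. In
  logarithmic coordinates rays thus become cosets of the span of the unit.\<close>

lemma jb_exp_add_unit: "jb_exp (x + c *\<^sub>R e\<^sub>J) = exp c *\<^sub>R jb_exp x"
proof -
  have "jmult (x + c *\<^sub>R e\<^sub>J) = jmult x + of_real c"
    by (rule jop_eqI) (simp add: jprod.add_left jprod.scaleR_left jop.add_left jop.scaleR_left of_real_def)
  moreover have "exp (jmult x + of_real c) = exp (jmult x) * exp (of_real c)"
    by (rule exp_add_commuting) (simp add: of_real_def)
  ultimately have "jexp_op (x + c *\<^sub>R e\<^sub>J) = exp c *\<^sub>R jexp_op x"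
    by (simp add: exp_of_real) (simp add: of_real_def)
  then show ?thesis
    by (metis jexp_op_unit jop.scaleR_left)
qed

lemma jb_exp_double: "jop_apply (jexp_op x) (jb_exp x) = jb_exp (2 *\<^sub>R x)"
proof -
  have "exp (jmult x + jmult x) = jexp_op x * jexp_op x"
    by (rule exp_add_commuting) simp
  moreover have "jmult (2 *\<^sub>R x) = jmult x + jmult x"
    by (simp add: linear_add[OF linear_jmult] scaleR_2)
  ultimately show ?thesis
    by (metis jexp_op_unit jop_apply_mult)
qed

text \<open>The cone automorphism \<open>jexp_op v\<close> in logarithmic coordinates. It sends 0 to
  \<open>v\<close> and so replaces a translation, although these maps do not compose additively in
  general.\<close>

definition log_transvection :: "'a::jb_algebra \<Rightarrow> 'a \<Rightarrow> 'a" where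
  "log_transvection v x = jb_log (jop_apply (jexp_op v) (jb_exp x))"

lemma jb_exp_log_transvection [simp]:
  "jb_exp (log_transvection v x) = jop_apply (jexp_op v) (jb_exp x)"
  by (simp add: log_transvection_def jexp_op_pos)

lemma log_transvection_inverse [simp]:
  "log_transvection (- v) (log_transvection v x) = x"
  "log_transvection v (log_transvection (- v) x) = x"
  by (simp_all add: log_transvection_def[of _ "log_transvection _ _"])

lemma log_transvection_at [simp]:
  "log_transvection 0 x = x" "log_transvection v 0 = v"
  "log_transvection v v = 2 *\<^sub>R v" "log_transvection v (- v) = 0"
  by (simp_all add: log_transvection_def jb_exp_double linear_0[OF linear_jmult])
    (metis jb_exp_zero jb_log_exp jexp_op_minus(2) jexp_op_unit)

lemma log_transvection_add_unit:
  "log_transvection v (x + c *\<^sub>R e\<^sub>J) = log_transvection v x + c *\<^sub>R e\<^sub>J"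
  by (subst jb_exp_inject[symmetric]) (simp add: jb_exp_add_unit jop.scaleR_right)

lemma unit_sup_jb_exp_le_iff: "unit_sup (jb_exp w) \<le> exp r \<longleftrightarrow> unit_sup w \<le> r"
proof -
  have "exp r *\<^sub>R e\<^sub>J - jb_exp w = jb_cfc (\<lambda>t. exp r - exp t) w"
    by (simp add: jb_exp_def jb_cfc_diff jb_cfc_const continuous_intros)
  then have "unit_sup (jb_exp w) \<le> exp r \<longleftrightarrow> (\<forall>t\<in>jb_spectrum w. 0 \<le> exp r - exp t)"
    unfolding unit_sup_le_iff by (simp add: jb_cfc_in_order_cone_iff continuous_intros)
  then show ?thesis
    by (simp add: unit_sup_le_iff_spectrum)
qed

lemma unit_sup_jb_exp: "unit_sup (jb_exp w) = exp (unit_sup w)"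
proof -
  have "(unit_sup (jb_exp w) *\<^sub>R e\<^sub>J - jb_exp w) + (jb_exp w - exp (- norm w) *\<^sub>R e\<^sub>J) \<in> order_cone"
    by (intro order_cone_add unit_sup_attained jb_exp_ge)
  then have "(unit_sup (jb_exp w) - exp (- norm w)) *\<^sub>R e\<^sub>J \<in> (order_cone :: 'a set)"
    by (simp add: scaleR_diff_left)
  from order_cone_minus_unit[OF this] have "0 < unit_sup (jb_exp w)"
    by (smt (verit) exp_gt_zero)
  then have "exp (ln (unit_sup (jb_exp w))) = unit_sup (jb_exp w)" by simp
  with unit_sup_jb_exp_le_iff[of w "ln (unit_sup (jb_exp w))"] unit_sup_jb_exp_le_iff[of w "unit_sup w"]
  show ?thesis
    by (smt (verit) exp_le_cancel_iff)
qed

text \<open>The logarithm of \<open>jb_M (jb_exp x) (jb_exp y)\<close>, see \<open>jb_M_exp\<close>: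
  the automorphism belonging to \<open>- y\<close> carries \<open>jb_exp y\<close> to the unit,
  where comparison is measured by \<open>unit_sup\<close>.\<close>

definition log_M :: "'a::jb_algebra \<Rightarrow> 'a \<Rightarrow> real" where
  "log_M x y = unit_sup (log_transvection (- y) x)"

lemma jexp_op_diff_order_cone:
  "jop_apply (jexp_op v) b - jop_apply (jexp_op v) a \<in> order_cone \<longleftrightarrow> b - a \<in> order_cone"
  by (simp flip: jop.diff_right)

lemma exp_log_M_le_iff: "exp (log_M x y) \<le> \<beta> \<longleftrightarrow> \<beta> *\<^sub>R jb_exp y - jb_exp x \<in> order_cone"
proof -
  have "jop_apply (jexp_op (- y)) (jb_exp y) = e\<^sub>J"
    by (metis jexp_op_minus(1) jexp_op_unit)
  then have "\<beta> *\<^sub>R jb_exp y - jb_exp x \<in> order_cone \<longleftrightarrow>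
      \<beta> *\<^sub>R e\<^sub>J - jb_exp (log_transvection (- y) x) \<in> order_cone"
    using jexp_op_diff_order_cone[of "- y" "\<beta> *\<^sub>R jb_exp y" "jb_exp x"] by (simp add: jop.scaleR_right)
  then show ?thesis
    by (simp only: log_M_def unit_sup_jb_exp[symmetric] unit_sup_le_iff)
qed

lemma log_M_le_iff: "log_M x y \<le> r \<longleftrightarrow> exp r *\<^sub>R jb_exp y - jb_exp x \<in> order_cone"
  using exp_log_M_le_iff[of x y "exp r"] by simp

lemma jb_M_exp: "jb_M (jb_exp x) (jb_exp y) = exp (log_M x y)"
proof -
  have "{\<beta>. \<beta> > 0 \<and> jb_exp x \<le>\<^sub>J \<beta> *\<^sub>R jb_exp y} = {exp (log_M x y)..}"
    unfolding jb_le_def order_cone_eq_jb_cone[symmetric] exp_log_M_le_iff[symmetric]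
    by (auto intro: less_le_trans[OF exp_gt_zero])
  then show ?thesis
    by (simp add: jb_M_def)
qed

lemma thompson_dist_exp: "thompson_dist (jb_exp x) (jb_exp y) = max (log_M x y) (log_M y x)"
  by (simp add: thompson_dist_def jb_M_exp max_def)

lemma log_M_triangle: "log_M x z \<le> log_M x y + log_M y z"
proof -
  have "exp (log_M x y) *\<^sub>R (exp (log_M y z) *\<^sub>R jb_exp z - jb_exp y) \<in> order_cone"
    using log_M_le_iff[of y z "log_M y z"] by (intro order_cone_scaleR) auto
  moreover have "exp (log_M x y) *\<^sub>R jb_exp y - jb_exp x \<in> order_cone"
    using log_M_le_iff[of x y "log_M x y"] by simp
  ultimately have "exp (log_M x y) *\<^sub>R (exp (log_M y z) *\<^sub>R jb_exp z - jb_exp y)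
      + (exp (log_M x y) *\<^sub>R jb_exp y - jb_exp x) \<in> order_cone"
    by (rule order_cone_add)
  then show ?thesis
    by (simp add: log_M_le_iff exp_add scaleR_diff_right)
qed

lemma log_M_self [simp]: "log_M x x = 0"
  using log_transvection_at(4)[of "- x"] by (simp add: log_M_def)

lemma log_M_zero_right [simp]: "log_M x 0 = unit_sup x"
  by (simp add: log_M_def)

lemma log_M_antisym:
  assumes "log_M x y \<le> 0" "log_M y x \<le> 0"
  shows "x = y"
proof -
  have "jb_exp y - jb_exp x \<in> order_cone" "- (jb_exp y - jb_exp x) \<in> order_cone"
    using assms by (simp_all add: log_M_le_iff)
  then have "jb_exp y - jb_exp x = 0"
    by (rule order_cone_antisym)
  then show ?thesis by simp
qed

lemma log_M_sum_nonneg: "0 \<le> log_M x y + log_M y x"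
  using log_M_triangle[of x x y] by simp

lemma log_M_add_unit_left [simp]: "log_M (x + c *\<^sub>R e\<^sub>J) y = log_M x y + c"
  by (simp add: log_M_def log_transvection_add_unit)

lemma log_M_add_unit_right [simp]: "log_M x (y + c *\<^sub>R e\<^sub>J) = log_M x y - c"
proof -
  have "log_M x (y + c *\<^sub>R e\<^sub>J) \<le> r \<longleftrightarrow> log_M x y \<le> c + r" for r
    unfolding log_M_le_iff by (simp add: jb_exp_add_unit exp_add mult.commute)
  from this[of "log_M x (y + c *\<^sub>R e\<^sub>J)"] this[of "log_M x y - c"] show ?thesis
    by simp
qed

lemma log_M_log_transvection [simp]:
  "log_M (log_transvection v x) (log_transvection v y) = log_M x y"
proof -
  have "log_M (log_transvection v x) (log_transvection v y) \<le> r \<longleftrightarrow> log_M x y \<le> r" for r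
    unfolding log_M_le_iff
    using jexp_op_diff_order_cone[of v "exp r *\<^sub>R jb_exp y" "jb_exp x"] by (simp add: jop.scaleR_right)
  then show ?thesis
    by (metis order_antisym order_refl)
qed

text \<open>Inversion \<open>exp x \<mapsto> exp (- x)\<close> reverses the order: moving \<open>y\<close> to the origin by a transvection
  reduces this to the case \<open>y = 0\<close>, by \<open>jb_exp_minus_transform\<close>.\<close>

lemma log_M_minus [simp]: "log_M (- y) (- x) = log_M x y"
proof -
  have le: "log_M (- y) (- x) \<le> log_M x y" for x y :: 'a
  proof -
    define w where "w = log_transvection (- y) x"
    have "jb_exp w = jop_apply (jexp_op (- y)) (jb_exp x)"
      by (simp add: w_def)
    from jb_exp_minus_transform[OF this]
    have "jb_exp (- w) = jb_exp (log_transvection y (- x))" by simp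
    then have "log_transvection y (- x) = - w" by (metis jb_exp_inject)
    then have "log_M (- y) (- x) = log_M 0 (- w)"
      using log_M_log_transvection[of y "- y" "- x"] by simp
    also have "\<dots> = log_M w 0"
      by (simp add: log_M_def)
    finally show ?thesis
      by (simp add: w_def log_M_def)
  qed
  show ?thesis
    using le[of y x] le[of "- x" "- y"] by simp
qed

text \<open>Moving \<open>- w\<close> to the origin moves \<open>w\<close> to
  \<open>2 *\<^sub>R w\<close>, as exponentials of one element multiply. This is the source of the
  factor 2 for reflections.\<close>

lemma log_M_opposite: "log_M w (- w) = 2 * log_M w 0"
  by (simp add: log_M_def unit_sup_scaleR)

text \<open>The curve \<open>W\<close> has derivative \<open>x - y\<close> at 0, and its
  \<open>unit_sup\<close> is the exponential of \<open>log_M\<close>. Since \<open>unit_sup\<close>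
  is Lipschitz, and homogeneous for positive factors, it passes through the one-sided difference
  quotient; the chain rule for \<open>ln\<close> at 1 does the rest.\<close>

lemma log_M_scaled_limit:
  "((\<lambda>t. log_M (t *\<^sub>R x) (t *\<^sub>R y) / t) \<longlongrightarrow> unit_sup (x - y)) (at_right 0)"
proof -
  define W where "W t = jop_apply (exp (t *\<^sub>R jmult (- y)) * exp (t *\<^sub>R jmult x)) e\<^sub>J" for t
  define F where "F t = unit_sup (W t)" for t
  have W: "W t = jb_exp (log_transvection (- (t *\<^sub>R y)) (t *\<^sub>R x))" for t
    by (simp add: W_def linear_scale[OF linear_jmult, symmetric])
  then have F: "F t = exp (log_M (t *\<^sub>R x) (t *\<^sub>R y))" for t
    by (simp only: F_def log_M_def unit_sup_jb_exp)
  have W0: "W 0 = e\<^sub>J" and F0: "F 0 = 1"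
    by (simp_all add: W F)
  have "((\<lambda>t. exp (t *\<^sub>R jmult (- y)) * exp (t *\<^sub>R jmult x)) has_vector_derivative
      exp (0 *\<^sub>R jmult (- y)) * (exp (0 *\<^sub>R jmult x) * jmult x)
      + (exp (0 *\<^sub>R jmult (- y)) * jmult (- y)) * exp (0 *\<^sub>R jmult x)) (at 0 within {0<..})"
    by (intro has_vector_derivative_mult exp_scaleR_has_vector_derivative_right)
  from bounded_linear.has_vector_derivative[OF jop.bounded_linear_left this, of e\<^sub>J]
  have "(W has_vector_derivative (x - y)) (at 0 within {0<..})"
    by (simp add: W_def[abs_def] jop.add_left)
  then have "((\<lambda>t. (1 / norm (t - 0)) *\<^sub>R (W t - (W 0 + (t - 0) *\<^sub>R (x - y)))) \<longlongrightarrow> 0) (at_right 0)"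
    by (simp only: has_vector_derivative_def has_derivative_within)
  moreover have "\<forall>\<^sub>F t in at_right 0. (1 / norm (t - 0)) *\<^sub>R (W t - (W 0 + (t - 0) *\<^sub>R (x - y)))
      = (1 / t) *\<^sub>R (W t - e\<^sub>J) - (x - y)"
    using eventually_at_right_less[of 0]
    by eventually_elim (simp add: W0 scaleR_diff_right scaleR_add_right)
  ultimately have "((\<lambda>t. (1 / t) *\<^sub>R (W t - e\<^sub>J) - (x - y)) \<longlongrightarrow> 0) (at_right 0)"
    by (rule Lim_transform_eventually)
  then have lim: "((\<lambda>t. (1 / t) *\<^sub>R (W t - e\<^sub>J)) \<longlongrightarrow> x - y) (at_right 0)"
    by (rule LIM_zero_cancel)
  have "((\<lambda>t. unit_sup ((1 / t) *\<^sub>R (W t - e\<^sub>J))) \<longlongrightarrow> unit_sup (x - y)) (at_right 0)"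
  proof (rule metric_tendsto_imp_tendsto[OF lim])
    show "\<forall>\<^sub>F t in at_right 0. dist (unit_sup ((1 / t) *\<^sub>R (W t - e\<^sub>J))) (unit_sup (x - y))
        \<le> dist ((1 / t) *\<^sub>R (W t - e\<^sub>J)) (x - y)"
      by (rule always_eventually) (simp add: dist_norm unit_sup_diff_le)
  qed
  moreover have "\<forall>\<^sub>F t in at_right 0. unit_sup ((1 / t) *\<^sub>R (W t - e\<^sub>J)) = (F t - F 0) / (t - 0)"
    using eventually_at_right_less[of 0]
  proof eventually_elim
    case (elim t)
    have "unit_sup (W t - e\<^sub>J) = F t - 1"
      using unit_sup_add_unit[of "W t" "- 1"] by (simp add: F_def)
    then show ?case
      using elim by (simp add: unit_sup_scaleR F0)
  qed
  ultimately have "((\<lambda>t. (F t - F 0) / (t - 0)) \<longlongrightarrow> unit_sup (x - y)) (at_right 0)"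
    by (rule Lim_transform_eventually)
  then have "(F has_field_derivative unit_sup (x - y)) (at 0 within {0<..})"
    by (simp add: has_field_derivative_iff)
  from DERIV_chain[OF _ this, of ln 1]
  have "(ln \<circ> F has_field_derivative unit_sup (x - y)) (at 0 within {0<..})"
    using DERIV_ln_divide[of 1] by (simp add: F0)
  then show ?thesis
    by (simp add: has_field_derivative_iff F0) (simp add: F)
qed

lemma log_M_dyadic_limit:
  "(\<lambda>n. 2 ^ n * log_M ((1 / 2 ^ n) *\<^sub>R x) ((1 / 2 ^ n) *\<^sub>R y)) \<longlonglongrightarrow> unit_sup (x - y)"
proof -
  have "filterlim (\<lambda>n. (1 / 2) ^ n :: real) (at_right 0) sequentially"
    unfolding filterlim_at by (auto intro!: LIMSEQ_realpow_zero)
  from filterlim_compose[OF log_M_scaled_limit this] show ?thesis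
    by (simp add: power_one_over mult.commute)
qed

section \<open>Geodesic reflections\<close>

definition log_reflection :: "'a::jb_algebra \<Rightarrow> 'a \<Rightarrow> 'a" where
  "log_reflection v x = log_transvection v (- log_transvection (- v) x)"

lemma log_reflection_involution [simp]: "log_reflection v (log_reflection v x) = x"
  by (simp add: log_reflection_def)

lemma log_reflection_center [simp]: "log_reflection v v = v"
  using log_transvection_at(4)[of "- v"] by (simp add: log_reflection_def)

lemma log_reflection_zero [simp]: "log_reflection v 0 = 2 *\<^sub>R v"
  by (simp add: log_reflection_def)

lemma log_reflection_add_unit:
  "log_reflection v (x + c *\<^sub>R e\<^sub>J) = log_reflection v x + (- c) *\<^sub>R e\<^sub>J"
  using log_transvection_add_unit[of v "- log_transvection (- v) x" "- c"]
  by (simp add: log_reflection_def log_transvection_add_unit)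

text \<open>The sign change inside the reflection exchanges the arguments, so \<open>log_M\<close>
  itself is not preserved; its two symmetrizations are.\<close>

lemma log_M_reflection [simp]: "log_M (log_reflection v x) (log_reflection v y) = log_M y x"
  using log_M_log_transvection[of "- v" y x] by (simp add: log_reflection_def del: log_M_log_transvection) simp

text \<open>A transvection moves \<open>v\<close> to the origin, where the reflection is the change
  of sign and \<open>log_M_opposite\<close> applies.\<close>

lemma log_M_reflection_self:
  "log_M x (log_reflection v x) = 2 * log_M x v"
  "log_M (log_reflection v x) x = 2 * log_M v x"
proof -
  define u where "u = log_transvection (- v) x"
  have x: "x = log_transvection v u" and r: "log_reflection v x = log_transvection v (- u)"
    by (simp_all add: u_def log_reflection_def)
  have "log_M x v = log_M u 0" "log_M v x = log_M 0 u"
    using log_M_log_transvection[of v u 0] log_M_log_transvection[of v 0 u] by (simp_all add: x)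
  moreover have "log_M 0 u = log_M (- u) 0"
    using log_M_minus[of u 0] by simp
  moreover have "log_M x (log_reflection v x) = 2 * log_M u 0"
    unfolding r unfolding x by (simp add: log_M_opposite)
  moreover have "log_M (log_reflection v x) x = 2 * log_M (- u) 0"
    unfolding r unfolding x using log_M_opposite[of "- u"] by simp
  ultimately show "log_M x (log_reflection v x) = 2 * log_M x v"
    "log_M (log_reflection v x) x = 2 * log_M v x"
    by simp_all
qed

section \<open>Isometries and midpoints\<close>

text \<open>The expansion property at the center also makes it the only fixed point. Three cases
  share this notion: both metrics in logarithmic coordinates, and norms with
  \<open>p + q - u\<close> as the reflection.\<close>

definition point_reflection :: "('x \<Rightarrow> 'x \<Rightarrow> real) \<Rightarrow> ('x \<Rightarrow> 'x) \<Rightarrow> 'x \<Rightarrow> bool" where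
  "point_reflection d \<tau> z \<longleftrightarrow> (\<forall>u. \<tau> (\<tau> u) = u) \<and> (\<forall>u v. d (\<tau> u) (\<tau> v) = d u v) \<and> \<tau> z = z \<and>
     (\<forall>u. 2 * d u z \<le> d (\<tau> u) u)"

lemma point_reflectionD:
  assumes "point_reflection d \<tau> z"
  shows "\<tau> (\<tau> u) = u" "d (\<tau> u) (\<tau> v) = d u v" "\<tau> z = z" "2 * d u z \<le> d (\<tau> u) u"
  using assms by (auto simp: point_reflection_def)

text \<open>Vaisala's argument: the commutator \<open>\<tau> g\<^sup>-\<^sup>1 \<tau> g\<close> again fixes \<open>p\<close> and \<open>\<tau> p\<close>, and it moves
  \<open>z\<close> at least twice as far as \<open>g\<close> does, whereas such maps move \<open>z\<close> by at most \<open>2 d(p, z)\<close>.\<close>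

lemma isometry_fixes_center:
  fixes d :: "'x \<Rightarrow> 'x \<Rightarrow> real"
  assumes d: "Metric_space UNIV d" and \<tau>: "point_reflection d \<tau> z"
    and g: "bij g" "\<And>u v. d (g u) (g v) = d u v" "g p = p" "g (\<tau> p) = \<tau> p"
  shows "g z = z"
proof -
  interpret Metric_space UNIV d by (rule d)
  note \<tau> = point_reflectionD[OF \<tau>]
  \<comment> \<open>The induction must range over all such \<open>g\<close>, since its hypothesis is
    applied to the commutator. As the right side stays fixed while the power of 2 grows, the
    displacement is zero.\<close>
  have bound: "2 ^ n * d (g z) z \<le> 2 * d p z"
    if "bij g" "\<And>u v. d (g u) (g v) = d u v" "g p = p" "g (\<tau> p) = \<tau> p" for n g
    using that
  proof (induction n arbitrary: g)
    case 0
    show ?case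
      using triangle[of "g z" p z] 0(2)[of z p] 0(3) commute[of z p] by simp
  next
    case (Suc n)
    define h where "h = (\<lambda>u. \<tau> (inv g (\<tau> (g u))))"
    have inv: "inv g (g u) = u" "g (inv g u) = u" for u
      using Suc.prems(1) by (simp_all add: bij_is_inj bij_is_surj surj_f_inv_f)
    have inv_iso: "d (inv g u) (inv g v) = d u v" for u v
      using Suc.prems(2)[of "inv g u" "inv g v"] by (simp add: inv)
    have "bij h"
    proof (rule o_bij)
      show "(\<lambda>u. inv g (\<tau> (g (\<tau> u)))) \<circ> h = id" "h \<circ> (\<lambda>u. inv g (\<tau> (g (\<tau> u)))) = id"
        by (simp_all add: h_def fun_eq_iff inv \<tau>(1))
    qed
    moreover have "d (h u) (h v) = d u v" for u v
      by (simp add: h_def \<tau>(2) inv_iso Suc.prems(2))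
    moreover have "h p = p" "h (\<tau> p) = \<tau> p"
      using Suc.prems(3,4) inv(1)[of p] inv(1)[of "\<tau> p"] by (simp_all add: h_def \<tau>(1))
    ultimately have "2 ^ n * d (h z) z \<le> 2 * d p z"
      by (rule Suc.IH)
    moreover have "d (h z) z = d (\<tau> (g z)) (g z)"
      using \<tau>(2)[of "inv g (\<tau> (g z))" z] inv_iso[of "\<tau> (g z)" "g z"] by (simp add: h_def \<tau>(3) inv)
    ultimately have "2 ^ n * d (\<tau> (g z)) (g z) \<le> 2 * d p z" by simp
    moreover have "2 ^ Suc n * d (g z) z \<le> 2 ^ n * d (\<tau> (g z)) (g z)"
      using mult_left_mono[OF \<tau>(4)[of "g z"], of "2 ^ n"] by (simp add: mult_ac)
    ultimately show ?case by (rule order_trans[rotated])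
  qed
  have "d (g z) z \<le> 0"
  proof (rule ccontr)
    assume "\<not> d (g z) z \<le> 0"
    then have pos: "0 < d (g z) z" by (rule not_le_imp_less)
    obtain n where "2 * d p z / d (g z) z < 2 ^ n"
      using real_arch_pow[of 2] by auto
    then show False
      using bound[OF g, of n] pos by (simp add: divide_less_eq)
  qed
  then show ?thesis
    using nonneg[of "g z" z] zero[of "g z" z] by simp
qed

text \<open>The composite of \<open>f\<close>, \<tau>', the inverse of \<open>f\<close> and \<tau>
  fixes \<open>p\<close> and \<open>\<tau> p\<close>, hence \<open>z\<close>. Therefore
  \<open>f z\<close> is a fixed point of \<tau>', which by the expansion property can only be
  \<open>z'\<close>.\<close>

lemma isometry_center:
  fixes d :: "'x \<Rightarrow> 'x \<Rightarrow> real" and d' :: "'y \<Rightarrow> 'y \<Rightarrow> real"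
  assumes d: "Metric_space UNIV d" "Metric_space UNIV d'"
    and \<tau>: "point_reflection d \<tau> z" and \<tau>': "point_reflection d' \<tau>' z'"
    and f: "bij f" "\<And>u v. d' (f u) (f v) = d u v" and p: "\<tau>' (f p) = f (\<tau> p)"
  shows "f z = z'"
proof -
  interpret d': Metric_space UNIV d' by (rule d)
  note r = point_reflectionD[OF \<tau>] and r' = point_reflectionD[OF \<tau>']
  have inv: "inv f (f u) = u" "f (inv f v) = v" for u v
    using f(1) by (simp_all add: bij_is_inj bij_is_surj surj_f_inv_f)
  have inv_iso: "d (inv f u) (inv f v) = d' u v" for u v
    using f(2)[of "inv f u" "inv f v"] by (simp add: inv)
  define g where "g = (\<lambda>u. \<tau> (inv f (\<tau>' (f u))))"
  have "f (\<tau> p) = \<tau>' (f p)" "\<tau>' (f (\<tau> p)) = f p"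
    using p r'(1)[of "f p"] by simp_all
  moreover have "bij g"
  proof (rule o_bij)
    show "(\<lambda>u. inv f (\<tau>' (f (\<tau> u)))) \<circ> g = id" "g \<circ> (\<lambda>u. inv f (\<tau>' (f (\<tau> u)))) = id"
      by (simp_all add: g_def fun_eq_iff inv r(1) r'(1))
  qed
  moreover have "d (g u) (g v) = d u v" for u v
    by (simp add: g_def r(2) r'(2) inv_iso f(2))
  ultimately have "g z = z"
    using inv(1)[of p] inv(1)[of "\<tau> p"]
    by (intro isometry_fixes_center[OF d(1) \<tau>, of g p]) (simp_all add: g_def r(1) p)
  then have "\<tau>' (f z) = f z"
    by (metis g_def inv(2) r(1,3))
  then have "d' (f z) z' \<le> 0"
    using r'(4)[of "f z"] by simp
  then show ?thesis
    using d'.nonneg[of "f z" z'] d'.zero[of "f z" z'] by simp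
qed

text \<open>Norms are plain functions here because \<open>var_norm\<close> does not belong to a type
  class, yet both norms are to share the same argument.\<close>

locale real_norm =
  fixes N :: "'v::real_vector \<Rightarrow> real"
  assumes N_triangle: "N (x + y) \<le> N x + N y"
    and N_scaleR: "N (c *\<^sub>R x) = \<bar>c\<bar> * N x"
    and N_eq_0: "N x = 0 \<Longrightarrow> x = 0"
begin

lemma N_zero [simp]: "N 0 = 0"
  using N_scaleR[of 0 0] by simp

lemma N_minus: "N (- x) = N x"
  using N_scaleR[of "- 1" x] by simp

lemma N_nonneg: "0 \<le> N x"
  using N_triangle[of x "- x"] by (simp add: N_minus)

lemma Metric_space_N: "Metric_space UNIV (\<lambda>x y. N (x - y))"
proof
  fix x y z :: 'v
  show "0 \<le> N (x - y)" by (rule N_nonneg)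
  show "N (x - y) = N (y - x)" using N_minus[of "x - y"] by simp
  show "N (x - y) = 0 \<longleftrightarrow> x = y" using N_eq_0[of "x - y"] by auto
  show "N (x - z) \<le> N (x - y) + N (y - z)" using N_triangle[of "x - y" "y - z"] by simp
qed

lemma point_reflection_N:
  "point_reflection (\<lambda>x y. N (x - y)) (\<lambda>u. p + q - u) ((1/2) *\<^sub>R (p + q))"
proof -
  have half: "(1/2) *\<^sub>R (p + q) + (1/2) *\<^sub>R (p + q) = p + q"
    by (simp flip: scaleR_add_left)
  have "2 * N (u - (1/2) *\<^sub>R (p + q)) \<le> N (p + q - u - u)" for u
  proof -
    have "p + q - u - u = (- 2) *\<^sub>R (u - (1/2) *\<^sub>R (p + q))"
      using half by (simp add: scaleR_diff_right algebra_simps scaleR_2)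
    then show ?thesis
      using N_scaleR[of "- 2" "u - (1/2) *\<^sub>R (p + q)"] by simp
  qed
  moreover have "p + q - (1/2) *\<^sub>R (p + q) = (1/2) *\<^sub>R (p + q)"
    using half by (metis add_diff_cancel_right')
  moreover have "N (p + q - u - (p + q - v)) = N (u - v)" for u v
    using N_minus[of "u - v"] by simp
  ultimately show ?thesis
    by (simp add: point_reflection_def)
qed

end

lemma isometry_linear_Mazur_Ulam:
  fixes N :: "'v::real_vector \<Rightarrow> real" and N' :: "'w::real_vector \<Rightarrow> real"
  assumes "real_norm N" "real_norm N'"
    and S: "bij S" "\<And>x y. N' (S x - S y) = N (x - y)" "S 0 = 0"
  shows "linear S"
proof -
  interpret N: real_norm N by (rule assms)
  interpret N': real_norm N' by (rule assms)
  have mid: "S ((1/2) *\<^sub>R (p + q)) = (1/2) *\<^sub>R (S p + S q)" for p q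
    by (rule isometry_center[OF N.Metric_space_N N'.Metric_space_N N.point_reflection_N
          N'.point_reflection_N S(1,2), where p = p]) simp
  have double: "S (2 *\<^sub>R p) = 2 *\<^sub>R S p" for p
    using mid[of "2 *\<^sub>R p" 0] S(3) by simp
  have add: "S (p + q) = S p + S q" for p q
    using mid[of "2 *\<^sub>R p" "2 *\<^sub>R q"] by (simp add: double flip: scaleR_add_right)
  have minus: "S (- p) = - S p" for p
    using add[of p "- p"] S(3) by (simp add: eq_neg_iff_add_eq_0 add.commute)
  have of_nat: "S (real k *\<^sub>R p) = real k *\<^sub>R S p" for k p
    by (induction k) (simp_all add: S(3) scaleR_add_left add)
  have of_int: "S (real_of_int k *\<^sub>R p) = real_of_int k *\<^sub>R S p" for k p
    by (cases k rule: int_cases2) (simp_all add: of_nat minus)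
  have N_S: "N' (S x) = N x" for x
    using S(2)[of x 0] S(3) by simp
  have scale: "S (c *\<^sub>R x) = c *\<^sub>R S x" for c x
  proof -
    define y where "y = S (c *\<^sub>R x) - c *\<^sub>R S x"
    \<comment> \<open>Real homogeneity without any topology on the vector spaces: additivity cancels
      the integer part of \<open>n * c\<close>, so n times the defect \<open>y\<close> equals the
      defect at the fractional part, which is bounded independently of n.\<close>
    have "real n * N' y \<le> 2 * N x" for n
    proof -
      define k where "k = \<lfloor>real n * c\<rfloor>"
      define r where "r = real n * c - real_of_int k"
      have r: "\<bar>r\<bar> \<le> 1"
        unfolding r_def k_def by linarith
      have nc: "real n * c = r + real_of_int k"
        by (simp add: r_def)
      have "real n *\<^sub>R y = S ((real n * c) *\<^sub>R x) - (real n * c) *\<^sub>R S x"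
        using of_nat[of n "c *\<^sub>R x"] by (simp add: y_def scaleR_diff_right)
      also have "\<dots> = S (r *\<^sub>R x) - r *\<^sub>R S x"
        unfolding nc by (simp add: scaleR_add_left add of_int)
      finally have "real n * N' y = N' (S (r *\<^sub>R x) + (- r) *\<^sub>R S x)"
        using N'.N_scaleR[of "real n" y] by simp
      also have "\<dots> \<le> N' (S (r *\<^sub>R x)) + N' ((- r) *\<^sub>R S x)"
        by (rule N'.N_triangle)
      also have "\<dots> = 2 * (\<bar>r\<bar> * N x)"
        by (simp only: N_S N.N_scaleR N'.N_scaleR) simp
      also have "\<dots> \<le> 2 * N x"
        using r N.N_nonneg[of x] by (simp add: mult_left_le_one_le)
      finally show ?thesis .
    qed
    then have "N' y = 0"
      using N'.N_nonneg[of y] reals_Archimedean3[of "N' y" ] by (metis less_le not_less)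
    then have "y = 0" by (rule N'.N_eq_0)
    then show ?thesis by (simp add: y_def)
  qed
  show ?thesis
    by (rule linearI) (simp_all add: add scale)
qed

text \<open>Reflections in the points \<open>x / 2\<close> show that an isometry fixing the origin commutes with halving; the
  norm is then recovered from the metric near the origin.\<close>

locale tangent_norm = real_norm N for N :: "'v::real_vector \<Rightarrow> real" +
  fixes D :: "'v \<Rightarrow> 'v \<Rightarrow> real"
  assumes D: "Metric_space UNIV D"
    and reflection: "\<exists>\<tau>. point_reflection D \<tau> ((1/2) *\<^sub>R x) \<and> \<tau> 0 = x"
    and dyadic_limit: "(\<lambda>n. 2 ^ n * D ((1 / 2 ^ n) *\<^sub>R x) ((1 / 2 ^ n) *\<^sub>R y)) \<longlonglongrightarrow> N (x - y)"

lemma tangent_norm_isometry: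
  fixes N :: "'v::real_vector \<Rightarrow> real" and N' :: "'w::real_vector \<Rightarrow> real"
  assumes "tangent_norm N D" "tangent_norm N' D'"
    and S: "bij S" "\<And>x y. D' (S x) (S y) = D x y" "S 0 = 0"
  shows "linear S" "N' (S x - S y) = N (x - y)"
proof -
  interpret A: tangent_norm N D by (rule assms)
  interpret B: tangent_norm N' D' by (rule assms)
  have half: "S ((1/2) *\<^sub>R x) = (1/2) *\<^sub>R S x" for x
  proof -
    obtain \<tau> where \<tau>: "point_reflection D \<tau> ((1/2) *\<^sub>R x)" "\<tau> 0 = x"
      using A.reflection by blast
    obtain \<tau>' where \<tau>': "point_reflection D' \<tau>' ((1/2) *\<^sub>R S x)" "\<tau>' 0 = S x"
      using B.reflection by blast
    show ?thesis
      by (rule isometry_center[OF A.D B.D \<tau>(1) \<tau>'(1) S(1,2), of 0]) (simp add: S(3) \<tau>(2) \<tau>'(2))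
  qed
  have pow: "S ((1 / 2 ^ n) *\<^sub>R x) = (1 / 2 ^ n) *\<^sub>R S x" for n x
  proof (induction n)
    case (Suc n)
    then show ?case
      using half[of "(1 / 2 ^ n) *\<^sub>R x"] by simp
  qed simp
  have iso: "N' (S x - S y) = N (x - y)" for x y
  proof (rule LIMSEQ_unique)
    show "(\<lambda>n. 2 ^ n * D ((1 / 2 ^ n) *\<^sub>R x) ((1 / 2 ^ n) *\<^sub>R y)) \<longlonglongrightarrow> N' (S x - S y)"
      using B.dyadic_limit[of "S x" "S y"] by (simp only: pow[symmetric] S(2))
  qed (rule A.dyadic_limit)
  then show "N' (S x - S y) = N (x - y)" .
  show "linear S"
    by (rule isometry_linear_Mazur_Ulam[OF A.real_norm_axioms B.real_norm_axioms S(1) iso S(3)])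
qed

section \<open>Thompson's metric\<close>

lemma tangent_norm_thompson:
  "tangent_norm norm (\<lambda>x y :: 'a::jb_algebra. max (log_M x y) (log_M y x))"
proof (intro tangent_norm.intro real_norm.intro tangent_norm_axioms.intro)
  fix x y z :: 'a and c :: real
  show "norm (x + y) \<le> norm x + norm y" by (rule norm_triangle_ineq)
  show "norm (c *\<^sub>R x) = \<bar>c\<bar> * norm x" by simp
  show "norm x = 0 \<Longrightarrow> x = 0" by simp
  show "Metric_space UNIV (\<lambda>x y :: 'a. max (log_M x y) (log_M y x))"
  proof
    fix x y z :: 'a
    show "0 \<le> max (log_M x y) (log_M y x)"
      using log_M_sum_nonneg[of x y] by (simp add: max_def)
    show "max (log_M x y) (log_M y x) = max (log_M y x) (log_M x y)"
      by (rule max.commute)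
    show "max (log_M x y) (log_M y x) = 0 \<longleftrightarrow> x = y"
      using log_M_antisym[of x y] by (auto simp: max_def split: if_splits)
    show "max (log_M x z) (log_M z x) \<le> max (log_M x y) (log_M y x) + max (log_M y z) (log_M z y)"
      using log_M_triangle[of x z y] log_M_triangle[of z x y] by linarith
  qed
  \<comment> \<open>The maximum is symmetric, so the exchange of arguments in
    \<open>log_M_reflection\<close> is invisible to it.\<close>
  have "point_reflection (\<lambda>x y. max (log_M x y) (log_M y x)) (log_reflection ((1/2) *\<^sub>R x)) ((1/2) *\<^sub>R x)"
    by (simp add: point_reflection_def log_M_reflection_self max.commute) (simp add: max_def)
  then show "\<exists>\<tau>. point_reflection (\<lambda>x y. max (log_M x y) (log_M y x)) \<tau> ((1/2) *\<^sub>R x) \<and> \<tau> 0 = x"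
    by (intro exI[of _ "log_reflection ((1/2) *\<^sub>R x)"]) simp
  show "(\<lambda>n. 2 ^ n * max (log_M ((1 / 2 ^ n) *\<^sub>R x) ((1 / 2 ^ n) *\<^sub>R y))
      (log_M ((1 / 2 ^ n) *\<^sub>R y) ((1 / 2 ^ n) *\<^sub>R x))) \<longlonglongrightarrow> norm (x - y)"
    using tendsto_max[OF log_M_dyadic_limit[of x y] log_M_dyadic_limit[of y x]]
    by (simp add: norm_eq_unit_sup[of "x - y"] max_mult_distrib_left)
qed

lemma bij_betw_jb_exp: "bij_betw jb_exp UNIV jb_pos" and bij_betw_jb_log: "bij_betw jb_log jb_pos UNIV"
  by (rule bij_betw_byWitness[where f' = jb_log], auto)
    (rule bij_betw_byWitness[where f' = jb_exp], auto)

lemma thompson_isometry_linear: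
  fixes f :: "'a::jb_algebra \<Rightarrow> 'b::jb_algebra"
  assumes f: "bij_betw f jb_pos jb_pos"
    "\<And>a b. a \<in> jb_pos \<Longrightarrow> b \<in> jb_pos \<Longrightarrow> thompson_dist (f a) (f b) = thompson_dist a b"
    "f e\<^sub>J = e\<^sub>J"
  defines "S \<equiv> \<lambda>a. jb_log (f (jb_exp a))"
  shows "bij S" "linear S" "dist (S a) (S b) = dist a b"
proof -
  have "bij_betw (jb_log \<circ> (f \<circ> jb_exp)) UNIV UNIV"
    by (intro bij_betw_trans[OF _ bij_betw_jb_log] bij_betw_trans[OF bij_betw_jb_exp f(1)])
  then show "bij S"
    by (simp add: S_def comp_def)
  have exp_S: "jb_exp (S a) = f (jb_exp a)" for a
    unfolding S_def using bij_betwE[OF f(1)] by simp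
  have "max (log_M (S a) (S b)) (log_M (S b) (S a)) = max (log_M a b) (log_M b a)" for a b
    unfolding thompson_dist_exp[symmetric] exp_S by (simp add: f(2))
  moreover have "S 0 = 0"
    using jb_log_exp[of "0 :: 'b"] by (simp add: S_def f(3))
  ultimately show "linear S" "dist (S a) (S b) = dist a b"
    using tangent_norm_isometry[OF tangent_norm_thompson tangent_norm_thompson \<open>bij S\<close>]
    unfolding dist_norm by blast+
qed

section \<open>Hilbert's metric\<close>

lemma unit_class_eq_iff: "unit_class a = unit_class b \<longleftrightarrow> (\<exists>c. a = b + c *\<^sub>R e\<^sub>J)"
  unfolding mod_unit.abs_eq_iff unit_equiv_def span_singleton
  by (auto simp: image_iff algebra_simps)

lemma unit_class_rep [simp]: "unit_class (rep_mod_unit X) = X"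
  using Quotient3_abs_rep[OF Quotient3_mod_unit] .

lemma unit_class_surj:
  obtains a where "X = unit_class a"
  using unit_class_rep[of X] by metis

lemma rep_unit_class:
  obtains c where "rep_mod_unit (unit_class a) = a + c *\<^sub>R e\<^sub>J"
  using unit_class_rep[of "unit_class a"] unfolding unit_class_eq_iff by blast

lemma unit_class_scaleR: "c *\<^sub>R unit_class a = unit_class (c *\<^sub>R a)"
  and unit_class_add: "unit_class a + unit_class b = unit_class (a + b)"
  and unit_class_diff: "unit_class a - unit_class b = unit_class (a - b)"
  and unit_class_zero: "0 = unit_class 0"
  by (simp_all add: scaleR_mod_unit.abs_eq plus_mod_unit.abs_eq minus_mod_unit.abs_eq zero_mod_unit_def)

lemma Sup_jb_spectrum: "Sup (jb_spectrum a) = unit_sup a"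
proof -
  have "bdd_above (jb_spectrum a)"
    by (simp add: bounded_imp_bdd_above compact_imp_bounded compact_jb_spectrum)
  then have "Sup (jb_spectrum a) \<le> s \<longleftrightarrow> unit_sup a \<le> s" for s
    by (simp add: cSup_le_iff jb_spectrum_nonempty unit_sup_le_iff_spectrum)
  from this[of "Sup (jb_spectrum a)"] this[of "unit_sup a"] show ?thesis
    by simp
qed

lemma Inf_jb_spectrum: "Inf (jb_spectrum a) = - unit_sup (- a)"
proof -
  have "bdd_below (jb_spectrum a)"
    by (simp add: bounded_imp_bdd_below compact_imp_bounded compact_jb_spectrum)
  moreover have "s \<le> - unit_sup (- a) \<longleftrightarrow> (\<forall>t\<in>jb_spectrum a. s \<le> t)" for s
    using unit_sup_le_iff[of "- a" "- s"] jpoly_in_order_cone_iff[of "[:- s, 1:]" a]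
    by (simp add: le_minus_iff)
  ultimately have "s \<le> Inf (jb_spectrum a) \<longleftrightarrow> s \<le> - unit_sup (- a)" for s
    by (simp add: le_cInf_iff jb_spectrum_nonempty)
  from this[of "Inf (jb_spectrum a)"] this[of "- unit_sup (- a)"] show ?thesis
    by simp
qed

lemma var_norm_unit_class: "var_norm (unit_class a) = unit_sup a + unit_sup (- a)"
proof -
  have "Sup (jb_spectrum b) - Inf (jb_spectrum b) = unit_sup a + unit_sup (- a)"
    if eq: "unit_class b = unit_class a" for b
  proof -
    obtain c where b: "b = a + c *\<^sub>R e\<^sub>J"
      using eq unfolding unit_class_eq_iff by blast
    have "unit_sup (- b) = unit_sup (- a) - c"
      using unit_sup_add_unit[of "- a" "- c"] by (simp add: b)
    then show ?thesis
      by (simp add: Sup_jb_spectrum Inf_jb_spectrum) (simp add: b)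
  qed
  then show ?thesis
    unfolding var_norm_def by (intro the_equality) auto
qed

text \<open>The representatives do not matter: shifting one by \<open>c *\<^sub>R e\<^sub>J\<close>
  changes the two summands by opposite amounts.\<close>

definition hilbert_log_dist :: "'a::jb_algebra mod_unit \<Rightarrow> 'a mod_unit \<Rightarrow> real" where
  "hilbert_log_dist X Y = log_M (rep_mod_unit X) (rep_mod_unit Y) + log_M (rep_mod_unit Y) (rep_mod_unit X)"

lemma hilbert_log_dist_unit_class:
  "hilbert_log_dist (unit_class a) (unit_class b) = log_M a b + log_M b a"
  by (rule rep_unit_class[of a], rule rep_unit_class[of b]) (simp add: hilbert_log_dist_def)

lemma tangent_norm_hilbert: "tangent_norm (var_norm :: 'a::jb_algebra mod_unit \<Rightarrow> real) hilbert_log_dist"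
proof (intro tangent_norm.intro real_norm.intro tangent_norm_axioms.intro)
  fix X Y :: "'a mod_unit" and c :: real
  obtain x y where x: "X = unit_class x" and y: "Y = unit_class y"
    using unit_class_surj by metis
  show "var_norm (X + Y) \<le> var_norm X + var_norm Y"
    using unit_sup_add[of x y] unit_sup_add[of "- x" "- y"]
    by (simp add: x y unit_class_add var_norm_unit_class)
  show "var_norm (c *\<^sub>R X) = \<bar>c\<bar> * var_norm X"
  proof -
    consider "0 < c" | "c = 0" | "0 < - c" by linarith
    then show ?thesis
    proof cases
      case 1
      then show ?thesis
        using unit_sup_scaleR[OF 1, of x] unit_sup_scaleR[OF 1, of "- x"]
        by (simp add: x unit_class_scaleR var_norm_unit_class distrib_left)
    next
      case 3
      then show ?thesis
        using unit_sup_scaleR[OF 3, of x] unit_sup_scaleR[OF 3, of "- x"]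
        by (simp add: x unit_class_scaleR var_norm_unit_class distrib_left)
    qed (simp add: x unit_class_scaleR var_norm_unit_class)
  qed
  show "X = 0" if "var_norm X = 0"
  proof -
    have "unit_sup (- x) = - unit_sup x"
      using that by (simp add: x var_norm_unit_class)
    then have "- (unit_sup x *\<^sub>R e\<^sub>J - x) \<in> order_cone"
      using unit_sup_attained[of "- x"] by simp
    then have "unit_sup x *\<^sub>R e\<^sub>J - x = 0"
      by (rule order_cone_antisym[OF unit_sup_attained])
    then have "x = 0 + unit_sup x *\<^sub>R e\<^sub>J" by simp
    then show ?thesis
      unfolding x unit_class_zero unit_class_eq_iff by blast
  qed
  show "Metric_space UNIV (hilbert_log_dist :: 'a mod_unit \<Rightarrow> _)"
  proof
    fix X Y Z :: "'a mod_unit"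
    obtain x y z where x: "X = unit_class x" and y: "Y = unit_class y" and z: "Z = unit_class z"
      using unit_class_surj by metis
    note [simp] = x y z hilbert_log_dist_unit_class
    show "0 \<le> hilbert_log_dist X Y"
      by (simp add: log_M_sum_nonneg)
    show "hilbert_log_dist X Y = hilbert_log_dist Y X"
      by simp
    show "hilbert_log_dist X Z \<le> hilbert_log_dist X Y + hilbert_log_dist Y Z"
      using log_M_triangle[of x z y] log_M_triangle[of z x y] by simp
    show "hilbert_log_dist X Y = 0 \<longleftrightarrow> X = Y"
    proof
      assume "hilbert_log_dist X Y = 0"
      \<comment> \<open>The two values of \<open>log_M\<close> are opposite, so shifting
        \<open>y\<close> by the first one annihilates both.\<close>
      then have "x = y + log_M x y *\<^sub>R e\<^sub>J"
        by (intro log_M_antisym) simp_all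
      then show "X = Y"
        unfolding x y unit_class_eq_iff by blast
    qed simp
  qed
  show "\<exists>\<tau>. point_reflection hilbert_log_dist \<tau> ((1/2) *\<^sub>R X) \<and> \<tau> 0 = X"
  proof -
    define v where "v = (1/2) *\<^sub>R x"
    \<comment> \<open>This descends to classes since by \<open>log_reflection_add_unit\<close> a
      shift of the argument by the unit only changes sign.\<close>
    define \<tau> where "\<tau> U = unit_class (log_reflection v (rep_mod_unit U))" for U
    have \<tau>: "\<tau> (unit_class u) = unit_class (log_reflection v u)" for u
    proof -
      obtain c where "rep_mod_unit (unit_class u) = u + c *\<^sub>R e\<^sub>J"
        by (rule rep_unit_class)
      then show ?thesis
        unfolding \<tau>_def unit_class_eq_iff by (intro exI[of _ "- c"]) (simp add: log_reflection_add_unit)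
    qed
    have "point_reflection hilbert_log_dist \<tau> (unit_class v)"
      unfolding point_reflection_def
    proof (intro conjI allI)
      fix U V :: "'a mod_unit"
      obtain u w where u: "U = unit_class u" and w: "V = unit_class w"
        using unit_class_surj by metis
      show "\<tau> (\<tau> U) = U" "hilbert_log_dist (\<tau> U) (\<tau> V) = hilbert_log_dist U V"
        "2 * hilbert_log_dist U (unit_class v) \<le> hilbert_log_dist (\<tau> U) U"
        by (simp_all add: u w \<tau> hilbert_log_dist_unit_class log_M_reflection_self)
    qed (simp add: \<tau>)
    moreover have "\<tau> 0 = X"
      by (simp add: unit_class_zero \<tau> x v_def)
    moreover have "(1/2) *\<^sub>R X = unit_class v"
      by (simp add: x v_def unit_class_scaleR)
    ultimately show ?thesis by auto
  qed
  show "(\<lambda>n. 2 ^ n * hilbert_log_dist ((1 / 2 ^ n) *\<^sub>R X) ((1 / 2 ^ n) *\<^sub>R Y)) \<longlonglongrightarrow> var_norm (X - Y)"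
    using tendsto_add[OF log_M_dyadic_limit[of x y] log_M_dyadic_limit[of y x]]
    by (simp add: x y unit_class_scaleR unit_class_diff hilbert_log_dist_unit_class var_norm_unit_class
        distrib_left)
qed

section \<open>Rays of the cone and classes modulo the unit\<close>

lemma ray_scaleR: "0 < c \<Longrightarrow> ray (c *\<^sub>R a) = ray a"
  unfolding ray_def
proof (intro Collect_cong iffI; elim exE conjE)
  fix x d assume "0 < c" "x = d *\<^sub>R c *\<^sub>R a" "0 < d"
  then show "\<exists>d. x = d *\<^sub>R a \<and> 0 < d" by (intro exI[of _ "d * c"]) simp
next
  fix x d assume "0 < c" "x = d *\<^sub>R a" "0 < d"
  then show "\<exists>d. x = d *\<^sub>R c *\<^sub>R a \<and> 0 < d" by (intro exI[of _ "d / c"]) simp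
qed

text \<open>Every positive scalar is \<open>exp c\<close> for some real \<open>c\<close>. Statements
  about all representatives of a ray thereby become statements about shifts by the unit.\<close>

lemma ray_jb_exp: "ray (jb_exp a) = {jb_exp (a + c *\<^sub>R e\<^sub>J) |c. True}"
proof (intro equalityI subsetI)
  fix x assume "x \<in> ray (jb_exp a)"
  then obtain c where "x = c *\<^sub>R jb_exp a" "0 < c"
    unfolding ray_def by blast
  then have "x = jb_exp (a + ln c *\<^sub>R e\<^sub>J)"
    by (simp add: jb_exp_add_unit)
  then show "x \<in> {jb_exp (a + c *\<^sub>R e\<^sub>J) |c. True}" by blast
next
  fix x assume "x \<in> {jb_exp (a + c *\<^sub>R e\<^sub>J) |c. True}"
  then obtain c where "x = exp c *\<^sub>R jb_exp a"
    unfolding jb_exp_add_unit by blast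
  then show "x \<in> ray (jb_exp a)"
    unfolding ray_def using exp_gt_zero[of c] by blast
qed

lemma exp_class_unit_class: "exp_class (unit_class a) = ray (jb_exp a)"
proof -
  have same: "ray (jb_exp a) = ray (jb_exp b)" if eq: "unit_class b = unit_class a" for b
  proof -
    obtain c where "b = a + c *\<^sub>R e\<^sub>J"
      using eq unfolding unit_class_eq_iff by blast
    then show ?thesis
      by (simp add: jb_exp_add_unit ray_scaleR)
  qed
  show ?thesis
    unfolding exp_class_def
  proof (rule the_equality)
    show "R = ray (jb_exp a)" if "\<forall>b. unit_class b = unit_class a \<longrightarrow> R = ray (jb_exp b)" for R
      using that by blast
  qed (intro allI impI same)
qed

lemma log_ray_exp: "log_ray (ray (jb_exp a)) = unit_class a"
proof -
  have "unit_class (jb_log b) = unit_class a" if "b \<in> ray (jb_exp a)" for b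
    using that unfolding ray_jb_exp by (auto simp: unit_class_eq_iff)
  moreover have "jb_exp a \<in> ray (jb_exp a)"
    unfolding ray_jb_exp by (auto intro: exI[of _ 0])
  ultimately show ?thesis
    unfolding log_ray_def by (intro the_equality) auto
qed

lemma log_ray_exp_class [simp]: "log_ray (exp_class X) = X"
  by (rule unit_class_surj[of X]) (simp add: exp_class_unit_class log_ray_exp)

lemma exp_class_in_jb_rays [simp]: "exp_class X \<in> jb_rays"
  by (rule unit_class_surj[of X]) (simp add: exp_class_unit_class jb_rays_def)

lemma exp_class_log_ray [simp]:
  assumes "R \<in> jb_rays"
  shows "exp_class (log_ray R) = R"
proof -
  obtain b where b: "b \<in> jb_pos" "R = ray b"
    using assms by (auto simp: jb_rays_def)
  then have "R = ray (jb_exp (jb_log b))" by simp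
  then show ?thesis by (simp only: log_ray_exp exp_class_unit_class)
qed

lemma bij_betw_exp_class: "bij_betw exp_class UNIV jb_rays"
  and bij_betw_log_ray: "bij_betw log_ray jb_rays UNIV"
  by (rule bij_betw_byWitness[where f' = log_ray], auto)
    (rule bij_betw_byWitness[where f' = exp_class], auto)

lemma hilbert_dist_exp_class: "hilbert_dist (exp_class X) (exp_class Y) = hilbert_log_dist X Y"
proof -
  obtain x y where x: "X = unit_class x" and y: "Y = unit_class y"
    using unit_class_surj by metis
  have *: "ln (jb_M a b * jb_M b a) = log_M x y + log_M y x"
    if "a \<in> ray (jb_exp x)" "b \<in> ray (jb_exp y)" for a b
    using that unfolding ray_jb_exp by (auto simp: jb_M_exp simp flip: exp_add)
  have "jb_exp x \<in> ray (jb_exp x)" "jb_exp y \<in> ray (jb_exp y)"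
    unfolding ray_jb_exp by (auto intro: exI[of _ 0])
  with * have "hilbert_dist (ray (jb_exp x)) (ray (jb_exp y)) = log_M x y + log_M y x"
    unfolding hilbert_dist_def by (intro the_equality) auto
  then show ?thesis
    by (simp add: x y exp_class_unit_class hilbert_log_dist_unit_class)
qed

lemma hilbert_isometry_linear:
  fixes f :: "'a::jb_algebra set \<Rightarrow> 'b::jb_algebra set"
  assumes f: "bij_betw f jb_rays jb_rays"
    "\<And>Q R. Q \<in> jb_rays \<Longrightarrow> R \<in> jb_rays \<Longrightarrow> hilbert_dist (f Q) (f R) = hilbert_dist Q R"
    "f (ray e\<^sub>J) = ray e\<^sub>J"
  defines "S \<equiv> \<lambda>X. log_ray (f (exp_class X))"
  shows "bij S" "linear S" "var_norm (S X - S Y) = var_norm (X - Y)"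
proof -
  have "bij_betw (log_ray \<circ> (f \<circ> exp_class)) UNIV UNIV"
    by (intro bij_betw_trans[OF _ bij_betw_log_ray] bij_betw_trans[OF bij_betw_exp_class f(1)])
  then show "bij S"
    by (simp add: S_def comp_def)
  have exp_S: "exp_class (S X) = f (exp_class X)" for X
    unfolding S_def using bij_betwE[OF f(1)] by simp
  have "hilbert_log_dist (S X) (S Y) = hilbert_log_dist X Y" for X Y
    unfolding hilbert_dist_exp_class[symmetric] exp_S by (simp add: f(2))
  moreover have "S 0 = 0"
    using log_ray_exp[of "0 :: 'b"] exp_class_unit_class[of "0 :: 'a"]
    by (simp add: S_def f(3) flip: unit_class_zero)
  ultimately show "linear S" "var_norm (S X - S Y) = var_norm (X - Y)"
    using tangent_norm_isometry[OF tangent_norm_hilbert tangent_norm_hilbert \<open>bij S\<close>] by blast+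
qed

theorem theorem2p17:
  shows "(\<forall>f :: 'a::jb_algebra \<Rightarrow> 'b::jb_algebra.
            bij_betw f jb_pos jb_pos \<and>
            (\<forall>a\<in>jb_pos. \<forall>b\<in>jb_pos. thompson_dist (f a) (f b) = thompson_dist a b) \<and>
            f e\<^sub>J = e\<^sub>J \<longrightarrow>
            (let S = (\<lambda>a. jb_log (f (jb_exp a))) in
              bij S \<and> linear S \<and> (\<forall>a b. dist (S a) (S b) = dist a b)))
       \<and> (\<forall>f :: 'a set \<Rightarrow> 'b set.
            bij_betw f jb_rays jb_rays \<and>
            (\<forall>R\<in>jb_rays. \<forall>R'\<in>jb_rays. hilbert_dist (f R) (f R') = hilbert_dist R R') \<and>
            f (ray e\<^sub>J) = ray e\<^sub>J \<longrightarrow>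
            (let S = (\<lambda>x. log_ray (f (exp_class x))) in
              bij S \<and> linear S \<and> (\<forall>x y. var_norm (S x - S y) = var_norm (x - y))))"
  unfolding Let_def using thompson_isometry_linear hilbert_isometry_linear by metis

end
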